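(* Let $a\in(1/2,\infty)$ be such that $B(s_0(a))^2>2K(a)^2$. If $\phi_a(s)>0$ for every $s\in[0,s_0(a)]$, then $r'(a)>0$ and $\mu_2(0)>0$.
   Context: $\mathbb{H}^3$ is the hyperboloid model in $\mathbb{R}^4$ with $\langle x,y\rangle_L=-x_0y_0+x_1y_1+x_2y_2+x_3y_3$. For $a>1/2$ put $A(s)=\sqrt{a\cosh(2s)+\tfrac12}$, $B(s)=\sqrt{a\cosh(2s)-\tfrac12}$, $K=K(a)=\sqrt{a^2-\tfrac14}$, and $\varphi(s)=\int_0^s\frac{K}{A(t)^2B(t)}\,dt$. Let $s_0=s_0(a)>0$ be the unique positive solution of $\tanh\varphi(s_0)=\frac{B(s_0)K}{a\sinh(2s_0)}$, and let $r(a)>0$ be defined by $\cosh r(a)=A(s_0)\cosh\varphi(s_0)$; $r$ is real-analytic in $a$. The critical spherical catenoid is $\Sigma_a=X_a([-s_0,s_0]\times S^1)$, $X_a(s,\theta)=(A\cosh\varphi,A\sinh\varphi,B\cos\theta,B\sin\theta)$, a free boundary minimal surface in the geodesic ball of radius $r(a)$ centered at $(1,0,0,0)$, with induced metric $ds^2+B^2d\theta^2$ and $|\mathrm{II}|^2=2K^2/B^4$. Parametric Jacobi field: $\phi_a:=\langle\partial_aX_a,\nu_a\rangle_L$, where $\partial_a$ is taken at fixed $(s,\theta)$ and $\nu_a=\bigl(\tfrac{K\cosh\varphi}{A}-\tfrac{a\sinh(2s)\sinh\varphi}{AB},\ \tfrac{K\sinh\varphi}{A}-\tfrac{a\sinh(2s)\cosh\varphi}{AB},\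 \tfrac{K}{B}\cos\theta,\ \tfrac{K}{B}\sin\theta\bigr)$ is the unit normal; $\phi_a$ depends only on $s$. $\mu_n(0)$, $n\ge0$, is the $(n+1)$-th eigenvalue (increasing, with multiplicity) on $H^1((-s_0,s_0))$ of $\mathcal{S}_0^{\mathrm{rad}}(u,u)=\int_{-s_0}^{s_0}[B(u')^2-B(|\mathrm{II}|^2-2)u^2]ds-\coth r(a)B(s_0)[u(s_0)^2+u(-s_0)^2]$ relative to the norm $\int_{-s_0}^{s_0}Bu^2ds$. *)

theory Defs
  imports "HOL-Analysis.Analysis" "HOL-Library.Function_Algebras"
begin

definition catA :: "real \<Rightarrow> real \<Rightarrow> real" where
  "catA a s = sqrt (a * cosh (2 * s) + 1 / 2)"

definition catB :: "real \<Rightarrow> real \<Rightarrow> real" where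
  "catB a s = sqrt (a * cosh (2 * s) - 1 / 2)"

definition catK :: "real \<Rightarrow> real" where
  "catK a = sqrt (a\<^sup>2 - 1 / 4)"

text \<open>The interval integral is oriented, so this is also the intended (odd) function for negative \<open>s\<close>.\<close>

definition cat_phi :: "real \<Rightarrow> real \<Rightarrow> real" where
  "cat_phi a s = (LBINT t=0..s. catK a / ((catA a t)\<^sup>2 * catB a t))"

definition cat_s0 :: "real \<Rightarrow> real" where
  "cat_s0 a = (THE s. s > 0 \<and> tanh (cat_phi a s) = catB a s * catK a / (a * sinh (2 * s)))"

definition cat_r :: "real \<Rightarrow> real" where
  "cat_r a = (THE \<rho>. \<rho> > 0 \<and> cosh \<rho> = catA a (cat_s0 a) * cosh (cat_phi a (cat_s0 a)))"

text \<open>Coordinates \<open>x\<^sub>0, x\<^sub>1, x\<^sub>2, x\<^sub>3\<close> of Minkowski space are the components \<open>1, 2, 3, 4\<close>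
  of a vector in \<open>real ^ 4\<close>; the timelike one is component \<open>1\<close>.\<close>

definition lorentz :: "real ^ 4 \<Rightarrow> real ^ 4 \<Rightarrow> real" where
  "lorentz x y = - (x $ 1) * y $ 1 + x $ 2 * y $ 2 + x $ 3 * y $ 3 + x $ 4 * y $ 4"

definition cat_X :: "real \<Rightarrow> real \<Rightarrow> real \<Rightarrow> real ^ 4" where
  "cat_X a s \<theta> = vector
     [catA a s * cosh (cat_phi a s), catA a s * sinh (cat_phi a s),
      catB a s * cos \<theta>, catB a s * sin \<theta>]"

definition cat_nu :: "real \<Rightarrow> real \<Rightarrow> real \<Rightarrow> real ^ 4" where
  "cat_nu a s \<theta> = vector
     [catK a * cosh (cat_phi a s) / catA a s
        - a * sinh (2 * s) * sinh (cat_phi a s) / (catA a s * catB a s),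
      catK a * sinh (cat_phi a s) / catA a s
        - a * sinh (2 * s) * cosh (cat_phi a s) / (catA a s * catB a s),
      catK a / catB a s * cos \<theta>, catK a / catB a s * sin \<theta>]"

text \<open>The value of the Jacobi field does not depend on \<open>\<theta>\<close>, which is kept as an argument
  because \<open>X\<^sub>a\<close> and \<open>\<nu>\<^sub>a\<close> are functions of \<open>(s, \<theta>)\<close>.\<close>

definition jacobi_field :: "real \<Rightarrow> real \<Rightarrow> real \<Rightarrow> real" where
  "jacobi_field a s \<theta> =
     lorentz (vector_derivative (\<lambda>b. cat_X b s \<theta>) (at a)) (cat_nu a s \<theta>)"

definition cat_II_sq :: "real \<Rightarrow> real \<Rightarrow> real" where
  "cat_II_sq a s = 2 * (catK a)\<^sup>2 / catB a s ^ 4"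

text \<open>An element of \<open>H\<^sup>1((-l, l))\<close> is represented by its absolutely continuous representative
  on \<open>[-l, l]\<close>, i.e. by a primitive of an \<open>L\<^sup>2\<close> function, so that the boundary values
  \<open>u(l)\<close>, \<open>u(-l)\<close> make sense. It is extended by \<open>0\<close> to the real line: otherwise one element of
  \<open>H\<^sup>1\<close> would have many representatives and dimensions would be wrong.\<close>

definition has_weak_deriv :: "real \<Rightarrow> (real \<Rightarrow> real) \<Rightarrow> (real \<Rightarrow> real) \<Rightarrow> bool" where
  "has_weak_deriv l u g \<longleftrightarrow>
     set_borel_measurable lborel {-l..l} g \<and>
     set_integrable lborel {-l..l} (\<lambda>x. (g x)\<^sup>2) \<and>
     (\<forall>x\<in>{-l..l}. u x = u (-l) + (LINT t:{-l..x}|lborel. g t))"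

definition H1 :: "real \<Rightarrow> (real \<Rightarrow> real) set" where
  "H1 l = {u. (\<exists>g. has_weak_deriv l u g) \<and> (\<forall>x. x \<notin> {-l..l} \<longrightarrow> u x = 0)}"

text \<open>The weak derivative is unique up to null sets.\<close>

definition weak_deriv :: "real \<Rightarrow> (real \<Rightarrow> real) \<Rightarrow> real \<Rightarrow> real" where
  "weak_deriv l u = (SOME g. has_weak_deriv l u g)"

text \<open>The bilinear polarization of the radial quadratic form; \<open>cosh r / sinh r\<close> is \<open>coth r\<close>.\<close>

definition S_rad :: "real \<Rightarrow> (real \<Rightarrow> real) \<Rightarrow> (real \<Rightarrow> real) \<Rightarrow> real" where
  "S_rad a u v = (let l = cat_s0 a in
     (LINT s:{-l..l}|lborel.
        catB a s * (weak_deriv l u s * weak_deriv l v s)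
        - catB a s * (cat_II_sq a s - 2) * (u s * v s))
     - cosh (cat_r a) / sinh (cat_r a) * catB a l * (u l * v l + u (-l) * v (-l)))"

definition B_inner :: "real \<Rightarrow> (real \<Rightarrow> real) \<Rightarrow> (real \<Rightarrow> real) \<Rightarrow> real" where
  "B_inner a u v = (LINT s:{- cat_s0 a..cat_s0 a}|lborel. catB a s * (u s * v s))"

definition eigenspace :: "real \<Rightarrow> real \<Rightarrow> (real \<Rightarrow> real) set" where
  "eigenspace a \<kappa> =
     {u \<in> H1 (cat_s0 a). \<forall>v \<in> H1 (cat_s0 a). S_rad a u v = \<kappa> * B_inner a u v}"

definition is_eigenvalue :: "real \<Rightarrow> real \<Rightarrow> bool" where
  "is_eigenvalue a \<kappa> \<longleftrightarrow> (\<exists>u \<in> eigenspace a \<kappa>. u \<noteq> (\<lambda>x. 0))"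

interpretation fun_space: vector_space "\<lambda>(c::real) (u::real \<Rightarrow> real) x. c * u x"
  by unfold_locales (auto simp: fun_eq_iff algebra_simps)

definition multiplicity_of :: "real \<Rightarrow> real \<Rightarrow> nat" where
  "multiplicity_of a \<kappa> = fun_space.dim (eigenspace a \<kappa>)"

text \<open>\<open>\<mu>\<close> is number \<open>n\<close>, counting from \<open>0\<close>, in the increasing list of eigenvalues repeated
  according to multiplicity: at most \<open>n\<close> entries lie strictly below \<open>\<mu>\<close> and more than \<open>n\<close>
  entries are at most \<open>\<mu>\<close>. A sum over an infinite set is \<open>0\<close>, so the last condition also forces
  the set of eigenvalues at most \<open>\<mu>\<close> to be finite.\<close>

definition is_nth_eigenvalue :: "real \<Rightarrow> nat \<Rightarrow> real \<Rightarrow> bool" where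
  "is_nth_eigenvalue a n \<mu> \<longleftrightarrow>
     is_eigenvalue a \<mu> \<and>
     (\<Sum>\<kappa> | is_eigenvalue a \<kappa> \<and> \<kappa> < \<mu>. multiplicity_of a \<kappa>) \<le> n \<and>
     n < (\<Sum>\<kappa> | is_eigenvalue a \<kappa> \<and> \<kappa> \<le> \<mu>. multiplicity_of a \<kappa>)"

definition mu_rad :: "real \<Rightarrow> nat \<Rightarrow> real" where
  "mu_rad a n = (THE \<mu>. is_nth_eigenvalue a n \<mu>)"

end

theory Submission
  imports Defs
begin

text \<open>
The two conclusions have separate reasons.

The radius. Let \<open>m = B(s\<^sub>0)\<^sup>2\<close>, as a function of \<open>a\<close>. Squaring the free boundary equation
gives \<open>tanh\<^sup>2 \<phi> = K\<^sup>2 m / (m\<^sup>2 + m - K\<^sup>2)\<close> at \<open>s\<^sub>0\<close>, and therefore \<open>cosh\<^sup>2 r = 1 + m\<^sup>2 / (m - K\<^sup>2)\<close>: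
the radius depends on \<open>a\<close> only through \<open>m\<close> and \<open>K\<^sup>2\<close>. Differentiating the first relation along the
free boundary curve and expressing the parameter derivative of \<open>\<phi>\<close> through the Jacobi field \<open>\<phi>\<^sub>a\<close>
yields \<open>K\<^sup>2 m' = 2 a m + 2 K (m - K\<^sup>2) \<phi>\<^sub>a(s\<^sub>0)\<close> (\<open>boundary_m_deriv\<close>). So positivity of \<open>\<phi>\<^sub>a(s\<^sub>0)\<close> makes \<open>m\<close>
increasing, and the derivative of \<open>m\<^sup>2 / (m - K\<^sup>2)\<close> has the sign of \<open>m' (m - 2 K\<^sup>2) + 2 a m\<close>, which is
positive when \<open>m > 2 K\<^sup>2\<close>. Geometrically, \<open>K / B = cos \<alpha>\<close> at \<open>s\<^sub>0\<close>, where \<open>\<alpha>\<close> is the polar angle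
of the boundary circle on the sphere; positivity of \<open>\<phi>\<^sub>a\<close> says that \<open>\<alpha>\<close> increases, and
\<open>m > 2 K\<^sup>2\<close> says that \<open>\<alpha> > \<pi>/4\<close>. The curve \<open>s\<^sub>0(a)\<close> is differentiable by the inverse function
theorem, because the defect of the free boundary equation has positive derivative in \<open>s\<close>.

The eigenvalue. Since \<open>\<phi>\<^sub>a\<close> is even in \<open>s\<close>, it is a positive solution of the Jacobi equation
\<open>(B f')' + B (|II|\<^sup>2 - 2) f = 0\<close> on all of \<open>[-s\<^sub>0, s\<^sub>0]\<close>. Dividing by it
(\<open>positive_jacobi_coercive\<close>) shows that the quadratic form is positive on every nonzero function that
vanishes at \<open>\<plusminus>s\<^sub>0\<close>. These are two linear conditions, so the eigenvalues that are at most \<open>0\<close>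
have total multiplicity at most two, and the third eigenvalue is positive.

This argument presupposes that there is a third eigenvalue and that it is unique, that is, the
discreteness and the infinitude of the spectrum. Discreteness is the same counting argument for an
arbitrary level \<open>\<lambda>\<close>: functions that vanish on a fine enough grid have a quadratic form larger than
\<open>\<lambda>\<close> times the squared norm (\<open>coercive_exists\<close>). Infinitude comes from shooting: the
Liouville substitution \<open>w = \<surd>B u\<close> turns the eigenvalue equation into \<open>w'' + (k\<^sup>2 + q) w = 0\<close>; for large
\<open>k\<close> this is a contraction problem whose solution is close to an explicit oscillation, and the
boundary condition at the right end is met by the intermediate value theorem (\<open>infinite_spec\<close>).
\<close>

section \<open>Primitives of integrable functions on an interval\<close>

lemma set_integrable_subinterval:
  fixes f :: "real \<Rightarrow> real"
  assumes "set_integrable lborel {a..b} f" "a \<le> c" "d \<le> b"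
  shows "set_integrable lborel {c..d} f"
  by (rule set_integrable_subset[OF assms(1)]) (use assms in auto)

lemma primitive_diff:
  fixes f :: "real \<Rightarrow> real"
  assumes "set_integrable lborel {a..b} f" "a \<le> x" "x \<le> y" "y \<le> b"
  shows "(LINT t:{a..y}|lborel. f t) = (LINT t:{a..x}|lborel. f t) + (LINT t:{x..y}|lborel. f t)"
proof -
  have i: "set_integrable lborel {c..d} f" if "a \<le> c" "d \<le> b" for c d
    using set_integrable_subinterval[OF assms(1)] that by blast
  have "integral {a..x} f + integral {x..y} f = integral {a..y} f"
    using assms i[of a y] set_borel_integral_eq_integral(1)
    by (intro Henstock_Kurzweil_Integration.integral_combine) auto
  then show ?thesis using assms i
    by (simp add: set_borel_integral_eq_integral(2))
qed

lemma primitive_continuous: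
  fixes f :: "real \<Rightarrow> real"
  assumes "set_integrable lborel {a..b} f"
      and "\<And>x. x \<in> {a..b} \<Longrightarrow> F x = F a + (LINT t:{a..x}|lborel. f t)"
  shows "continuous_on {a..b} F"
proof -
  have "f integrable_on {a..b}" using set_borel_integral_eq_integral(1)[OF assms(1)] .
  then have "continuous_on {a..b} (\<lambda>x. F a + integral {a..x} f)"
    by (intro continuous_intros indefinite_integral_continuous_1)
  moreover have "F a + integral {a..x} f = F x" if "x \<in> {a..b}" for x
    using assms(2)[OF that] that
      set_borel_integral_eq_integral(2)[OF set_integrable_subinterval[OF assms(1)], of a x] by simp
  ultimately show ?thesis using continuous_on_cong by (metis (mono_tags, lifting))
qed

lemma set_integrable_mult_continuous:
  fixes f :: "real \<Rightarrow> real"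
  assumes "set_integrable lborel {a..b} f" "continuous_on {a..b} G"
  shows "set_integrable lborel {a..b} (\<lambda>t. G t * f t)"
proof -
  have "compact (G ` {a..b})" using assms(2) by (intro compact_continuous_image) auto
  then obtain C where C: "\<And>x. x \<in> {a..b} \<Longrightarrow> \<bar>G x\<bar> \<le> C"
    using compact_imp_bounded bounded_iff by (metis (no_types, lifting) imageI real_norm_def)
  have mG: "(\<lambda>t. indicator {a..b} t * G t) \<in> borel_measurable lborel"
    using borel_measurable_continuous_on_indicator[OF _ assms(2)] by simp
  have mf: "integrable lborel (\<lambda>t. indicator {a..b} t * f t)" using assms(1) unfolding set_integrable_def by simp
  have "integrable lborel (\<lambda>t. (indicator {a..b} t * G t) * (indicator {a..b} t * f t))"
  proof (rule Bochner_Integration.integrable_bound[OF integrable_mult_left[OF mf, of C]])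
    show "(\<lambda>t. (indicator {a..b} t * G t) * (indicator {a..b} t * f t)) \<in> borel_measurable lborel"
      using mG borel_measurable_integrable[OF mf] by (rule borel_measurable_times)
    show "AE t in lborel. norm ((indicator {a..b} t * G t) * (indicator {a..b} t * f t))
       \<le> norm (indicator {a..b} t * f t * C)"
    proof (rule AE_I2)
      fix t
      have "\<bar>G t\<bar> * \<bar>f t\<bar> \<le> \<bar>f t\<bar> * \<bar>C\<bar>" if "t \<in> {a..b}"
        using mult_right_mono[of "\<bar>G t\<bar>" "\<bar>C\<bar>" "\<bar>f t\<bar>"] C[OF that] by (simp add: mult.commute)
      then show "norm ((indicator {a..b} t * G t) * (indicator {a..b} t * f t))
       \<le> norm (indicator {a..b} t * f t * C)" by (auto simp: indicator_def abs_mult)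
    qed
  qed
  moreover have "(indicator {a..b} t * G t) * (indicator {a..b} t * f t) = indicator {a..b} t * (G t * f t)" for t :: real
    by (auto simp: indicator_def)
  ultimately show ?thesis unfolding set_integrable_def by simp
qed

text \<open>The sets on which the integral of \<open>h\<close> vanishes form a Dynkin system that contains the rays, hence
all Borel sets.\<close>

lemma primitive_zero_AE:
  fixes h :: "real \<Rightarrow> real"
  assumes int: "set_integrable lborel {a..b} h"
    and zero: "\<And>x. x \<in> {a..b} \<Longrightarrow> (LINT t:{a..x}|lborel. h t) = 0"
  shows "AE x in lborel. x \<in> {a..b} \<longrightarrow> h x = 0"
proof -
  define k where "k = (\<lambda>t. indicator {a..b} t * h t)"
  have k: "integrable lborel k" using int unfolding set_integrable_def k_def by simp
  have ray: "set_lebesgue_integral lborel {..x} k = 0" for x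
  proof -
    have "set_lebesgue_integral lborel {..x} k = set_lebesgue_integral lborel {a..min x b} h"
      unfolding set_lebesgue_integral_def k_def
      by (rule Bochner_Integration.integral_cong) (auto simp: indicator_def)
    also have "\<dots> = 0"
    proof (cases "a \<le> min x b")
      case True then show ?thesis using zero[of "min x b"] by simp
    next
      case False then have "{a..min x b} = {}" by auto
      then show ?thesis by (simp add: set_lebesgue_integral_def)
    qed
    finally show ?thesis .
  qed
  have total: "set_lebesgue_integral lborel UNIV k = 0"
  proof -
    have "set_lebesgue_integral lborel UNIV k = set_lebesgue_integral lborel {..b} k"
      unfolding set_lebesgue_integral_def k_def
      by (rule Bochner_Integration.integral_cong) (auto simp: indicator_def)
    then show ?thesis using ray by simp
  qed
  have ki: "set_integrable lborel A k" if "A \<in> sets lborel" for A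
    using that k by (metis integrable_mult_indicator set_integrable_def)
  have all: "set_lebesgue_integral lborel A k = 0" if "A \<in> sets lborel" for A
  proof -
    have A: "A \<in> sigma_sets UNIV (range atMost)" using that
      by (metis borel_eq_atMost sets_lborel sets_measure_of subset_UNIV Pow_UNIV)
    have "Int_stable (range (atMost :: real \<Rightarrow> real set))"
      by (auto simp: Int_stable_def)
    then show ?thesis
      using subset_UNIV[of "range atMost", folded Pow_UNIV] A
    proof (induction rule: sigma_sets_induct_disjoint[consumes 3, case_names Basic Empty Compl Union'])
      case (Basic A) then show ?case using ray by auto
    next
      case Empty show ?case by (simp add: set_lebesgue_integral_def)
    next
      case (Compl A)
      then have A: "A \<in> sets lborel"
        by (metis borel_eq_atMost sets_lborel sets_measure_of subset_UNIV Pow_UNIV)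
      have "set_lebesgue_integral lborel (A \<union> (UNIV - A)) k = set_lebesgue_integral lborel A k + set_lebesgue_integral lborel (UNIV - A) k"
        using A by (intro set_integral_Un ki) auto
      then show ?case using Compl total by (simp add: Un_UNIV_right)
    next
      case (Union' A)
      have A: "A i \<in> sets lborel" for i
        using Union'(2)
        by (metis borel_eq_atMost sets_lborel sets_measure_of subset_UNIV Pow_UNIV range_subsetD)
      have "set_lebesgue_integral lborel (\<Union>i. A i) k = (\<Sum>i. set_lebesgue_integral lborel (A i) k)"
        using A Union'(1) by (intro lebesgue_integral_countable_add ki) (auto simp: disjoint_family_on_def)
      then show ?case using Union' by simp
    qed
  qed
  have "AE x in lborel. k x = 0" by (rule sigma_finite_measure.density_zero[OF lborel.sigma_finite_measure_axioms, OF k all])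
  then show ?thesis by eventually_elim (auto simp: k_def)
qed

text \<open>The product rule for absolutely continuous functions. It is Fubini's theorem for \<open>f(s) g(t)\<close> on the
square: the two summands are the integrals over the triangles \<open>t < s\<close> and \<open>s \<le> t\<close>.\<close>

lemma product_of_primitives:
  fixes f g F G :: "real \<Rightarrow> real"
  assumes f: "set_integrable lborel {a..b} f" and g: "set_integrable lborel {a..b} g"
    and F: "\<And>x. x \<in> {a..b} \<Longrightarrow> F x = F a + (LINT t:{a..x}|lborel. f t)"
    and G: "\<And>x. x \<in> {a..b} \<Longrightarrow> G x = G a + (LINT t:{a..x}|lborel. g t)"
    and x: "x \<in> {a..b}"
  shows "F x * G x = F a * G a + (LINT t:{a..x}|lborel. f t * G t + F t * g t)"
proof -
  define p where "p = (\<lambda>t. indicator {a..x} t * f t)"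
  define q where "q = (\<lambda>t. indicator {a..x} t * g t)"
  have sub: "s \<in> {a..b}" if "s \<in> {a..x}" for s using that x by auto
  have fx: "set_integrable lborel {a..x} f" and gx: "set_integrable lborel {a..x} g"
    using x f g by (auto intro: set_integrable_subinterval)
  have p: "integrable lborel p" and q: "integrable lborel q"
    using fx gx unfolding set_integrable_def p_def q_def by simp_all
  have pm[measurable]: "p \<in> borel_measurable borel" and qm[measurable]: "q \<in> borel_measurable borel"
    using p q by auto
  define \<Phi> where "\<Phi> = (\<lambda>s. LINT t|lborel. indicator {..s} t * p t)"
  \<comment> \<open>The half-open ray makes the two triangles below complementary; the missing end point is a null set.\<close>
  define \<Psi> where "\<Psi> = (\<lambda>s. LINT t|lborel. indicator {..<s} t * q t)"
  have Fe: "F s = F a + \<Phi> s" if "s \<in> {a..x}" for s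
  proof -
    have "(LINT t:{a..s}|lborel. f t) = \<Phi> s" unfolding \<Phi>_def set_lebesgue_integral_def p_def
      by (rule Bochner_Integration.integral_cong) (use that in \<open>auto simp: indicator_def\<close>)
    then show ?thesis using F[OF sub[OF that]] by simp
  qed
  have Ge: "G s = G a + \<Psi> s" if "s \<in> {a..x}" for s
  proof -
    have "(LINT t:{a..s}|lborel. g t) = \<Psi> s" unfolding \<Psi>_def set_lebesgue_integral_def q_def
    proof (rule integral_cong_AE)
      show "AE t in lborel. indicat_real {a..s} t *\<^sub>R g t = indicat_real {..<s} t * (indicat_real {a..x} t * g t)"
        using AE_lborel_singleton[of s] by eventually_elim (use that in \<open>auto simp: indicator_def\<close>)
      show "(\<lambda>t. indicat_real {a..s} t *\<^sub>R g t) \<in> borel_measurable lborel"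
        using set_integrable_subinterval[OF gx, of a s] that unfolding set_integrable_def by auto
    qed (use qm in \<open>simp add: q_def\<close>)
    then show ?thesis using G[OF sub[OF that]] by simp
  qed
  have cF: "continuous_on {a..x} F" by (rule primitive_continuous[OF fx]) (rule F[OF sub])
  have cG: "continuous_on {a..x} G" by (rule primitive_continuous[OF gx]) (rule G[OF sub])
  have i1: "set_integrable lborel {a..x} (\<lambda>t. F t * g t)"
    using set_integrable_mult_continuous[OF gx cF] .
  have i2: "set_integrable lborel {a..x} (\<lambda>t. f t * G t)"
    using set_integrable_mult_continuous[OF fx cG] by (simp add: mult.commute)
  have Pe: "(LINT t|lborel. p t) = F x - F a"
    using F[OF x] unfolding set_lebesgue_integral_def p_def by simp
  have Qe: "(LINT t|lborel. q t) = G x - G a"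
    using G[OF x] unfolding set_lebesgue_integral_def q_def by simp
  have pq: "integrable (lborel \<Otimes>\<^sub>M lborel) (\<lambda>(s,t). p s * q t)"
  proof (rule lborel_pair.Fubini_integrable)
    show "(\<lambda>(s, t). p s * q t) \<in> borel_measurable (lborel \<Otimes>\<^sub>M lborel)" by measurable
    show "integrable lborel (\<lambda>s. LINT t|lborel. norm (case (s, t) of (s, t) \<Rightarrow> p s * q t))"
      using p q by (simp add: abs_mult)
    show "AE s in lborel. integrable lborel (\<lambda>t. case (s, t) of (s, t) \<Rightarrow> p s * q t)"
      using q by simp
  qed
  have i3: "integrable (lborel \<Otimes>\<^sub>M lborel) (\<lambda>(s,t). indicator {..<s} t * (p s * q t))"
    by (rule Bochner_Integration.integrable_bound[OF pq]) (auto simp: indicator_def)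
  have sw: "(LINT s|lborel. LINT t|lborel. indicator {..<s} t * (p s * q t)) = (LINT t|lborel. LINT s|lborel. indicator {..<s} t * (p s * q t))"
    using lborel_pair.Fubini_integral[of "\<lambda>s t. indicator {..<s} t * (p s * q t)"] i3 by simp
  have e1: "(LINT s|lborel. LINT t|lborel. indicator {..<s} t * (p s * q t)) = (LINT s|lborel. p s * \<Psi> s)"
    unfolding \<Psi>_def mult.left_commute[of "indicator _ _"] by simp
  have e2: "(LINT s|lborel. indicator {..<s} t * (p s * q t)) = ((F x - F a) - \<Phi> t) * q t" for t
  proof -
    have "(LINT s|lborel. indicator {..<s} t * (p s * q t)) = (LINT s|lborel. (p s - indicator {..t} s * p s) * q t)"
      by (rule Bochner_Integration.integral_cong) (auto simp: indicator_def)
    also have "\<dots> = (LINT s|lborel. (p s - indicator {..t} s * p s)) * q t" by simp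
    also have "(LINT s|lborel. (p s - indicator {..t} s * p s)) = (F x - F a) - \<Phi> t"
      unfolding \<Phi>_def Pe[symmetric]
      using p integrable_mult_indicator[OF _ p, of "{..t}"] by (intro Bochner_Integration.integral_diff) auto
    finally show ?thesis .
  qed
  have s1: "(LINT t:{a..x}|lborel. f t * G t) = (F x - F a) * G a + (LINT s|lborel. p s * \<Psi> s)"
  proof -
    have "(LINT t:{a..x}|lborel. f t * G t) = (LINT t|lborel. p t * G a + p t * \<Psi> t)"
      unfolding set_lebesgue_integral_def p_def
      by (rule Bochner_Integration.integral_cong) (simp_all add: indicator_def distrib_left[symmetric] Ge[symmetric])
    also have "\<dots> = (LINT t|lborel. p t * G a) + (LINT t|lborel. p t * \<Psi> t)"
    proof (rule Bochner_Integration.integral_add)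
      have eq: "p t * \<Psi> t = indicator {a..x} t * (f t * G t) - p t * G a" for t
        using Ge[of t] by (cases "t \<in> {a..x}") (simp_all add: p_def algebra_simps)
      show "integrable lborel (\<lambda>t. p t * \<Psi> t)" unfolding eq
        using i2 p unfolding set_integrable_def by simp
    qed (use p in auto)
    finally show ?thesis using Pe by simp
  qed
  have s2: "(LINT t:{a..x}|lborel. F t * g t) = F x * (G x - G a) - (LINT s|lborel. p s * \<Psi> s)"
  proof -
    have "(LINT s|lborel. p s * \<Psi> s) = (LINT t|lborel. ((F x - F a) - \<Phi> t) * q t)"
      using e1 sw e2 by simp
    also have "\<dots> = (LINT t|lborel. F x * q t - indicator {a..x} t * (F t * g t))"
    proof (rule Bochner_Integration.integral_cong)
      show "((F x - F a) - \<Phi> t) * q t = F x * q t - indicator {a..x} t * (F t * g t)" for t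
        using Fe[of t] by (cases "t \<in> {a..x}") (simp_all add: q_def algebra_simps)
    qed simp
    also have "\<dots> = F x * (G x - G a) - (LINT t:{a..x}|lborel. F t * g t)"
      unfolding Qe[symmetric] set_lebesgue_integral_def
      using i1 q unfolding set_integrable_def by simp
    finally show ?thesis by simp
  qed
  have "(LINT t:{a..x}|lborel. f t * G t + F t * g t) = (LINT t:{a..x}|lborel. f t * G t) + (LINT t:{a..x}|lborel. F t * g t)"
    using i1 i2 by (rule set_integral_add(2)[rotated])
  then show ?thesis unfolding s1 s2 by (simp add: algebra_simps)
qed

lemma C1_primitive:
  fixes F f :: "real \<Rightarrow> real"
  assumes "\<And>x. x \<in> {a..b} \<Longrightarrow> (F has_real_derivative f x) (at x within {a..b})" "continuous_on {a..b} f"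
     "x \<in> {a..b}"
  shows "F x = F a + (LINT t:{a..x}|lborel. f t)"
proof -
  have "(LINT t:{a..x}|lborel. f t) = F x - F a"
    unfolding set_lebesgue_integral_def
  proof (rule integral_FTC_atLeastAtMost)
    show "(F has_vector_derivative f y) (at y within {a..x})" if "a \<le> y" "y \<le> x" for y
      using assms(1)[of y] assms(3) that
      by (auto simp: has_real_derivative_iff_has_vector_derivative intro: has_vector_derivative_within_subset)
    show "continuous_on {a..x} f" using assms by (auto intro: continuous_on_subset)
  qed (use assms in auto)
  then show ?thesis by simp
qed

section \<open>Counting the eigenvalues of a pair of symmetric forms\<close>

text \<open>Gaussian elimination: fewer homogeneous equations than unknowns.\<close>

lemma underdetermined_system_nontrivial:
  fixes \<phi> :: "'i \<Rightarrow> 'w \<Rightarrow> real"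
  assumes "finite I" "finite W" "card I < card W"
  shows "\<exists>c. (\<exists>w\<in>W. c w \<noteq> 0) \<and> (\<forall>i\<in>I. (\<Sum>w\<in>W. c w * \<phi> i w) = 0)"
  using assms
proof (induction I arbitrary: W \<phi> rule: finite_induct)
  case empty
  then have "W \<noteq> {}" by auto
  then show ?case by (intro exI[of _ "\<lambda>_. 1"]) auto
next
  case (insert i I)
  show ?case
  proof (cases "\<forall>w\<in>W. \<phi> i w = 0")
    case True
    obtain c where "\<exists>w\<in>W. c w \<noteq> 0" "\<forall>j\<in>I. (\<Sum>w\<in>W. c w * \<phi> j w) = 0"
      using insert.IH[of W \<phi>] insert.prems insert.hyps by auto
    then show ?thesis using True by (intro exI[of _ c]) auto
  next
    case False
    then obtain w0 where w0: "w0 \<in> W" "\<phi> i w0 \<noteq> 0" by blast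
    define \<psi> where "\<psi> j w = \<phi> j w - \<phi> j w0 * \<phi> i w / \<phi> i w0" for j w
    have "card I < card (W - {w0})" using insert w0 by simp
    then obtain c where c: "\<exists>w\<in>W-{w0}. c w \<noteq> 0" "\<forall>j\<in>I. (\<Sum>w\<in>W-{w0}. c w * \<psi> j w) = 0"
      using insert.IH[of "W - {w0}" \<psi>] insert.prems by auto
    define c0 where "c0 = - (\<Sum>w\<in>W-{w0}. c w * \<phi> i w) / \<phi> i w0"
    define d where "d = c(w0 := c0)"
    have split: "(\<Sum>w\<in>W. d w * \<phi> j w) = c0 * \<phi> j w0 + (\<Sum>w\<in>W-{w0}. c w * \<phi> j w)" for j
    proof -
      have "(\<Sum>w\<in>W. d w * \<phi> j w) = d w0 * \<phi> j w0 + (\<Sum>w\<in>W-{w0}. d w * \<phi> j w)"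
        using w0 insert.prems by (simp add: sum.remove)
      also have "(\<Sum>w\<in>W-{w0}. d w * \<phi> j w) = (\<Sum>w\<in>W-{w0}. c w * \<phi> j w)"
        by (rule sum.cong) (auto simp: d_def)
      finally show ?thesis by (simp add: d_def)
    qed
    have i: "(\<Sum>w\<in>W. d w * \<phi> i w) = 0" unfolding split c0_def using w0 by simp
    have j: "(\<Sum>w\<in>W. d w * \<phi> j w) = 0" if "j \<in> I" for j
    proof -
      have "0 = (\<Sum>w\<in>W-{w0}. c w * \<psi> j w)" using c(2) that by simp
      also have "\<dots> = (\<Sum>w\<in>W-{w0}. c w * \<phi> j w - (c w * \<phi> i w) * (\<phi> j w0 / \<phi> i w0))"
        by (rule sum.cong) (simp_all add: \<psi>_def right_diff_distrib)
      also have "\<dots> = (\<Sum>w\<in>W-{w0}. c w * \<phi> j w) - (\<Sum>w\<in>W-{w0}. c w * \<phi> i w) * (\<phi> j w0 / \<phi> i w0)"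
        by (simp add: sum_subtractf sum_distrib_right sum_divide_distrib)
      finally show ?thesis unfolding split c0_def by simp
    qed
    show ?thesis using c(1) i j by (intro exI[of _ d]) (auto simp: d_def)
  qed
qed

text \<open>An energy form \<open>S\<close> and an inner product \<open>M\<close> on a space of functions. The spectral
statements below are counts of dimensions.\<close>

locale form_pair =
  fixes H :: "(real \<Rightarrow> real) set" and S M :: "(real \<Rightarrow> real) \<Rightarrow> (real \<Rightarrow> real) \<Rightarrow> real"
  assumes subspace_H: "fun_space.subspace H"
    and S_sym: "u \<in> H \<Longrightarrow> v \<in> H \<Longrightarrow> S u v = S v u"
    and S_add: "u \<in> H \<Longrightarrow> v \<in> H \<Longrightarrow> w \<in> H \<Longrightarrow> S (u + v) w = S u w + S v w"
    and S_scale: "u \<in> H \<Longrightarrow> v \<in> H \<Longrightarrow> S (\<lambda>x. c * u x) v = c * S u v"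
    and M_sym: "u \<in> H \<Longrightarrow> v \<in> H \<Longrightarrow> M u v = M v u"
    and M_add: "u \<in> H \<Longrightarrow> v \<in> H \<Longrightarrow> w \<in> H \<Longrightarrow> M (u + v) w = M u w + M v w"
    and M_scale: "u \<in> H \<Longrightarrow> v \<in> H \<Longrightarrow> M (\<lambda>x. c * u x) v = c * M u v"
    and M_pos: "u \<in> H \<Longrightarrow> u \<noteq> (\<lambda>x. 0) \<Longrightarrow> M u u > 0"
begin

definition eig :: "real \<Rightarrow> (real \<Rightarrow> real) set" where
  "eig \<kappa> = {u \<in> H. \<forall>v\<in>H. S u v = \<kappa> * M u v}"

definition mult :: "real \<Rightarrow> nat" where "mult \<kappa> = fun_space.dim (eig \<kappa>)"

definition spec :: "real set" where "spec = {\<kappa>. \<exists>u\<in>eig \<kappa>. u \<noteq> (\<lambda>x. 0)}"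

text \<open>Point evaluations at \<open>I\<close> are the linear conditions that remove the directions on which
\<open>S \<le> lam M\<close>; the size of \<open>I\<close> bounds the number of eigenvalues up to \<open>lam\<close>.\<close>

definition coercive :: "real \<Rightarrow> real set \<Rightarrow> bool" where
  "coercive lam I \<longleftrightarrow> finite I \<and> (\<forall>u\<in>H. u \<noteq> (\<lambda>x. 0) \<longrightarrow> (\<forall>x\<in>I. u x = 0) \<longrightarrow> S u u > lam * M u u)"

lemma zero_H: "(\<lambda>x. 0) \<in> H"
  using fun_space.subspace_0[OF subspace_H] by (simp add: zero_fun_def)

lemma M_zero: "v \<in> H \<Longrightarrow> M (\<lambda>x. 0) v = 0"
  using M_scale[OF zero_H, of v 0] by simp

lemma S_zero: "v \<in> H \<Longrightarrow> S (\<lambda>x. 0) v = 0"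
  using S_scale[OF zero_H, of v 0] by simp

lemma sum_H: "(\<And>i. i \<in> A \<Longrightarrow> f i \<in> H) \<Longrightarrow> sum f A \<in> H"
  using fun_space.subspace_sum[OF subspace_H] by blast

lemma M_sum: "(\<And>i. i \<in> A \<Longrightarrow> f i \<in> H) \<Longrightarrow> v \<in> H \<Longrightarrow> M (sum f A) v = (\<Sum>i\<in>A. M (f i) v)"
proof (induction A rule: infinite_finite_induct)
  case (insert x F)
  then have "M (f x + sum f F) v = M (f x) v + (\<Sum>i\<in>F. M (f i) v)"
    using M_add[of "f x" "sum f F" v] sum_H[of F f] by simp
  then show ?case unfolding sum.insert[OF insert.hyps(1,2)] .
qed (auto simp: zero_fun_def M_zero)

lemma S_sum: "(\<And>i. i \<in> A \<Longrightarrow> f i \<in> H) \<Longrightarrow> v \<in> H \<Longrightarrow> S (sum f A) v = (\<Sum>i\<in>A. S (f i) v)"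
proof (induction A rule: infinite_finite_induct)
  case (insert x F)
  then have "S (f x + sum f F) v = S (f x) v + (\<Sum>i\<in>F. S (f i) v)"
    using S_add[of "f x" "sum f F" v] sum_H[of F f] by simp
  then show ?case unfolding sum.insert[OF insert.hyps(1,2)] .
qed (auto simp: zero_fun_def S_zero)

lemma subspace_eig: "fun_space.subspace (eig \<kappa>)"
proof (rule fun_space.subspaceI)
  show "0 \<in> eig \<kappa>" unfolding eig_def using zero_H S_zero M_zero by (simp add: zero_fun_def)
  show "x + y \<in> eig \<kappa>" if "x \<in> eig \<kappa>" "y \<in> eig \<kappa>" for x y
    using that fun_space.subspace_add[OF subspace_H, of x y] by (auto simp: eig_def S_add M_add distrib_left)
  show "(\<lambda>t. c * x t) \<in> eig \<kappa>" if "x \<in> eig \<kappa>" for c x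
    using that fun_space.subspace_scale[OF subspace_H, of x c] by (auto simp: eig_def S_scale M_scale)
qed

lemma eig_orthogonal:
  assumes "u \<in> eig \<kappa>" "v \<in> eig \<kappa>'" "\<kappa> \<noteq> \<kappa>'"
  shows "M u v = 0"
proof -
  have H: "u \<in> H" "v \<in> H" using assms by (auto simp: eig_def)
  have "\<kappa> * M u v = S u v" using assms(1) H by (auto simp: eig_def)
  also have "\<dots> = S v u" using S_sym H by blast
  also have "\<dots> = \<kappa>' * M u v" using assms(2) H M_sym by (auto simp: eig_def)
  finally show ?thesis using assms(3) by simp
qed

text \<open>More than \<open>card I\<close> independent eigenvectors would have a nontrivial combination \<open>u\<close> that vanishes on
\<open>I\<close>. Eigenspaces are orthogonal for both forms, so \<open>S u u \<le> lam M u u\<close>, against coercivity.\<close>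

lemma card_independent_eigenvectors_le:
  assumes co: "coercive lam I" and F: "finite F" "\<And>\<kappa>. \<kappa> \<in> F \<Longrightarrow> \<kappa> \<le> lam"
    and W: "\<And>\<kappa>. \<kappa> \<in> F \<Longrightarrow> finite (W \<kappa>)" "\<And>\<kappa>. \<kappa> \<in> F \<Longrightarrow> W \<kappa> \<subseteq> eig \<kappa>"
      "\<And>\<kappa>. \<kappa> \<in> F \<Longrightarrow> \<not> fun_space.dependent (W \<kappa>)"
  shows "(\<Sum>\<kappa>\<in>F. card (W \<kappa>)) \<le> card I"
proof (rule ccontr)
  assume "\<not> ?thesis"
  moreover have "card (Sigma F W) = (\<Sum>\<kappa>\<in>F. card (W \<kappa>))" using F W by (intro card_SigmaI) auto
  ultimately have "card I < card (Sigma F W)" by simp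
  then obtain c where c0: "\<exists>p\<in>Sigma F W. c p \<noteq> 0"
    and c: "\<forall>x\<in>I. (\<Sum>p\<in>Sigma F W. c p * (snd p) x) = 0"
    using underdetermined_system_nontrivial[of I "Sigma F W" "\<lambda>x p. snd p x"] co F W
    unfolding coercive_def by (auto simp: finite_SigmaI)
  define U where "U \<kappa> = (\<Sum>w\<in>W \<kappa>. (\<lambda>x. c (\<kappa>, w) * w x))" for \<kappa>
  \<comment> \<open>\<open>U \<kappa>\<close> is the component of the combination \<open>u\<close> in the eigenspace of \<open>\<kappa>\<close>.\<close>
  define u where "u = (\<Sum>\<kappa>\<in>F. U \<kappa>)"
  have UE: "U \<kappa> \<in> eig \<kappa>" if "\<kappa> \<in> F" for \<kappa>
    unfolding U_def using W(2)[OF that]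
    by (intro fun_space.subspace_sum[OF subspace_eig] fun_space.subspace_scale[OF subspace_eig]) auto
  then have UH: "U \<kappa> \<in> H" if "\<kappa> \<in> F" for \<kappa> using that by (auto simp: eig_def)
  have uH: "u \<in> H" unfolding u_def using UH by (rule sum_H)
  have fsum: "(sum f A) x = (\<Sum>i\<in>A. f i x)" for f :: "'c \<Rightarrow> real \<Rightarrow> real" and A x
    by (induction A rule: infinite_finite_induct) auto
  have uI: "u x = 0" if "x \<in> I" for x
  proof -
    have "u x = (\<Sum>\<kappa>\<in>F. \<Sum>w\<in>W \<kappa>. c (\<kappa>, w) * w x)" by (simp add: u_def U_def fsum)
    also have "\<dots> = (\<Sum>p\<in>Sigma F W. c p * (snd p) x)"
      using F W by (subst sum.Sigma) (auto simp: case_prod_beta intro!: sum.cong)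
    finally show ?thesis using c that by simp
  qed
  have Mu: "M u (U \<kappa>) = M (U \<kappa>) (U \<kappa>)" if "\<kappa> \<in> F" for \<kappa>
  proof -
    have "M u (U \<kappa>) = (\<Sum>\<kappa>'\<in>F. M (U \<kappa>') (U \<kappa>))" unfolding u_def using UH that by (intro M_sum)
    also have "\<dots> = (\<Sum>\<kappa>'\<in>F. if \<kappa>' = \<kappa> then M (U \<kappa>) (U \<kappa>) else 0)"
      using eig_orthogonal[OF UE UE[OF that]] by (intro sum.cong) auto
    finally show ?thesis using that F by simp
  qed
  have "u = (\<lambda>x. 0)"
  proof (rule ccontr)
    assume nz: "u \<noteq> (\<lambda>x. 0)"
    have Muu: "M u u = (\<Sum>\<kappa>\<in>F. M (U \<kappa>) (U \<kappa>))"
    proof -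
      have "M u u = (\<Sum>\<kappa>\<in>F. M (U \<kappa>) u)" using M_sum[of F U u] UH uH unfolding u_def by simp
      also have "\<dots> = (\<Sum>\<kappa>\<in>F. M (U \<kappa>) (U \<kappa>))"
        using Mu M_sym UH uH by (intro sum.cong) auto
      finally show ?thesis .
    qed
    have "S u u = (\<Sum>\<kappa>\<in>F. S (U \<kappa>) u)" using S_sum[of F U u] UH uH unfolding u_def by simp
    also have "\<dots> = (\<Sum>\<kappa>\<in>F. \<kappa> * M (U \<kappa>) (U \<kappa>))"
      using UE Mu M_sym UH uH by (intro sum.cong) (auto simp: eig_def)
    also have "\<dots> \<le> (\<Sum>\<kappa>\<in>F. lam * M (U \<kappa>) (U \<kappa>))"
    proof (rule sum_mono)
      fix \<kappa> assume k: "\<kappa> \<in> F"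
      have "M (U \<kappa>) (U \<kappa>) \<ge> 0" using M_pos[OF UH[OF k]] M_zero[OF zero_H] by (cases "U \<kappa> = (\<lambda>x. 0)") auto
      then show "\<kappa> * M (U \<kappa>) (U \<kappa>) \<le> lam * M (U \<kappa>) (U \<kappa>)" using F(2)[OF k] by (rule mult_right_mono[rotated])
    qed
    also have "\<dots> = lam * M u u" by (simp add: Muu sum_distrib_left)
    finally show False using co nz uH uI unfolding coercive_def by force
  qed
  then have "M (U \<kappa>) (U \<kappa>) = 0" if "\<kappa> \<in> F" for \<kappa> using Mu[OF that] M_zero UH that by simp
  then have U0: "U \<kappa> = 0" if "\<kappa> \<in> F" for \<kappa> using M_pos[OF UH[OF that]] that by (force simp: zero_fun_def)
  obtain \<kappa> w where kw: "\<kappa> \<in> F" "w \<in> W \<kappa>" "c (\<kappa>, w) \<noteq> 0" using c0 by auto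
  have "fun_space.dependent (W \<kappa>)"
    unfolding fun_space.dependent_explicit
    using kw W(1) U0[OF kw(1)] by (intro exI[of _ "W \<kappa>"] exI[of _ "\<lambda>w. c (\<kappa>, w)"]) (auto simp: U_def)
  then show False using W(3) kw by blast
qed

text \<open>The dimension of an infinite-dimensional space is \<open>0\<close> by convention, so the finiteness of the basis is
what makes \<open>mult\<close> the true multiplicity.\<close>

lemma eig_basis:
  assumes "coercive lam I" "\<kappa> \<le> lam"
  obtains W where "finite W" "W \<subseteq> eig \<kappa>" "\<not> fun_space.dependent W" "card W = mult \<kappa>" "eig \<kappa> \<subseteq> fun_space.span W"
proof -
  obtain W where W: "W \<subseteq> eig \<kappa>" "\<not> fun_space.dependent W" "eig \<kappa> \<subseteq> fun_space.span W" "card W = fun_space.dim (eig \<kappa>)"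
    using fun_space.basis_exists[of "eig \<kappa>"] by blast
  have "finite W"
  proof (rule ccontr)
    assume "infinite W"
    then obtain V where V: "V \<subseteq> W" "finite V" "card V = Suc (card I)"
      using infinite_arbitrarily_large by blast
    have "(\<Sum>k\<in>{\<kappa>}. card V) \<le> card I"
      using V W fun_space.independent_mono assms by (intro card_independent_eigenvectors_le) auto
    then show False using V by simp
  qed
  then show ?thesis using that W by (simp add: mult_def)
qed

lemma mult_pos:
  assumes "coercive lam I" "\<kappa> \<le> lam" "\<kappa> \<in> spec"
  shows "mult \<kappa> \<ge> 1"
proof -
  obtain W where W: "finite W" "card W = mult \<kappa>" "eig \<kappa> \<subseteq> fun_space.span W"
    by (rule eig_basis[OF assms(1,2)])
  have "W \<noteq> {}"
  proof
    assume "W = {}"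
    then have "eig \<kappa> \<subseteq> {0}" using W(3) by (simp add: fun_space.span_empty)
    then show False using assms(3) by (auto simp: spec_def zero_fun_def)
  qed
  then have "card W > 0" using W(1) by (simp add: card_gt_0_iff)
  then show ?thesis using W(2) by simp
qed

lemma sum_mult_le:
  assumes co: "coercive lam I" and F: "finite F" "F \<subseteq> {..lam}"
  shows "(\<Sum>\<kappa>\<in>F. mult \<kappa>) \<le> card I"
proof -
  have "\<exists>W. finite W \<and> W \<subseteq> eig \<kappa> \<and> \<not> fun_space.dependent W \<and> card W = mult \<kappa>" if "\<kappa> \<in> F" for \<kappa>
  proof -
    have "\<kappa> \<le> lam" using F that by auto
    then show ?thesis by (rule eig_basis[OF co]) blast
  qed
  then obtain W where W: "\<And>\<kappa>. \<kappa> \<in> F \<Longrightarrow> finite (W \<kappa>) \<and> W \<kappa> \<subseteq> eig \<kappa> \<and> \<not> fun_space.dependent (W \<kappa>) \<and> card (W \<kappa>) = mult \<kappa>"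
    by metis
  have "(\<Sum>\<kappa>\<in>F. mult \<kappa>) = (\<Sum>\<kappa>\<in>F. card (W \<kappa>))" using W by (intro sum.cong) auto
  also have "\<dots> \<le> card I" using W F by (intro card_independent_eigenvectors_le[OF co]) auto
  finally show ?thesis .
qed

lemma finite_spec_below:
  assumes co: "coercive lam I"
  shows "finite (spec \<inter> {..lam})"
proof (rule ccontr)
  assume "infinite (spec \<inter> {..lam})"
  then obtain F where F: "F \<subseteq> spec \<inter> {..lam}" "finite F" "card F = Suc (card I)"
    using infinite_arbitrarily_large by blast
  have "card F = (\<Sum>\<kappa>\<in>F. 1)" by simp
  also have "\<dots> \<le> (\<Sum>\<kappa>\<in>F. mult \<kappa>)" using F mult_pos[OF co] by (intro sum_mono) auto
  also have "\<dots> \<le> card I" using F by (intro sum_mult_le[OF co]) auto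
  finally show False using F by simp
qed

definition nth_eigenvalue :: "nat \<Rightarrow> real \<Rightarrow> bool" where
  "nth_eigenvalue n \<mu> \<longleftrightarrow> \<mu> \<in> spec \<and> (\<Sum>\<kappa> | \<kappa> \<in> spec \<and> \<kappa> < \<mu>. mult \<kappa>) \<le> n \<and>
     n < (\<Sum>\<kappa> | \<kappa> \<in> spec \<and> \<kappa> \<le> \<mu>. mult \<kappa>)"

text \<open>The witness is the least eigenvalue whose cumulative multiplicity exceeds \<open>n\<close>; it exists
because only finitely many eigenvalues lie below any given one.\<close>

lemma nth_eigenvalue_exists:
  assumes co: "\<And>lam. \<exists>I. coercive lam I" and inf: "infinite spec"
  shows "\<exists>\<mu>. nth_eigenvalue n \<mu>"
proof -
  have fin: "finite {\<kappa>. \<kappa> \<in> spec \<and> \<kappa> \<le> lam}" for lam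
  proof -
    obtain I where "coercive lam I" using co by blast
    moreover have "{\<kappa>. \<kappa> \<in> spec \<and> \<kappa> \<le> lam} = spec \<inter> {..lam}" by auto
    ultimately show ?thesis using finite_spec_below by simp
  qed
  define N where "N \<mu> = (\<Sum>\<kappa> | \<kappa> \<in> spec \<and> \<kappa> \<le> \<mu>. mult \<kappa>)" for \<mu>
  define G where "G = {\<mu> \<in> spec. n < N \<mu>}"
  obtain F where F: "F \<subseteq> spec" "finite F" "card F = Suc n"
    using infinite_arbitrarily_large[OF inf] by blast
  then have Fn: "F \<noteq> {}" by auto
  define m where "m = Max F"
  have "n < N m"
  proof -
    obtain I where I: "coercive m I" using co by blast
    have "Suc n = (\<Sum>\<kappa>\<in>F. 1)" using F by simp
    also have "\<dots> \<le> (\<Sum>\<kappa>\<in>F. mult \<kappa>)"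
      using F Fn mult_pos[OF I] by (intro sum_mono) (auto simp: m_def)
    also have "\<dots> \<le> N m" unfolding N_def
      using F fin by (intro sum_mono2) (auto simp: m_def)
    finally show ?thesis by simp
  qed
  then have mG: "m \<in> G" using F(1) Max_in[OF F(2) Fn] unfolding G_def m_def by blast
  define K where "K = {\<mu> \<in> G. \<mu> \<le> m}"
  have Kf: "finite K" using fin[of m] by (rule rev_finite_subset) (auto simp: K_def G_def)
  have Kn: "K \<noteq> {}" using mG by (auto simp: K_def)
  define \<mu> where "\<mu> = Min K"
  have \<mu>: "\<mu> \<in> K" unfolding \<mu>_def using Kf Kn by (rule Min_in)
  have least: "\<mu> \<le> x" if "x \<in> G" for x
  proof (cases "x \<le> m")
    case True then show ?thesis unfolding \<mu>_def using Kf that by (intro Min_le) (auto simp: K_def)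
  next
    case False then show ?thesis using \<mu> by (auto simp: K_def)
  qed
  define L where "L = {\<kappa>. \<kappa> \<in> spec \<and> \<kappa> < \<mu>}"
  have Lf: "finite L" using fin[of \<mu>] by (rule rev_finite_subset) (auto simp: L_def)
  have "sum mult L \<le> n"
  proof (cases "L = {}")
    case False
    have mx: "Max L \<in> L" using Lf False by (rule Max_in)
    have "L = {\<kappa>. \<kappa> \<in> spec \<and> \<kappa> \<le> Max L}"
    proof (intro equalityI subsetI)
      fix x assume "x \<in> L" then show "x \<in> {\<kappa>. \<kappa> \<in> spec \<and> \<kappa> \<le> Max L}"
        using Max_ge[OF Lf] by (simp add: L_def)
    next
      fix x assume x: "x \<in> {\<kappa>. \<kappa> \<in> spec \<and> \<kappa> \<le> Max L}"
      have "Max L < \<mu>" using mx unfolding L_def by simp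
      then show "x \<in> L" using x unfolding L_def by simp
    qed
    then have "sum mult L = N (Max L)" unfolding N_def by simp
    moreover have "Max L \<notin> G" using least[of "Max L"] mx by (auto simp: L_def)
    ultimately show ?thesis using mx by (auto simp: G_def L_def)
  qed simp
  then show ?thesis using \<mu> unfolding nth_eigenvalue_def L_def K_def G_def N_def by auto
qed

lemma nth_eigenvalue_unique:
  assumes co: "\<And>lam. \<exists>I. coercive lam I" and "nth_eigenvalue n \<mu>" "nth_eigenvalue n \<mu>'"
  shows "\<mu> = \<mu>'"
proof -
  have fin: "finite {\<kappa>. \<kappa> \<in> spec \<and> \<kappa> \<le> lam}" for lam
  proof -
    obtain I where "coercive lam I" using co by blast
    moreover have "{\<kappa>. \<kappa> \<in> spec \<and> \<kappa> \<le> lam} = spec \<inter> {..lam}" by auto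
    ultimately show ?thesis using finite_spec_below by simp
  qed
  have False if "nth_eigenvalue n x" "nth_eigenvalue n y" "x < y" for x y
  proof -
    have "(\<Sum>\<kappa> | \<kappa> \<in> spec \<and> \<kappa> \<le> x. mult \<kappa>) \<le> (\<Sum>\<kappa> | \<kappa> \<in> spec \<and> \<kappa> < y. mult \<kappa>)"
      using that(3) by (intro sum_mono2 finite_subset[OF _ fin[of y]]) auto
    then show False using that unfolding nth_eigenvalue_def by linarith
  qed
  then show ?thesis using assms by (metis linorder_neqE)
qed

lemma nth_eigenvalue_gt:
  assumes "coercive lam I" "card I \<le> n" "nth_eigenvalue n \<mu>"
  shows "\<mu> > lam"
proof (rule ccontr)
  assume "\<not> ?thesis"
  then have le: "\<mu> \<le> lam" by simp
  have "(\<Sum>\<kappa> | \<kappa> \<in> spec \<and> \<kappa> \<le> \<mu>. mult \<kappa>) \<le> card I"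
    using finite_spec_below[OF assms(1)] le
    by (intro sum_mult_le[OF assms(1)]) (auto elim!: rev_finite_subset)
  then show False using assms(2,3) unfolding nth_eigenvalue_def by linarith
qed

end

section \<open>Weak derivatives and Robin forms on an interval\<close>

lemma square_integrable_product:
  fixes g h :: "real \<Rightarrow> real"
  assumes g: "set_borel_measurable lborel A g" "set_integrable lborel A (\<lambda>x. (g x)\<^sup>2)"
    and h: "set_borel_measurable lborel A h" "set_integrable lborel A (\<lambda>x. (h x)\<^sup>2)"
  shows "set_integrable lborel A (\<lambda>x. g x * h x)"
proof -
  have m: "(\<lambda>x. (indicat_real A x *\<^sub>R g x) * (indicat_real A x *\<^sub>R h x)) \<in> borel_measurable lborel"
    using g(1) h(1) unfolding set_borel_measurable_def by (rule borel_measurable_times)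
  have "integrable lborel (\<lambda>x. (indicat_real A x *\<^sub>R g x) * (indicat_real A x *\<^sub>R h x))"
  proof (rule Bochner_Integration.integrable_bound[OF _ m])
    show "integrable lborel (\<lambda>x. indicat_real A x *\<^sub>R (g x)\<^sup>2 + indicat_real A x *\<^sub>R (h x)\<^sup>2)"
      using g(2) h(2) unfolding set_integrable_def by (rule Bochner_Integration.integrable_add)
    have "\<bar>p * q\<bar> \<le> p\<^sup>2 + q\<^sup>2" for p q :: real
    proof -
      have "2 * (\<bar>p\<bar> * \<bar>q\<bar>) \<le> p\<^sup>2 + q\<^sup>2" using sum_squares_bound[of "\<bar>p\<bar>" "\<bar>q\<bar>"] by simp
      moreover have "0 \<le> \<bar>p\<bar> * \<bar>q\<bar>" by simp
      ultimately show ?thesis unfolding abs_mult by linarith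
    qed
    then show "AE x in lborel. norm ((indicat_real A x *\<^sub>R g x) * (indicat_real A x *\<^sub>R h x))
      \<le> norm (indicat_real A x *\<^sub>R (g x)\<^sup>2 + indicat_real A x *\<^sub>R (h x)\<^sup>2)"
      by (intro AE_I2) (auto simp: indicator_def)
  qed
  moreover have "(indicat_real A x *\<^sub>R g x) * (indicat_real A x *\<^sub>R h x) = indicat_real A x *\<^sub>R (g x * h x)" for x
    by (auto simp: indicator_def)
  ultimately show ?thesis unfolding set_integrable_def by (simp only:)
qed

lemma set_integrable_continuous_Icc:
  fixes f :: "real \<Rightarrow> real"
  assumes "continuous_on {a..b} f"
  shows "set_integrable lborel {a..b} f"
  using borel_integrable_compact[OF compact_Icc assms] unfolding set_integrable_def by (simp add: indicator_def if_distrib cong: if_cong)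

lemma set_measurable_continuous_Icc:
  fixes f :: "real \<Rightarrow> real"
  assumes "continuous_on {a..b} f"
  shows "set_borel_measurable lborel {a..b} f"
  using set_integrable_continuous_Icc[OF assms] unfolding set_integrable_def set_borel_measurable_def by auto

lemma has_weak_deriv_integrable:
  assumes "has_weak_deriv l u g"
  shows "set_integrable lborel {-l..l} g"
  using square_integrable_product[of "{-l..l}" g "\<lambda>_. 1"] assms
    set_measurable_continuous_Icc[of "-l" l "\<lambda>_. 1"] set_integrable_continuous_Icc[of "-l" l "\<lambda>_. 1"]
  unfolding has_weak_deriv_def by simp

lemma has_weak_deriv_eq:
  "has_weak_deriv l u g \<Longrightarrow> x \<in> {-l..l} \<Longrightarrow> u x = u (-l) + (LINT t:{-l..x}|lborel. g t)"
  unfolding has_weak_deriv_def by blast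

lemma has_weak_deriv_continuous: "has_weak_deriv l u g \<Longrightarrow> continuous_on {-l..l} u"
  by (rule primitive_continuous[OF has_weak_deriv_integrable]) (auto dest: has_weak_deriv_eq)

lemma H1D: "u \<in> H1 l \<Longrightarrow> has_weak_deriv l u (weak_deriv l u)"
  unfolding H1_def weak_deriv_def using someI_ex[of "has_weak_deriv l u"] by blast

lemma H1I: "has_weak_deriv l u g \<Longrightarrow> (\<And>x. x \<notin> {-l..l} \<Longrightarrow> u x = 0) \<Longrightarrow> u \<in> H1 l"
  unfolding H1_def by blast

lemma H1_outside: "u \<in> H1 l \<Longrightarrow> x \<notin> {-l..l} \<Longrightarrow> u x = 0"
  unfolding H1_def by blast

text \<open>\<open>weak_deriv\<close> is an arbitrary choice among the weak derivatives; this makes the forms below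
independent of that choice.\<close>

lemma has_weak_deriv_unique:
  assumes "has_weak_deriv l u g" "has_weak_deriv l u h"
  shows "AE x in lborel. x \<in> {-l..l} \<longrightarrow> g x = h x"
proof -
  have gi: "set_integrable lborel {-l..l} g" and hi: "set_integrable lborel {-l..l} h"
    using assms by (auto intro: has_weak_deriv_integrable)
  have "AE x in lborel. x \<in> {-l..l} \<longrightarrow> g x - h x = 0"
  proof (rule primitive_zero_AE)
    show "set_integrable lborel {-l..l} (\<lambda>x. g x - h x)" using gi hi by (rule set_integral_diff(1))
    fix x assume x: "x \<in> {-l..l}"
    have "(LINT t:{-l..x}|lborel. g t - h t) = (LINT t:{-l..x}|lborel. g t) - (LINT t:{-l..x}|lborel. h t)"
      using x by (intro set_integral_diff(2) set_integrable_subinterval[OF gi] set_integrable_subinterval[OF hi]) auto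
    then show "(LINT t:{-l..x}|lborel. g t - h t) = 0"
      using has_weak_deriv_eq[OF assms(1) x] has_weak_deriv_eq[OF assms(2) x] by simp
  qed
  then show ?thesis by eventually_elim auto
qed

lemma has_weak_deriv_add:
  assumes "has_weak_deriv l u g" "has_weak_deriv l v h"
  shows "has_weak_deriv l (u + v) (\<lambda>x. g x + h x)"
proof -
  have gi: "set_integrable lborel {-l..l} g" and hi: "set_integrable lborel {-l..l} h"
    using assms by (auto intro: has_weak_deriv_integrable)
  have gh: "set_integrable lborel {-l..l} (\<lambda>x. g x * h x)"
    using assms unfolding has_weak_deriv_def by (intro square_integrable_product) auto
  have 1: "set_borel_measurable lborel {-l..l} (\<lambda>x. g x + h x)"
    using set_integral_add(1)[OF gi hi] unfolding set_integrable_def set_borel_measurable_def by auto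
  have "set_integrable lborel {-l..l} (\<lambda>x. (g x)\<^sup>2 + (h x)\<^sup>2 + (2 * (g x * h x)))"
    using assms gh unfolding has_weak_deriv_def by (intro set_integral_add(1) set_integrable_mult_right) auto
  moreover have "(g x)\<^sup>2 + (h x)\<^sup>2 + (2 * (g x * h x)) = (g x + h x)\<^sup>2" for x by (simp add: power2_sum)
  ultimately have 2: "set_integrable lborel {-l..l} (\<lambda>x. (g x + h x)\<^sup>2)" by simp
  have 3: "(u + v) x = (u + v) (-l) + (LINT t:{-l..x}|lborel. g t + h t)" if x: "x \<in> {-l..l}" for x
  proof -
    have "(LINT t:{-l..x}|lborel. g t + h t) = (LINT t:{-l..x}|lborel. g t) + (LINT t:{-l..x}|lborel. h t)"
      using x by (intro set_integral_add(2) set_integrable_subinterval[OF gi] set_integrable_subinterval[OF hi]) auto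
    then show ?thesis using has_weak_deriv_eq[OF assms(1) x] has_weak_deriv_eq[OF assms(2) x] by simp
  qed
  show ?thesis unfolding has_weak_deriv_def using 1 2 3 by blast
qed

lemma has_weak_deriv_scale:
  assumes "has_weak_deriv l u g"
  shows "has_weak_deriv l (\<lambda>x. c * u x) (\<lambda>x. c * g x)"
proof -
  have gi: "set_integrable lborel {-l..l} g"
    using assms by (auto intro: has_weak_deriv_integrable)
  have 1: "set_borel_measurable lborel {-l..l} (\<lambda>x. c * g x)"
    using set_integrable_mult_right[of c, OF gi] unfolding set_integrable_def set_borel_measurable_def by auto
  have 2: "set_integrable lborel {-l..l} (\<lambda>x. (c * g x)\<^sup>2)"
    unfolding power_mult_distrib using assms unfolding has_weak_deriv_def by (intro set_integrable_mult_right) auto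
  have 3: "c * u x = c * u (-l) + (LINT t:{-l..x}|lborel. c * g t)" if x: "x \<in> {-l..l}" for x
    using has_weak_deriv_eq[OF assms x] by (simp add: distrib_left)
  show ?thesis unfolding has_weak_deriv_def using 1 2 3 by blast
qed

lemma subspace_H1: "fun_space.subspace (H1 l)"
proof (rule fun_space.subspaceI)
  have "has_weak_deriv l (\<lambda>x. 0) (\<lambda>x. 0)"
    unfolding has_weak_deriv_def by (simp add: set_borel_measurable_def set_integrable_def)
  then show "0 \<in> H1 l" unfolding zero_fun_def by (rule H1I) simp
  show "x + y \<in> H1 l" if "x \<in> H1 l" "y \<in> H1 l" for x y
    using has_weak_deriv_add[OF H1D[OF that(1)] H1D[OF that(2)]] H1_outside[OF that(1)] H1_outside[OF that(2)]
    by (intro H1I) auto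
  show "(\<lambda>t. c * x t) \<in> H1 l" if "x \<in> H1 l" for c x
    using has_weak_deriv_scale[OF H1D[OF that]] H1_outside[OF that] by (intro H1I) auto
qed

text \<open>The weighted form \<open>\<integral> B (u'\<^sup>2 - V u\<^sup>2) - C (u(l)\<^sup>2 + u(-l)\<^sup>2)\<close>, whose eigenfunctions satisfy
\<open>(B u')' + B (V + \<kappa>) u = 0\<close> with Robin boundary conditions.\<close>

locale robin_form =
  fixes l :: real and B V :: "real \<Rightarrow> real" and C :: real
  assumes l_pos: "l > 0"
    and B_cont: "continuous_on {-l..l} B" and V_cont: "continuous_on {-l..l} V"
    and B_pos: "x \<in> {-l..l} \<Longrightarrow> B x > 0"
begin

definition S :: "(real \<Rightarrow> real) \<Rightarrow> (real \<Rightarrow> real) \<Rightarrow> real" where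
  "S u v = (LINT s:{-l..l}|lborel. B s * (weak_deriv l u s * weak_deriv l v s) - B s * V s * (u s * v s))
     - C * (u l * v l + u (-l) * v (-l))"

definition M :: "(real \<Rightarrow> real) \<Rightarrow> (real \<Rightarrow> real) \<Rightarrow> real" where
  "M u v = (LINT s:{-l..l}|lborel. B s * (u s * v s))"

lemma deriv_term_integrable:
  assumes "has_weak_deriv l u g" "has_weak_deriv l v h"
  shows "set_integrable lborel {-l..l} (\<lambda>s. B s * (g s * h s))"
  using assms unfolding has_weak_deriv_def
  by (intro set_integrable_mult_continuous[OF square_integrable_product B_cont]) auto

lemma potential_term_integrable:
  assumes "continuous_on {-l..l} u" "continuous_on {-l..l} v"
  shows "set_integrable lborel {-l..l} (\<lambda>s. B s * V s * (u s * v s))"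
  by (intro set_integrable_continuous_Icc continuous_intros B_cont V_cont assms)

lemma mass_term_integrable:
  assumes "continuous_on {-l..l} u" "continuous_on {-l..l} v"
  shows "set_integrable lborel {-l..l} (\<lambda>s. B s * (u s * v s))"
  by (intro set_integrable_continuous_Icc continuous_intros B_cont assms)

lemma S_eq:
  assumes u: "u \<in> H1 l" "has_weak_deriv l u g" and v: "v \<in> H1 l" "has_weak_deriv l v h"
  shows "S u v = (LINT s:{-l..l}|lborel. B s * (g s * h s)) - (LINT s:{-l..l}|lborel. B s * V s * (u s * v s))
     - C * (u l * v l + u (-l) * v (-l))"
proof -
  have i: "set_integrable lborel {-l..l} (\<lambda>s. B s * (weak_deriv l u s * weak_deriv l v s))"
    using deriv_term_integrable[OF H1D[OF u(1)] H1D[OF v(1)]] .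
  have "S u v = (LINT s:{-l..l}|lborel. B s * (weak_deriv l u s * weak_deriv l v s)) - (LINT s:{-l..l}|lborel. B s * V s * (u s * v s))
     - C * (u l * v l + u (-l) * v (-l))"
    unfolding S_def
    by (subst set_integral_diff(2)[OF i potential_term_integrable])
      (use u v in \<open>auto intro: has_weak_deriv_continuous\<close>)
  also have "(LINT s:{-l..l}|lborel. B s * (weak_deriv l u s * weak_deriv l v s)) = (LINT s:{-l..l}|lborel. B s * (g s * h s))"
    unfolding set_lebesgue_integral_def
  proof (rule integral_cong_AE)
    show "AE s in lborel. indicat_real {-l..l} s *\<^sub>R (B s * (weak_deriv l u s * weak_deriv l v s)) = indicat_real {-l..l} s *\<^sub>R (B s * (g s * h s))"
      using has_weak_deriv_unique[OF H1D[OF u(1)] u(2)] has_weak_deriv_unique[OF H1D[OF v(1)] v(2)]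
      by eventually_elim (auto simp: indicator_def)
  qed (use i deriv_term_integrable[OF u(2) v(2)] in \<open>auto simp: set_integrable_def\<close>)
  finally show ?thesis .
qed

lemma H1_continuous: "u \<in> H1 l \<Longrightarrow> continuous_on {-l..l} u"
  using H1D has_weak_deriv_continuous by blast

lemma M_pos:
  assumes u: "u \<in> H1 l" "u \<noteq> (\<lambda>x. 0)"
  shows "M u u > 0"
proof -
  obtain x0 where "u x0 \<noteq> 0" using u(2) by auto
  then have x0: "x0 \<in> {-l..l}" "u x0 \<noteq> 0" using H1_outside[OF u(1)] by auto
  let ?f = "\<lambda>s. B s * (u s * u s)"
  have c: "continuous_on {-l..l} ?f" by (intro continuous_intros B_cont H1_continuous u)
  have M: "M u u = integral {-l..l} ?f"
    unfolding M_def using set_borel_integral_eq_integral(2)[OF set_integrable_continuous_Icc[OF c]] .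
  have nn: "?f s \<ge> 0" if "s \<in> {-l..l}" for s using B_pos[OF that] by simp
  have "integral {-l..l} ?f \<noteq> 0"
  proof
    assume "integral {-l..l} ?f = 0"
    then have "(?f has_integral 0) {-l..l}"
      using integrable_continuous_real[OF c] by (metis integrable_integral)
    then have "(?f has_integral 0) (cbox (-l) l)" by simp
    then have "?f x0 = 0"
      using has_integral_0_cbox_imp_0[of "-l" l ?f x0] c nn x0 l_pos by (auto simp: box_real)
    then show False using x0 B_pos[OF x0(1)] by simp
  qed
  moreover have "integral {-l..l} ?f \<ge> 0" using nn by (rule Henstock_Kurzweil_Integration.integral_nonneg[OF integrable_continuous_real[OF c]])
  ultimately show ?thesis using M by simp
qed

sublocale form_pair "H1 l" S M
proof
  show "fun_space.subspace (H1 l)" by (rule subspace_H1)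
  show "S u v = S v u" for u v by (simp add: S_def mult.commute mult.left_commute)
  show "M u v = M v u" for u v by (simp add: M_def mult.commute mult.left_commute)
  show "M u u > 0" if "u \<in> H1 l" "u \<noteq> (\<lambda>x. 0)" for u using M_pos that .
next
  fix u v w assume H: "u \<in> H1 l" "v \<in> H1 l" "w \<in> H1 l"
  have uv: "u + v \<in> H1 l" using fun_space.subspace_add[OF subspace_H1] H by blast
  note c = H1_continuous[OF H(1)] H1_continuous[OF H(2)] H1_continuous[OF H(3)]
  have e1: "B s * ((u + v) s * w s) = B s * (u s * w s) + B s * (v s * w s)" for s by (simp add: algebra_simps)
  have e2: "B s * V s * ((u + v) s * w s) = B s * V s * (u s * w s) + B s * V s * (v s * w s)" for s by (simp add: algebra_simps)
  have e3: "B s * ((weak_deriv l u s + weak_deriv l v s) * weak_deriv l w s) =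
     B s * (weak_deriv l u s * weak_deriv l w s) + B s * (weak_deriv l v s * weak_deriv l w s)" for s by (simp add: algebra_simps)
  show "M (u + v) w = M u w + M v w" unfolding M_def e1
    by (intro set_integral_add(2) mass_term_integrable c)
  show "S (u + v) w = S u w + S v w"
    unfolding S_eq[OF uv has_weak_deriv_add[OF H1D H1D] H(3) H1D, OF H]
      S_eq[OF H(1) H1D[OF H(1)] H(3) H1D[OF H(3)]] S_eq[OF H(2) H1D[OF H(2)] H(3) H1D[OF H(3)]] e2 e3
      set_integral_add(2)[OF deriv_term_integrable[OF H1D H1D] deriv_term_integrable[OF H1D H1D], OF H(1,3) H(2,3)]
      set_integral_add(2)[OF potential_term_integrable[OF c(1,3)] potential_term_integrable[OF c(2,3)]]
    by (simp add: algebra_simps)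
next
  fix u v c assume H: "u \<in> H1 l" "v \<in> H1 l"
  have cu: "(\<lambda>x. c * u x) \<in> H1 l" using fun_space.subspace_scale[OF subspace_H1] H by blast
  have e1: "B s * ((c * u s) * v s) = c * (B s * (u s * v s))" for s by (simp add: algebra_simps)
  have e2: "B s * V s * ((c * u s) * v s) = c * (B s * V s * (u s * v s))" for s by (simp add: algebra_simps)
  have e3: "B s * ((c * weak_deriv l u s) * weak_deriv l v s) = c * (B s * (weak_deriv l u s * weak_deriv l v s))" for s by (simp add: algebra_simps)
  show "M (\<lambda>x. c * u x) v = c * M u v" unfolding M_def e1 by simp
  show "S (\<lambda>x. c * u x) v = c * S u v"
    unfolding S_eq[OF cu has_weak_deriv_scale[OF H1D] H(2) H1D, OF H] S_eq[OF H(1) H1D[OF H(1)] H(2) H1D[OF H(2)]] e2 e3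
    by (simp add: algebra_simps)
qed

end

section \<open>Coercivity and classical eigenfunctions\<close>

text \<open>The Cauchy-Schwarz inequality against the constant function, read off from the variance of \<open>f\<close>
about its mean.\<close>

lemma square_of_primitive_le:
  fixes f :: "real \<Rightarrow> real"
  assumes f: "set_integrable lborel {y..x} f" and f2: "set_integrable lborel {y..x} (\<lambda>t. (f t)\<^sup>2)" and "y \<le> x"
  shows "(LINT t:{y..x}|lborel. f t)\<^sup>2 \<le> (x - y) * (LINT t:{y..x}|lborel. (f t)\<^sup>2)"
proof (cases "y = x")
  case True
  have "(LINT t:{y..x}|lborel. f t) = integral {y..x} f" using set_borel_integral_eq_integral(2)[OF f] .
  then show ?thesis using True by simp
next
  case False
  define U where "U = (LINT t:{y..x}|lborel. f t)"
  define m where "m = U / (x - y)"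
  have pos: "x - y > 0" using False assms by simp
  have ci: "set_integrable lborel {y..x} (\<lambda>t. m\<^sup>2)" by (rule set_integrable_continuous_Icc) simp
  have mi: "set_integrable lborel {y..x} (\<lambda>t. (2 * m) * f t)" using f by simp
  have cint: "(LINT t:{y..x}|lborel. m\<^sup>2) = m\<^sup>2 * (x - y)"
    using pos by (simp add: set_lebesgue_integral_def)
  have "0 \<le> (LINT t:{y..x}|lborel. (f t - m)\<^sup>2)"
    unfolding set_lebesgue_integral_def by (rule Bochner_Integration.integral_nonneg) simp
  also have "(\<lambda>t. (f t - m)\<^sup>2) = (\<lambda>t. ((f t)\<^sup>2 + m\<^sup>2) - (2 * m) * f t)"
    by (simp add: power2_diff fun_eq_iff)
  also have "(LINT t:{y..x}|lborel. ((f t)\<^sup>2 + m\<^sup>2) - (2 * m) * f t) = (LINT t:{y..x}|lborel. (f t)\<^sup>2) + m\<^sup>2 * (x - y) - (2 * m) * U"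
    unfolding set_integral_diff(2)[OF set_integral_add(1)[OF f2 ci] mi] set_integral_add(2)[OF f2 ci] cint U_def by simp
  also have "\<dots> = (LINT t:{y..x}|lborel. (f t)\<^sup>2) - U\<^sup>2 / (x - y)"
  proof -
    have U: "U = m * (x - y)" using pos by (simp add: m_def)
    have "U\<^sup>2 / (x - y) = m\<^sup>2 * (x - y)" unfolding U using pos by (simp add: power2_eq_square)
    moreover have "2 * m * U = 2 * (m\<^sup>2 * (x - y))" unfolding U by (simp add: power2_eq_square)
    ultimately show ?thesis by simp
  qed
  finally show ?thesis using pos unfolding U_def[symmetric] by (simp add: field_simps)
qed

text \<open>The Cauchy-Schwarz inequality for the primitive of the weak derivative, started at a zero.\<close>

lemma square_le_energy:
  assumes u: "has_weak_deriv l u g" and y: "y \<in> {-l..l}" "u y = 0" and x: "x \<in> {-l..l}" "y \<le> x" "x - y \<le> h"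
  shows "(u x)\<^sup>2 \<le> h * (LINT t:{-l..l}|lborel. (g t)\<^sup>2)"
proof -
  have gi: "set_integrable lborel {-l..l} g" using u by (rule has_weak_deriv_integrable)
  have g2: "set_integrable lborel {-l..l} (\<lambda>t. (g t)\<^sup>2)" using u unfolding has_weak_deriv_def by blast
  have "u x = (LINT t:{y..x}|lborel. g t)"
    using primitive_diff[OF gi, of y x] has_weak_deriv_eq[OF u, of x] has_weak_deriv_eq[OF u, of y] x y by auto
  then have "(u x)\<^sup>2 \<le> (x - y) * (LINT t:{y..x}|lborel. (g t)\<^sup>2)"
    using x y by (auto intro!: square_of_primitive_le set_integrable_subinterval[OF gi] set_integrable_subinterval[OF g2])
  also have "\<dots> \<le> h * (LINT t:{-l..l}|lborel. (g t)\<^sup>2)"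
  proof (rule mult_mono)
    show "(LINT t:{y..x}|lborel. (g t)\<^sup>2) \<le> (LINT t:{-l..l}|lborel. (g t)\<^sup>2)"
    proof -
      have nn: "0 \<le> (LINT t:{c..d}|lborel. (g t)\<^sup>2)" for c d
        unfolding set_lebesgue_integral_def by (rule Bochner_Integration.integral_nonneg) simp
      show ?thesis
        using primitive_diff[OF g2, of y x] primitive_diff[OF g2, of x l] nn[of "-l" y] nn[of x l] x y by simp
    qed
    show "0 \<le> (LINT t:{y..x}|lborel. (g t)\<^sup>2)"
      unfolding set_lebesgue_integral_def by (rule Bochner_Integration.integral_nonneg) simp
  qed (use x in auto)
  finally show ?thesis .
qed

lemma finite_grid:
  fixes l h :: real
  assumes "l > 0" "h > 0"
  obtains I where "finite I" "I \<subseteq> {-l..l}" "-l \<in> I" "l \<in> I" "\<And>x. x \<in> {-l..l} \<Longrightarrow> \<exists>y\<in>I. y \<le> x \<and> x - y \<le> h"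
proof -
  obtain N :: nat where N: "2 * l / h < N" using reals_Archimedean2 by blast
  define I where "I = insert l ((\<lambda>j::nat. -l + j * h) ` {..N} \<inter> {-l..l})"
  have "\<exists>y\<in>I. y \<le> x \<and> x - y \<le> h" if x: "x \<in> {-l..l}" for x
  proof -
    define j where "j = nat \<lfloor>(x + l) / h\<rfloor>"
    have nn: "(x + l) / h \<ge> 0" using x assms by auto
    have j1: "real j \<le> (x + l) / h" using nn unfolding j_def by linarith
    have j2: "(x + l) / h < real j + 1" using nn unfolding j_def by linarith
    have a: "j * h \<le> x + l" "x + l \<le> (j + 1) * h" using j1 j2 assms by (simp_all add: field_simps)
    have "(x + l) / h \<le> 2 * l / h" using x assms by (simp add: divide_right_mono)
    then have "j \<le> N" using j1 N by linarith
    then have "-l + j * h \<in> I" using a x assms unfolding I_def by auto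
    then show ?thesis using a by (intro bexI[of _ "-l + j * h"]) (auto simp: algebra_simps)
  qed
  moreover have "-l \<in> I" using assms by (auto simp: I_def intro!: image_eqI[of _ _ 0])
  moreover have "finite I" "I \<subseteq> {-l..l}" "l \<in> I" using assms by (auto simp: I_def)
  ultimately show ?thesis using that by blast
qed

context robin_form begin

text \<open>If \<open>u\<close> vanishes on a grid of mesh \<open>h\<close>, then \<open>u\<^sup>2 \<le> h E\<close> pointwise, where \<open>E\<close> is the integral of
\<open>u'\<^sup>2\<close>. For small \<open>h\<close> the potential and the mass term are then absorbed by the
derivative term. The grid contains \<open>\<plusminus>l\<close>, so the boundary term is absent.\<close>

lemma coercive_exists: "\<exists>I. coercive lam I"
proof -
  have "\<exists>b>0. \<forall>s\<in>{-l..l}. b \<le> B s"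
  proof -
    have "{-l..l} \<noteq> {}" using l_pos by auto
    then obtain s where s: "s \<in> {-l..l}" "\<forall>t\<in>{-l..l}. B s \<le> B t"
      using continuous_attains_inf[of "{-l..l}" B] B_cont by (auto simp del: atLeastAtMost_iff)
    then show ?thesis using B_pos by (intro exI[of _ "B s"]) auto
  qed
  then obtain b where b: "b > 0" "\<And>s. s \<in> {-l..l} \<Longrightarrow> b \<le> B s" by blast
  have "bounded ((\<lambda>s. B s * V s + lam * B s) ` {-l..l})"
    by (intro compact_imp_bounded compact_continuous_image continuous_intros B_cont V_cont) auto
  then obtain K where K: "K > 0" "\<And>s. s \<in> {-l..l} \<Longrightarrow> \<bar>B s * V s + lam * B s\<bar> \<le> K"
    unfolding bounded_pos by auto
  \<comment> \<open>The mesh is chosen so that \<open>K (h E) (2 l) = b E / 2\<close>.\<close>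
  define h where "h = b / (4 * l * K)"
  have h: "h > 0" using b K l_pos by (simp add: h_def)
  obtain I where I: "finite I" "I \<subseteq> {-l..l}" "-l \<in> I" "l \<in> I" "\<And>x. x \<in> {-l..l} \<Longrightarrow> \<exists>y\<in>I. y \<le> x \<and> x - y \<le> h"
    using finite_grid[OF l_pos h] by blast
  have "S u u > lam * M u u" if u: "u \<in> H1 l" "u \<noteq> (\<lambda>x. 0)" and z: "\<forall>x\<in>I. u x = 0" for u
  proof -
    define g where "g = weak_deriv l u"
    define E where "E = (LINT t:{-l..l}|lborel. (g t)\<^sup>2)"
    have g: "has_weak_deriv l u g" using H1D[OF u(1)] by (simp add: g_def)
    have g2: "set_integrable lborel {-l..l} (\<lambda>t. (g t)\<^sup>2)" using g unfolding has_weak_deriv_def by blast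
    have pt: "(u x)\<^sup>2 \<le> h * E" if x: "x \<in> {-l..l}" for x
    proof -
      obtain y where "y \<in> I" "y \<le> x" "x - y \<le> h" using I(5)[OF x] by blast
      then show ?thesis unfolding E_def using I(2) z x by (intro square_le_energy[OF g, of y]) auto
    qed
    have "E \<noteq> 0"
    proof
      assume "E = 0"
      then have "u x = 0" for x using pt[of x] H1_outside[OF u(1), of x] by (cases "x \<in> {-l..l}") auto
      then show False using u(2) by auto
    qed
    moreover have "E \<ge> 0" unfolding E_def set_lebesgue_integral_def by (rule Bochner_Integration.integral_nonneg) simp
    ultimately have E: "E > 0" by simp
    have cu: "continuous_on {-l..l} u" using H1_continuous[OF u(1)] .
    have S: "S u u = (LINT s:{-l..l}|lborel. B s * (g s * g s)) - (LINT s:{-l..l}|lborel. B s * V s * (u s * u s))"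
      using S_eq[OF u(1) g u(1) g] z I by simp
    have "b * E = (LINT s:{-l..l}|lborel. b * (g s)\<^sup>2)" by (simp add: E_def)
    also have "\<dots> \<le> (LINT s:{-l..l}|lborel. B s * (g s * g s))"
      using b(2) g2 by (intro set_integral_mono deriv_term_integrable[OF g g])
        (auto simp: power2_eq_square intro!: mult_right_mono)
    finally have 1: "b * E \<le> (LINT s:{-l..l}|lborel. B s * (g s * g s))" .
    have "(LINT s:{-l..l}|lborel. B s * V s * (u s * u s)) + lam * M u u
       = (LINT s:{-l..l}|lborel. B s * V s * (u s * u s)) + (LINT s:{-l..l}|lborel. lam * (B s * (u s * u s)))"
      by (simp add: M_def)
    also have "\<dots> = (LINT s:{-l..l}|lborel. B s * V s * (u s * u s) + lam * (B s * (u s * u s)))"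
      by (rule set_integral_add(2)[symmetric])
        (use potential_term_integrable[OF cu cu] mass_term_integrable[OF cu cu] in simp_all)
    also have "\<dots> \<le> (LINT s:{-l..l}|lborel. K * (h * E))"
    proof (rule set_integral_mono)
      show "set_integrable lborel {-l..l} (\<lambda>s. B s * V s * (u s * u s) + lam * (B s * (u s * u s)))"
        by (intro set_integrable_continuous_Icc continuous_intros B_cont V_cont cu)
      show "set_integrable lborel {-l..l} (\<lambda>s. K * (h * E))" by (rule set_integrable_continuous_Icc) simp
      fix s assume s: "s \<in> {-l..l}"
      have "B s * V s * (u s * u s) + lam * (B s * (u s * u s)) = (B s * V s + lam * B s) * (u s)\<^sup>2"
        by (simp add: algebra_simps power2_eq_square)
      also have "\<dots> \<le> K * (h * E)"
        using K(2)[OF s] K(1) pt[OF s] by (intro mult_mono) auto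
      finally show "B s * V s * (u s * u s) + lam * (B s * (u s * u s)) \<le> K * (h * E)" .
    qed
    also have "\<dots> = K * (h * E) * (2 * l)" using l_pos by (simp add: set_lebesgue_integral_def)
    also have "\<dots> = b * E / 2" using K l_pos by (simp add: h_def)
    also have "\<dots> < b * E" using b E by simp
    finally show ?thesis using 1 S by simp
  qed
  then show ?thesis using I(1) unfolding coercive_def by blast
qed

text \<open>Jacobi's factorization. With \<open>\<sigma> = B f' / f\<close> the integrand of the form is
\<open>B (u' - (f'/f) u)\<^sup>2 + (\<sigma> u\<^sup>2)'\<close>, and the exact derivative integrates to zero when \<open>u(\<plusminus>l) = 0\<close>. If
the square vanishes almost everywhere, then \<open>u / f\<close> is constant, hence zero.\<close>

lemma positive_jacobi_coercive:
  fixes f f' :: "real \<Rightarrow> real"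
  assumes f: "\<And>s. s \<in> {-l..l} \<Longrightarrow> (f has_real_derivative f' s) (at s within {-l..l})"
    and f': "\<And>s. s \<in> {-l..l} \<Longrightarrow> ((\<lambda>t. B t * f' t) has_real_derivative - B s * V s * f s) (at s within {-l..l})"
    and pos: "\<And>s. s \<in> {-l..l} \<Longrightarrow> f s > 0"
  shows "coercive 0 {-l, l}"
  unfolding coercive_def
proof (intro conjI ballI impI)
  fix u assume u: "u \<in> H1 l" "u \<noteq> (\<lambda>x. 0)" and z: "\<forall>x\<in>{-l, l}. u x = 0"
  define g where "g = weak_deriv l u"
  have g: "has_weak_deriv l u g" using H1D[OF u(1)] by (simp add: g_def)
  have gi: "set_integrable lborel {-l..l} g" using g by (rule has_weak_deriv_integrable)
  have cu: "continuous_on {-l..l} u" using H1_continuous[OF u(1)] .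
  have cf: "continuous_on {-l..l} f" by (rule DERIV_continuous_on[OF f])
  have cp: "continuous_on {-l..l} (\<lambda>t. B t * f' t)" by (rule DERIV_continuous_on[OF f'])
  have cf': "continuous_on {-l..l} f'"
  proof -
    have "continuous_on {-l..l} (\<lambda>t. (B t * f' t) / B t)"
      using B_pos by (intro continuous_intros cp B_cont) force
    moreover have "(B t * f' t) / B t = f' t" if "t \<in> {-l..l}" for t using B_pos[OF that] by simp
    ultimately show ?thesis using continuous_on_cong by (metis (mono_tags, lifting))
  qed
  have fnz: "\<forall>s\<in>{-l..l}. f s \<noteq> 0" using pos by force
  define \<sigma> where "\<sigma> s = B s * f' s / f s" for s
  define \<sigma>' where "\<sigma>' s = - B s * V s - B s * (f' s)\<^sup>2 / (f s)\<^sup>2" for s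
  have c\<sigma>: "continuous_on {-l..l} \<sigma>" unfolding \<sigma>_def using fnz by (intro continuous_intros cp cf) auto
  have c\<sigma>': "continuous_on {-l..l} \<sigma>'" unfolding \<sigma>'_def using fnz by (intro continuous_intros B_cont V_cont cf cf') auto
  have d\<sigma>: "(\<sigma> has_real_derivative \<sigma>' s) (at s within {-l..l})" if s: "s \<in> {-l..l}" for s
  proof -
    have "((\<lambda>t. B t * f' t / f t) has_real_derivative ((- B s * V s * f s) * f s - B s * f' s * f' s) / (f s * f s)) (at s within {-l..l})"
      using pos[OF s] by (intro DERIV_divide f f' s) auto
    moreover have "((- B s * V s * f s) * f s - B s * f' s * f' s) / (f s * f s) = \<sigma>' s"
      using pos[OF s] by (simp add: \<sigma>'_def field_simps power2_eq_square)
    ultimately show ?thesis unfolding \<sigma>_def by simp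
  qed
  have p\<sigma>: "\<sigma> x = \<sigma> (-l) + (LINT t:{-l..x}|lborel. \<sigma>' t)" if "x \<in> {-l..l}" for x
    using C1_primitive[OF d\<sigma> c\<sigma>' that] .
  have i\<sigma>': "set_integrable lborel {-l..l} \<sigma>'" by (rule set_integrable_continuous_Icc[OF c\<sigma>'])
  have pu: "u x = u (-l) + (LINT t:{-l..x}|lborel. g t)" if "x \<in> {-l..l}" for x
    using has_weak_deriv_eq[OF g that] .
  have l: "l \<in> {-l..l}" using l_pos by simp
  have ug: "set_integrable lborel {-l..l} (\<lambda>t. u t * g t)" using set_integrable_mult_continuous[OF gi cu] .
  have uug: "set_integrable lborel {-l..l} (\<lambda>t. g t * u t + u t * g t)" using ug by (intro set_integral_add(1)) (simp_all add: mult.commute)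
  have p2: "u x * u x = u (-l) * u (-l) + (LINT t:{-l..x}|lborel. g t * u t + u t * g t)" if "x \<in> {-l..l}" for x
    using product_of_primitives[OF gi gi pu pu that] .
  define R where "R t = \<sigma>' t * (u t * u t) + \<sigma> t * (g t * u t + u t * g t)" for t
  have iR: "set_integrable lborel {-l..l} R" unfolding R_def
    using set_integrable_mult_continuous[OF uug c\<sigma>] set_integrable_mult_continuous[OF i\<sigma>', of "\<lambda>t. u t * u t"] cu
    by (intro set_integral_add(1)) (auto simp: mult.commute intro: continuous_intros)
  have R0: "(LINT t:{-l..l}|lborel. R t) = 0"
    using product_of_primitives[OF i\<sigma>' uug p\<sigma> p2 l] z unfolding R_def by simp
  define Q where "Q t = B t * (g t - f' t / f t * u t)\<^sup>2" for t
  have pw: "B t * (g t * g t) - B t * V t * (u t * u t) = Q t + R t" if "t \<in> {-l..l}" for t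
    using pos[OF that] unfolding Q_def R_def \<sigma>_def \<sigma>'_def by (simp add: field_simps power2_eq_square)
  have iL: "set_integrable lborel {-l..l} (\<lambda>t. B t * (g t * g t) - B t * V t * (u t * u t))"
    by (intro set_integral_diff(1) deriv_term_integrable[OF g g] potential_term_integrable[OF cu cu])
  have iQ: "set_integrable lborel {-l..l} Q"
  proof -
    have "set_integrable lborel {-l..l} (\<lambda>t. (B t * (g t * g t) - B t * V t * (u t * u t)) - R t)"
      using iL iR by (rule set_integral_diff(1))
    then show ?thesis
      by (rule set_integrable_cong[THEN iffD1, rotated -1]) (auto simp: pw)
  qed
  have "S u u = (LINT t:{-l..l}|lborel. B t * (g t * g t) - B t * V t * (u t * u t))"
    using S_eq[OF u(1) g u(1) g] z set_integral_diff(2)[OF deriv_term_integrable[OF g g] potential_term_integrable[OF cu cu]] by simp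
  also have "\<dots> = (LINT t:{-l..l}|lborel. Q t + R t)"
    by (rule set_lebesgue_integral_cong) (auto simp: pw)
  also have "\<dots> = (LINT t:{-l..l}|lborel. Q t)"
    using set_integral_add(2)[OF iQ iR] R0 by simp
  finally have SQ: "S u u = (LINT t:{-l..l}|lborel. Q t)" .
  have Qn: "indicat_real {-l..l} t *\<^sub>R Q t \<ge> 0" for t
    using B_pos[of t] by (auto simp: Q_def indicator_def less_imp_le)
  have "S u u \<noteq> 0"
  proof
    assume "S u u = 0"
    then have "AE t in lborel. indicat_real {-l..l} t *\<^sub>R Q t = 0"
      using SQ iQ Qn unfolding set_lebesgue_integral_def set_integrable_def
      by (subst integral_nonneg_eq_0_iff_AE[symmetric]) auto
    then have ae: "AE t in lborel. t \<in> {-l..l} \<longrightarrow> g t = f' t / f t * u t"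
    proof eventually_elim
      case (elim t)
      then show ?case using B_pos[of t] by (auto simp: Q_def indicator_def)
    qed
    define k where "k t = - f' t / (f t)\<^sup>2" for t
    have ck: "continuous_on {-l..l} k" unfolding k_def using fnz by (intro continuous_intros cf cf') auto
    have dk: "((\<lambda>t. 1 / f t) has_real_derivative k s) (at s within {-l..l})" if s: "s \<in> {-l..l}" for s
      using DERIV_divide[OF DERIV_const f[OF s], of 1] pos[OF s] by (simp add: k_def power2_eq_square)
    have pk: "1 / f x = 1 / f (-l) + (LINT t:{-l..x}|lborel. k t)" if "x \<in> {-l..l}" for x
      using C1_primitive[OF dk ck that] .
    have "u x = 0" if x: "x \<in> {-l..l}" for x
    proof -
      have "1 / f x * u x = 1 / f (-l) * u (-l) + (LINT t:{-l..x}|lborel. k t * u t + 1 / f t * g t)"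
        by (rule product_of_primitives[OF set_integrable_continuous_Icc[OF ck] gi pk pu x])
      also have "(LINT t:{-l..x}|lborel. k t * u t + 1 / f t * g t) = 0"
        unfolding set_lebesgue_integral_def
      proof (rule integral_eq_zero_AE)
        show "AE t in lborel. indicat_real {-l..x} t *\<^sub>R (k t * u t + 1 / f t * g t) = 0"
          using ae
        proof eventually_elim
          case (elim t)
          then show ?case using fnz x by (auto simp: indicator_def k_def power2_eq_square)
        qed
      qed
      finally show ?thesis using z fnz x by auto
    qed
    then show False using u H1_outside[OF u(1)] by (metis (no_types, lifting) ext)
  qed
  moreover have "S u u \<ge> 0" unfolding SQ set_lebesgue_integral_def using Qn by (rule Bochner_Integration.integral_nonneg)
  ultimately show "0 * M u u < S u u" by simp
qed simp

text \<open>Integration by parts of \<open>(B w') v\<close>; the boundary terms are those of the form because of the Robin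
conditions. The function is cut off outside \<open>[-l, l]\<close> as elements of \<open>H1\<close> have to be.\<close>

lemma classical_eigenfunction:
  fixes w w' :: "real \<Rightarrow> real"
  assumes w: "\<And>s. s \<in> {-l..l} \<Longrightarrow> (w has_real_derivative w' s) (at s within {-l..l})"
    and w': "\<And>s. s \<in> {-l..l} \<Longrightarrow> ((\<lambda>t. B t * w' t) has_real_derivative - B s * (V s + \<kappa>) * w s) (at s within {-l..l})"
    and bc: "B l * w' l = C * w l" "B (-l) * w' (-l) = - C * w (-l)"
    and nz: "x0 \<in> {-l..l}" "w x0 \<noteq> 0"
  shows "\<kappa> \<in> spec"
proof -
  define u where "u x = (if x \<in> {-l..l} then w x else 0)" for x
  have cw: "continuous_on {-l..l} w" by (rule DERIV_continuous_on[OF w])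
  have cp: "continuous_on {-l..l} (\<lambda>t. B t * w' t)" by (rule DERIV_continuous_on[OF w'])
  have cw': "continuous_on {-l..l} w'"
  proof -
    have "continuous_on {-l..l} (\<lambda>t. (B t * w' t) / B t)"
      using B_pos by (intro continuous_intros cp B_cont) force
    moreover have "(B t * w' t) / B t = w' t" if "t \<in> {-l..l}" for t using B_pos[OF that] by simp
    ultimately show ?thesis using continuous_on_cong by (metis (mono_tags, lifting))
  qed
  have wd: "has_weak_deriv l u w'"
    unfolding has_weak_deriv_def
  proof (intro conjI ballI)
    show "set_borel_measurable lborel {-l..l} w'" by (rule set_measurable_continuous_Icc[OF cw'])
    show "set_integrable lborel {-l..l} (\<lambda>x. (w' x)\<^sup>2)" by (intro set_integrable_continuous_Icc continuous_intros cw')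
    show "u x = u (-l) + (LINT t:{-l..x}|lborel. w' t)" if "x \<in> {-l..l}" for x
      using C1_primitive[OF w cw' that] that l_pos by (simp add: u_def)
  qed
  have uH: "u \<in> H1 l" using wd by (rule H1I) (auto simp: u_def)
  have l: "l \<in> {-l..l}" using l_pos by simp
  define p where "p t = B t * w' t" for t
  define p' where "p' s = - B s * (V s + \<kappa>) * w s" for s
  have cp': "continuous_on {-l..l} p'" unfolding p'_def by (intro continuous_intros B_cont V_cont cw)
  have pp: "p x = p (-l) + (LINT t:{-l..x}|lborel. p' t)" if "x \<in> {-l..l}" for x
    using C1_primitive[OF _ cp' that, of p] w' unfolding p_def p'_def by auto
  have "S u v = \<kappa> * M u v" if v: "v \<in> H1 l" for v
  proof -
    define h where "h = weak_deriv l v"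
    have h: "has_weak_deriv l v h" using H1D[OF v] by (simp add: h_def)
    have hi: "set_integrable lborel {-l..l} h" using h by (rule has_weak_deriv_integrable)
    have cv: "continuous_on {-l..l} v" using H1_continuous[OF v] .
    have pv: "v x = v (-l) + (LINT t:{-l..x}|lborel. h t)" if "x \<in> {-l..l}" for x
      using has_weak_deriv_eq[OF h that] .
    have e: "p l * v l = p (-l) * v (-l) + (LINT t:{-l..l}|lborel. p' t * v t + p t * h t)"
      by (rule product_of_primitives[OF set_integrable_continuous_Icc[OF cp'] hi pp pv l])
    have i1: "set_integrable lborel {-l..l} (\<lambda>t. B t * V t * (u t * v t))"
      by (rule potential_term_integrable[OF H1_continuous[OF uH] cv])
    have i2: "set_integrable lborel {-l..l} (\<lambda>t. B t * (u t * v t))"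
      by (rule mass_term_integrable[OF H1_continuous[OF uH] cv])
    have i3: "set_integrable lborel {-l..l} (\<lambda>t. B t * (w' t * h t))"
      by (rule deriv_term_integrable[OF wd h])
    have "(LINT t:{-l..l}|lborel. p' t * v t + p t * h t) =
      (LINT t:{-l..l}|lborel. B t * (w' t * h t) - (B t * V t * (u t * v t) + \<kappa> * (B t * (u t * v t))))"
      by (rule set_lebesgue_integral_cong) (auto simp: p'_def p_def u_def algebra_simps)
    also have "\<dots> = (LINT t:{-l..l}|lborel. B t * (w' t * h t)) - ((LINT t:{-l..l}|lborel. B t * V t * (u t * v t)) + \<kappa> * M u v)"
      unfolding M_def
      by (subst set_integral_diff(2)[OF i3 set_integral_add(1)[OF i1 set_integrable_mult_right]], use i2 in simp)
        (subst set_integral_add(2)[OF i1 set_integrable_mult_right], use i2 in simp_all)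
    finally have "(LINT t:{-l..l}|lborel. B t * (w' t * h t)) - (LINT t:{-l..l}|lborel. B t * V t * (u t * v t))
       = \<kappa> * M u v + (p l * v l - p (-l) * v (-l))" using e by simp
    moreover have "p l * v l - p (-l) * v (-l) = C * (u l * v l + u (-l) * v (-l))"
      using bc l_pos by (simp add: p_def u_def algebra_simps)
    ultimately show ?thesis using S_eq[OF uH wd v h] by simp
  qed
  then have "u \<in> eig \<kappa>" using uH unfolding eig_def by blast
  moreover have "u x0 \<noteq> 0" using nz by (simp add: u_def)
  ultimately show ?thesis unfolding spec_def by (auto simp: fun_eq_iff)
qed

end

section \<open>Infinitely many eigenvalues by shooting\<close>

text \<open>Banach's fixed point theorem in the space of bounded continuous functions, after extending functions
from the box to the whole space by clamping the argument.\<close>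

lemma contraction_of_continuous_functions:
  fixes P :: "('a::euclidean_space \<Rightarrow> real) \<Rightarrow> 'a \<Rightarrow> real"
  assumes ne: "\<And>i. i \<in> Basis \<Longrightarrow> a \<bullet> i \<le> b \<bullet> i"
    and cont: "\<And>w. continuous_on (cbox a b) w \<Longrightarrow> continuous_on (cbox a b) (P w)"
    and contr: "\<And>w v d z. continuous_on (cbox a b) w \<Longrightarrow> continuous_on (cbox a b) v \<Longrightarrow>
       (\<And>y. y \<in> cbox a b \<Longrightarrow> \<bar>w y - v y\<bar> \<le> d) \<Longrightarrow> z \<in> cbox a b \<Longrightarrow> \<bar>P w z - P v z\<bar> \<le> d / 2"
  shows "\<exists>w. continuous_on (cbox a b) w \<and> (\<forall>z\<in>cbox a b. w z = P w z)"
proof -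
  define T where "T w = Bcontfun (ext_cont (P (apply_bcontfun w)) a b)" for w :: "'a \<Rightarrow>\<^sub>C real"
  have Tap: "apply_bcontfun (T w) z = P (apply_bcontfun w) (clamp a b z)" for w z
  proof -
    have c: "continuous_on (cbox a b) (P (apply_bcontfun w))" by (rule cont) simp
    have "ext_cont (P (apply_bcontfun w)) a b \<in> bcontfun"
      unfolding bcontfun_def using continuous_on_ext_cont[OF c]
        clamp_bounded[OF compact_imp_bounded[OF compact_continuous_image[OF c compact_cbox]]]
      by (auto simp: ext_cont_def)
    then show ?thesis unfolding T_def by (simp add: Bcontfun_inverse ext_cont_def)
  qed
  have "dist (T w) (T v) \<le> (1/2) * dist w v" for w v
  proof (rule dist_bound)
    fix z
    have "\<bar>apply_bcontfun w y - apply_bcontfun v y\<bar> \<le> dist w v" for y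
      using dist_bounded[of w y v] by (simp add: dist_real_def)
    then have "\<bar>P w (clamp a b z) - P v (clamp a b z)\<bar> \<le> dist w v / 2"
      using ne by (intro contr clamp_in_interval) auto
    then show "dist (T w z) (T v z) \<le> 1 / 2 * dist w v" by (simp add: Tap dist_real_def)
  qed
  then obtain w where w: "T w = w" using banach_fix_type[of "1/2" T] by auto
  have "apply_bcontfun w z = P (apply_bcontfun w) z" if "z \<in> cbox a b" for z
    using Tap[of w z] w that by simp
  then show ?thesis using continuous_on_apply_bcontfun[of "cbox a b" w] by blast
qed

lemma DERIV_within_transform:
  fixes f g :: "real \<Rightarrow> real"
  assumes "(f has_real_derivative D) (at x within S)" "x \<in> S" "\<And>y. y \<in> S \<Longrightarrow> g y = f y"
  shows "(g has_real_derivative D) (at x within S)"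
  using assms unfolding has_field_derivative_def by (blast intro: has_derivative_transform)

text \<open>The substitution \<open>t = a + \<tau> (s - a)\<close> moves the variable end point into the integrand, where the
continuity theorem for integrals with a parameter applies.\<close>

lemma sliding_integral_continuous:
  fixes f :: "real \<Rightarrow> real \<Rightarrow> real"
  assumes f: "continuous_on (U \<times> {a..b}) (\<lambda>(k, t). f k t)"
  shows "continuous_on (U \<times> {a..b}) (\<lambda>(k, s). integral {a..s} (f k))"
proof -
  have eq: "integral {0..1} (\<lambda>\<tau>. (snd x - a) * f (fst x) (a + \<tau> * (snd x - a))) = integral {a..snd x} (f (fst x))"
    if x: "x \<in> U \<times> {a..b}" for x
  proof -
    have fk: "continuous_on {a..b} (f (fst x))"
      by (rule continuous_on_compose2[OF f, of "{a..b}" "\<lambda>t. (fst x, t)", simplified])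
        (use x in \<open>auto intro!: continuous_intros\<close>)
    have conv: "a + \<tau> * (snd x - a) \<in> {a..b}" if "\<tau> \<in> {0..1}" for \<tau>
    proof -
      have "0 \<le> \<tau> * (snd x - a)" using that x by auto
      moreover have "\<tau> * (snd x - a) \<le> 1 * (snd x - a)" using that x by (intro mult_right_mono) auto
      ultimately show ?thesis using x by auto
    qed
    have d: "((\<lambda>\<tau>. a + \<tau> * (snd x - a)) has_real_derivative (snd x - a)) (at \<tau> within {0..1})" for \<tau>
      by (auto intro!: derivative_eq_intros)
    have "((\<lambda>\<tau>. (snd x - a) * f (fst x) (a + \<tau> * (snd x - a))) has_integral
        (integral {a..snd x} (f (fst x)))) {0..1}"
      using has_integral_substitution[of 0 1 "\<lambda>\<tau>. a + \<tau> * (snd x - a)" a b "f (fst x)" "\<lambda>_. snd x - a", OF _ _ image_subsetI[OF conv] fk d] x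
      by auto
    then show ?thesis by (rule integral_unique)
  qed
  have "continuous_on ((U \<times> {a..b}) \<times> cbox 0 (1::real)) (\<lambda>(x, \<tau>). (snd x - a) * f (fst x) (a + \<tau> * (snd x - a)))"
  proof -
    let ?h = "\<lambda>p::(real \<times> real) \<times> real. (fst (fst p), a + snd p * (snd (fst p) - a))"
    have c1: "continuous_on ((U \<times> {a..b}) \<times> cbox 0 (1::real)) ?h"
      by (intro continuous_intros)
    have c2: "?h ` ((U \<times> {a..b}) \<times> cbox 0 (1::real)) \<subseteq> U \<times> {a..b}"
    proof clarsimp
      fix s \<tau> :: real assume "a \<le> s" "s \<le> b" "0 \<le> \<tau>" "\<tau> \<le> 1"
      moreover have "\<tau> * (s - a) \<le> 1 * (s - a)" using calculation by (intro mult_right_mono) auto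
      ultimately show "a + \<tau> * (s - a) \<le> b" by simp
    qed
    have "continuous_on ((U \<times> {a..b}) \<times> cbox 0 (1::real)) (\<lambda>p. f (fst (fst p)) (a + snd p * (snd (fst p) - a)))"
      using continuous_on_compose2[OF f c1 c2] by simp
    then show ?thesis unfolding split_beta by (intro continuous_intros)
  qed
  from integral_continuous_on_param[OF this]
  have "continuous_on (U \<times> {a..b}) (\<lambda>x. integral {0..1} (\<lambda>\<tau>. (snd x - a) * f (fst x) (a + \<tau> * (snd x - a))))"
    by simp
  then show ?thesis by (rule continuous_on_eq) (use eq in \<open>simp add: split_beta\<close>)
qed

lemma abs_integral_le:
  fixes f :: "real \<Rightarrow> real"
  assumes "continuous_on {a..b} f" "\<And>t. t \<in> {a..b} \<Longrightarrow> \<bar>f t\<bar> \<le> C" "s \<in> {a..b}" "C \<ge> 0"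
  shows "\<bar>integral {a..s} f\<bar> \<le> C * (b - a)"
proof -
  have "\<bar>integral {a..s} f\<bar> \<le> C * (s - a)"
    using integral_bound[of a s f C] assms continuous_on_subset[OF assms(1), of "{a..s}"] by auto
  also have "\<dots> \<le> C * (b - a)" using assms by (intro mult_left_mono) auto
  finally show ?thesis .
qed

text \<open>Variation of constants turns \<open>y'' + (k\<^sup>2 + q) y = 0\<close> with \<open>y = 1\<close>, \<open>y' = c0\<close> at \<open>x0\<close> into
\<open>y(s) = cos(k (s - x0)) + (c0/k) sin(k (s - x0)) - (1/k) \<integral> sin(k (s - t)) q(t) y(t) dt\<close>, which is a
contraction with factor \<open>1/2\<close> once \<open>k \<ge> 2 Q (x1 - x0)\<close>. Solving it in the space of continuous functions
of the pair \<open>(k, s)\<close> gives the continuous dependence on \<open>k\<close> at the same time.\<close>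

lemma oscillator_solutions_exist:
  fixes q :: "real \<Rightarrow> real"
  assumes L: "x0 < x1" and q: "continuous_on {x0..x1} q" "\<And>t. t \<in> {x0..x1} \<Longrightarrow> \<bar>q t\<bar> \<le> Q"
    and ka: "ka \<le> kb" "ka > 0" "ka \<ge> 2 * Q * (x1 - x0)" "ka \<ge> \<bar>c0\<bar>"
  obtains y y' where
    "\<And>k s. k \<in> {ka..kb} \<Longrightarrow> s \<in> {x0..x1} \<Longrightarrow> (y k has_real_derivative y' k s) (at s within {x0..x1})"
    "\<And>k s. k \<in> {ka..kb} \<Longrightarrow> s \<in> {x0..x1} \<Longrightarrow> (y' k has_real_derivative - (k\<^sup>2 + q s) * y k s) (at s within {x0..x1})"
    "\<And>k. k \<in> {ka..kb} \<Longrightarrow> y k x0 = 1" "\<And>k. k \<in> {ka..kb} \<Longrightarrow> y' k x0 = c0"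
    "continuous_on {ka..kb} (\<lambda>k. y k x1)" "continuous_on {ka..kb} (\<lambda>k. y' k x1)"
    "\<And>k. k \<in> {ka..kb} \<Longrightarrow> \<bar>y k x1\<bar> \<le> 4"
    "\<And>k. k \<in> {ka..kb} \<Longrightarrow> \<bar>y' k x1 + k * sin (k * (x1 - x0))\<bar> \<le> \<bar>c0\<bar> + 8 * Q * (x1 - x0)"
proof -
  define D where "D = {ka..kb} \<times> {x0..x1}"
  have Dc: "D = cbox (ka, x0) (kb, x1)" by (simp add: D_def cbox_Pair_eq)
  have Q0: "Q \<ge> 0" using q(2)[of x0] L by auto
  define Ic where "Ic w k s = integral {x0..s} (\<lambda>t. cos (k * t) * q t * w (k, t))" for w :: "real \<times> real \<Rightarrow> real" and k s
  define Is where "Is w k s = integral {x0..s} (\<lambda>t. sin (k * t) * q t * w (k, t))" for w :: "real \<times> real \<Rightarrow> real" and k s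
  define P where "P w z = (case z of (k, s) \<Rightarrow> cos (k * (s - x0)) + c0 / k * sin (k * (s - x0))
      - (1 / k) * (sin (k * s) * Ic w k s - cos (k * s) * Is w k s))" for w z
  have qD: "continuous_on D (\<lambda>z. q (snd z))"
    by (rule continuous_on_compose2[OF q(1)]) (auto simp: D_def intro!: continuous_intros)
  have cI: "continuous_on D (\<lambda>(k, s). Ic w k s)" "continuous_on D (\<lambda>(k, s). Is w k s)" if w: "continuous_on D w" for w
  proof -
    show "continuous_on D (\<lambda>(k, s). Ic w k s)" unfolding Ic_def D_def
      by (rule sliding_integral_continuous, fold D_def) (use qD w in \<open>auto simp: split_beta intro!: continuous_intros\<close>)
    show "continuous_on D (\<lambda>(k, s). Is w k s)" unfolding Is_def D_def
      by (rule sliding_integral_continuous, fold D_def) (use qD w in \<open>auto simp: split_beta intro!: continuous_intros\<close>)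
  qed
  have contP: "continuous_on D (P w)" if w: "continuous_on D w" for w
  proof -
    have "\<forall>z\<in>D. fst z \<noteq> 0" using ka by (auto simp: D_def)
    then show ?thesis unfolding P_def using cI[OF w] unfolding split_beta
      by (intro continuous_intros) auto
  qed
  have wk: "continuous_on {x0..x1} (\<lambda>t. w (k, t))" if "continuous_on D w" "k \<in> {ka..kb}" for w :: "real \<times> real \<Rightarrow> real" and k
    by (rule continuous_on_compose2[OF that(1)]) (use that in \<open>auto simp: D_def intro!: continuous_intros\<close>)
  have comb: "sin (k * s) * Ic w k s - cos (k * s) * Is w k s = integral {x0..s} (\<lambda>t. sin (k * (s - t)) * q t * w (k, t))"
    if w: "continuous_on D w" and k: "k \<in> {ka..kb}" and s: "s \<in> {x0..x1}" for w k s
  proof -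
    have sub: "{x0..s} \<subseteq> {x0..x1}" using s by auto
    note c = continuous_on_subset[OF q(1) sub] continuous_on_subset[OF wk[OF w k] sub]
    have "sin (k * s) * Ic w k s - cos (k * s) * Is w k s =
      integral {x0..s} (\<lambda>t. sin (k * s) * (cos (k * t) * q t * w (k, t))) - integral {x0..s} (\<lambda>t. cos (k * s) * (sin (k * t) * q t * w (k, t)))"
      by (simp add: Ic_def Is_def)
    also have "\<dots> = integral {x0..s} (\<lambda>t. sin (k * s) * (cos (k * t) * q t * w (k, t)) - cos (k * s) * (sin (k * t) * q t * w (k, t)))"
      by (rule Henstock_Kurzweil_Integration.integral_diff[symmetric]) (auto intro!: integrable_continuous_real continuous_intros c)
    also have "(\<lambda>t. sin (k * s) * (cos (k * t) * q t * w (k, t)) - cos (k * s) * (sin (k * t) * q t * w (k, t))) = (\<lambda>t. sin (k * (s - t)) * q t * w (k, t))"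
      by (auto simp: right_diff_distrib sin_diff algebra_simps)
    finally show ?thesis .
  qed
  have contrP: "\<bar>P w z - P v z\<bar> \<le> d / 2" if w: "continuous_on D w" and v: "continuous_on D v"
     and d: "\<And>y. y \<in> D \<Longrightarrow> \<bar>w y - v y\<bar> \<le> d" and z: "z \<in> D" for w v d z
  proof -
    obtain k s where ks: "z = (k, s)" "k \<in> {ka..kb}" "s \<in> {x0..x1}" using z by (auto simp: D_def)
    have k: "k > 0" using ks ka by auto
    have d0: "d \<ge> 0" using d[OF z] by auto
    have sub: "{x0..s} \<subseteq> {x0..x1}" using ks by auto
    note c = continuous_on_subset[OF q(1) sub] continuous_on_subset[OF wk[OF w ks(2)] sub] continuous_on_subset[OF wk[OF v ks(2)] sub]
    have "P w z - P v z = - (1 / k) * (integral {x0..s} (\<lambda>t. sin (k * (s - t)) * q t * w (k, t)) - integral {x0..s} (\<lambda>t. sin (k * (s - t)) * q t * v (k, t)))"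
    proof -
      have gen: "a + b - t * X - (a + b - t * Y) = - t * (X - Y)" for a b t X Y :: real by (simp add: algebra_simps)
      show ?thesis unfolding P_def ks(1) prod.case comb[OF w ks(2,3)] comb[OF v ks(2,3)] by (rule gen)
    qed
    also have "(integral {x0..s} (\<lambda>t. sin (k * (s - t)) * q t * w (k, t)) - integral {x0..s} (\<lambda>t. sin (k * (s - t)) * q t * v (k, t)))
      = integral {x0..s} (\<lambda>t. sin (k * (s - t)) * q t * w (k, t) - sin (k * (s - t)) * q t * v (k, t))"
      by (rule Henstock_Kurzweil_Integration.integral_diff[symmetric]) (auto intro!: integrable_continuous_real continuous_intros c)
    finally have e: "\<bar>P w z - P v z\<bar> = (1 / k) * \<bar>integral {x0..s} (\<lambda>t. sin (k * (s - t)) * q t * w (k, t) - sin (k * (s - t)) * q t * v (k, t))\<bar>"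
      using k by (simp add: abs_mult)
    have "\<bar>integral {x0..s} (\<lambda>t. sin (k * (s - t)) * q t * w (k, t) - sin (k * (s - t)) * q t * v (k, t))\<bar> \<le> (Q * d) * (x1 - x0)"
    proof (rule abs_integral_le[OF _ _ ks(3)])
      show "continuous_on {x0..x1} (\<lambda>t. sin (k * (s - t)) * q t * w (k, t) - sin (k * (s - t)) * q t * v (k, t))"
        by (intro continuous_intros q wk w v ks)
      fix t assume t: "t \<in> {x0..x1}"
      have "\<bar>sin (k * (s - t)) * q t * w (k, t) - sin (k * (s - t)) * q t * v (k, t)\<bar> = \<bar>sin (k * (s - t))\<bar> * \<bar>q t\<bar> * \<bar>w (k, t) - v (k, t)\<bar>"
        by (simp add: abs_mult[symmetric] right_diff_distrib)
      also have "\<dots> \<le> 1 * Q * d"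
        using q(2)[OF t] d[of "(k, t)"] ks t Q0 by (intro mult_mono) (auto simp: D_def)
      finally show "\<bar>sin (k * (s - t)) * q t * w (k, t) - sin (k * (s - t)) * q t * v (k, t)\<bar> \<le> Q * d" by simp
    qed (use Q0 d0 in auto)
    then have "\<bar>P w z - P v z\<bar> \<le> (1 / k) * ((Q * d) * (x1 - x0))" unfolding e using k by (intro mult_left_mono) auto
    also have "\<dots> = (2 * Q * (x1 - x0)) * d / (2 * k)" by simp
    also have "\<dots> \<le> k * d / (2 * k)" using ks ka k d0 by (intro divide_right_mono mult_right_mono) auto
    finally show ?thesis using k by simp
  qed
  have "\<exists>w. continuous_on (cbox (ka, x0) (kb, x1)) w \<and> (\<forall>z\<in>cbox (ka, x0) (kb, x1). w z = P w z)"
    by (rule contraction_of_continuous_functions)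
      (use contP contrP L ka in \<open>auto simp: Dc[symmetric] Basis_prod_def\<close>)
  then obtain w where w: "continuous_on D w" "\<And>z. z \<in> D \<Longrightarrow> w z = P w z" unfolding Dc by blast
  define y where "y k s = w (k, s)" for k s
  define y' where "y' k s = - k * sin (k * (s - x0)) + c0 * cos (k * (s - x0)) - (cos (k * s) * Ic w k s + sin (k * s) * Is w k s)" for k s
  have ye: "y k s = P w (k, s)" if "k \<in> {ka..kb}" "s \<in> {x0..x1}" for k s
    using w(2)[of "(k, s)"] that by (simp add: y_def D_def)
  have dI: "(Ic w k has_real_derivative cos (k * s) * q s * y k s) (at s within {x0..x1})"
           "(Is w k has_real_derivative sin (k * s) * q s * y k s) (at s within {x0..x1})"
    if k: "k \<in> {ka..kb}" and s: "s \<in> {x0..x1}" for k s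
  proof -
    show "(Ic w k has_real_derivative cos (k * s) * q s * y k s) (at s within {x0..x1})"
      unfolding Ic_def y_def by (rule integral_has_real_derivative[OF _ s]) (intro continuous_intros q wk w k)
    show "(Is w k has_real_derivative sin (k * s) * q s * y k s) (at s within {x0..x1})"
      unfolding Is_def y_def by (rule integral_has_real_derivative[OF _ s]) (intro continuous_intros q wk w k)
  qed
  have D1: "(y k has_real_derivative y' k s) (at s within {x0..x1})" if k: "k \<in> {ka..kb}" and s: "s \<in> {x0..x1}" for k s
  proof -
    have k0: "k > 0" using k ka by auto
    have "((\<lambda>s. cos (k * (s - x0)) + c0 / k * sin (k * (s - x0))
      - (1 / k) * (sin (k * s) * Ic w k s - cos (k * s) * Is w k s)) has_real_derivative
       (- k * sin (k * (s - x0)) + c0 * cos (k * (s - x0)) - (1 / k) * (k * cos (k * s) * Ic w k s + sin (k * s) * (cos (k * s) * q s * y k s)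
         - (- k * sin (k * s) * Is w k s + cos (k * s) * (sin (k * s) * q s * y k s))))) (at s within {x0..x1})"
      using k0 by (auto intro!: derivative_eq_intros dI k s)
    also have "(- k * sin (k * (s - x0)) + c0 * cos (k * (s - x0)) - (1 / k) * (k * cos (k * s) * Ic w k s + sin (k * s) * (cos (k * s) * q s * y k s)
         - (- k * sin (k * s) * Is w k s + cos (k * s) * (sin (k * s) * q s * y k s)))) = y' k s"
      using k0 unfolding y'_def by (simp add: field_simps)
    finally show ?thesis
      by (rule DERIV_within_transform[OF _ s]) (use ye k in \<open>auto simp: P_def\<close>)
  qed
  have D2: "(y' k has_real_derivative - (k\<^sup>2 + q s) * y k s) (at s within {x0..x1})" if k: "k \<in> {ka..kb}" and s: "s \<in> {x0..x1}" for k s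
  proof -
    have k0: "k > 0" using k ka by auto
    have "(y' k has_real_derivative
       (- k * (k * cos (k * (s - x0))) + c0 * (- k * sin (k * (s - x0))) - ((- k * sin (k * s)) * Ic w k s + cos (k * s) * (cos (k * s) * q s * y k s)
         + (k * cos (k * s) * Is w k s + sin (k * s) * (sin (k * s) * q s * y k s))))) (at s within {x0..x1})"
      unfolding y'_def by (auto intro!: derivative_eq_intros dI k s)
    also have "(- k * (k * cos (k * (s - x0))) + c0 * (- k * sin (k * (s - x0))) - ((- k * sin (k * s)) * Ic w k s + cos (k * s) * (cos (k * s) * q s * y k s)
         + (k * cos (k * s) * Is w k s + sin (k * s) * (sin (k * s) * q s * y k s))))
       = - k\<^sup>2 * P w (k, s) - (cos (k * s) * cos (k * s) + sin (k * s) * sin (k * s)) * (q s * y k s)"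
      using k0 unfolding P_def by (simp add: field_simps power2_eq_square del: sin_cos_squared_add3)
    also have "\<dots> = - (k\<^sup>2 + q s) * y k s" unfolding ye[OF k s, symmetric] by (simp add: algebra_simps)
    finally show ?thesis .
  qed
  \<comment> \<open>At a maximum point of \<open>|w|\<close> the contraction bound against the zero function gives \<open>|w| \<le> 2 + |w| / 2\<close>.\<close>
  have bound: "\<bar>w z\<bar> \<le> 4" if "z \<in> D" for z
  proof -
    have "D \<noteq> {}" "compact D" using L ka by (auto simp: D_def intro!: compact_Times)
    then obtain m where m: "m \<in> D" "\<And>z. z \<in> D \<Longrightarrow> \<bar>w z\<bar> \<le> \<bar>w m\<bar>"
      using continuous_attains_sup[of D "\<lambda>z. \<bar>w z\<bar>"] continuous_on_rabs[OF w(1)] by blast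
    obtain k s where ks: "m = (k, s)" "k \<in> {ka..kb}" "s \<in> {x0..x1}" using m by (auto simp: D_def)
    have k: "k > 0" using ks ka by auto
    have "\<bar>P w m - P (\<lambda>_. 0) m\<bar> \<le> \<bar>w m\<bar> / 2" using m by (intro contrP w) auto
    moreover have "\<bar>P (\<lambda>_. 0) m\<bar> \<le> 2"
    proof -
      have "\<bar>c0 / k * sin (k * (s - x0))\<bar> \<le> 1 * 1"
        unfolding abs_mult using ks ka k by (intro mult_mono) (auto simp: field_simps)
      moreover have "\<bar>cos (k * (s - x0))\<bar> \<le> 1" by simp
      ultimately have "\<bar>cos (k * (s - x0)) + c0 / k * sin (k * (s - x0))\<bar> \<le> 2" by linarith
      then show ?thesis unfolding P_def ks Ic_def Is_def by simp
    qed
    ultimately have "\<bar>w m\<bar> \<le> 4" using w(2)[OF m(1)] by linarith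
    then show ?thesis using m(2)[OF that] by linarith
  qed
  have x1: "x1 \<in> {x0..x1}" and x0: "x0 \<in> {x0..x1}" using L by auto
  have "\<bar>y' k x1 + k * sin (k * (x1 - x0))\<bar> \<le> \<bar>c0\<bar> + 8 * Q * (x1 - x0)" if k: "k \<in> {ka..kb}" for k
  proof -
    have b: "\<bar>f (k * t) * q t * w (k, t)\<bar> \<le> Q * 4" if f: "\<And>x. \<bar>f x\<bar> \<le> 1" and t: "t \<in> {x0..x1}" for f :: "real \<Rightarrow> real" and t
    proof -
      have "\<bar>f (k * t)\<bar> * \<bar>q t\<bar> * \<bar>w (k, t)\<bar> \<le> 1 * Q * 4"
        using q(2)[OF t] bound[of "(k, t)"] k t Q0 f by (intro mult_mono) (auto simp: D_def)
      then show ?thesis by (simp add: abs_mult)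
    qed
    have 1: "\<bar>Ic w k x1\<bar> \<le> Q * 4 * (x1 - x0)" unfolding Ic_def
      by (rule abs_integral_le) (use b[of cos] Q0 x1 in \<open>auto intro!: continuous_intros q wk w k\<close>)
    have 2: "\<bar>Is w k x1\<bar> \<le> Q * 4 * (x1 - x0)" unfolding Is_def
      by (rule abs_integral_le) (use b[of sin] Q0 x1 in \<open>auto intro!: continuous_intros q wk w k\<close>)
    have 3: "\<bar>cos (k * x1) * Ic w k x1\<bar> \<le> 1 * (Q * 4 * (x1 - x0))" unfolding abs_mult using 1 by (intro mult_mono) auto
    have 4: "\<bar>sin (k * x1) * Is w k x1\<bar> \<le> 1 * (Q * 4 * (x1 - x0))" unfolding abs_mult using 2 by (intro mult_mono) auto
    have 5: "\<bar>c0 * cos (k * (x1 - x0))\<bar> \<le> \<bar>c0\<bar> * 1" unfolding abs_mult by (intro mult_mono) auto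
    show ?thesis unfolding y'_def using 3 4 5 by simp
  qed
  moreover have "continuous_on {ka..kb} (\<lambda>k. y k x1)" unfolding y_def
    by (rule continuous_on_compose2[OF w(1)]) (use x1 in \<open>auto simp: D_def intro!: continuous_intros\<close>)
  moreover have "continuous_on {ka..kb} (\<lambda>k. y' k x1)"
  proof -
    have cp: "continuous_on {ka..kb} (\<lambda>k. (k, x1))" by (intro continuous_intros)
    have im: "(\<lambda>k. (k, x1)) ` {ka..kb} \<subseteq> D" using x1 by (auto simp: D_def)
    have "continuous_on {ka..kb} (\<lambda>k. Ic w k x1)"
      using continuous_on_compose2[OF cI(1)[OF w(1)] cp im] by simp
    moreover have "continuous_on {ka..kb} (\<lambda>k. Is w k x1)"
      using continuous_on_compose2[OF cI(2)[OF w(1)] cp im] by simp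
    ultimately show ?thesis unfolding y'_def by (intro continuous_intros)
  qed
  moreover have "y k x0 = 1" "y' k x0 = c0" if "k \<in> {ka..kb}" for k
    using ye[OF that x0] by (auto simp: P_def y'_def Ic_def Is_def)
  moreover have "\<bar>y k x1\<bar> \<le> 4" if "k \<in> {ka..kb}" for k
    using bound[of "(k, x1)"] that x1 by (simp add: y_def D_def)
  ultimately show ?thesis using that[of y y'] D1 D2 by blast
qed

text \<open>The boundary defect \<open>y'(x1) - c1 y(x1)\<close> differs from \<open>- k sin(k (x1 - x0))\<close> by a bounded amount.
Between two consecutive values of \<open>k\<close> at which the sine is \<open>1\<close> and \<open>-1\<close> it therefore changes sign,
provided \<open>k\<close> exceeds that bound.\<close>

lemma robin_oscillator_unbounded_spectrum:
  fixes q :: "real \<Rightarrow> real"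
  assumes L: "x0 < x1" and q: "continuous_on {x0..x1} q"
  obtains k w w' where "k > K"
    "\<And>s. s \<in> {x0..x1} \<Longrightarrow> (w has_real_derivative w' s) (at s within {x0..x1})"
    "\<And>s. s \<in> {x0..x1} \<Longrightarrow> (w' has_real_derivative - (k\<^sup>2 + q s) * w s) (at s within {x0..x1})"
    "w x0 = 1" "w' x0 = c0" "w' x1 = c1 * w x1"
proof -
  obtain Q where "\<forall>x\<in>q ` {x0..x1}. \<bar>x\<bar> \<le> Q"
    using compact_imp_bounded[OF compact_continuous_image[OF q compact_Icc]] unfolding bounded_real by blast
  then have Q: "\<And>t. t \<in> {x0..x1} \<Longrightarrow> \<bar>q t\<bar> \<le> Q" by blast
  have Q0: "Q \<ge> 0" using Q[of x0] L by auto
  define R where "R = 1 + \<bar>K\<bar> + \<bar>c0\<bar> + 8 * Q * (x1 - x0) + 4 * \<bar>c1\<bar>"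
  have QL: "Q * (x1 - x0) \<ge> 0" using Q0 L by auto
  obtain n :: nat where n: "R * (x1 - x0) < n" using reals_Archimedean2 by blast
  \<comment> \<open>Here \<open>sin (ka (x1 - x0)) = 1\<close> and \<open>sin (kb (x1 - x0)) = -1\<close>.\<close>
  define ka where "ka = (pi / 2 + 2 * real n * pi) / (x1 - x0)"
  define kb where "kb = (3 * pi / 2 + 2 * real n * pi) / (x1 - x0)"
  have "real n * 1 \<le> real n * (2 * pi)" using pi_gt3 by (intro mult_left_mono) auto
  then have "R * (x1 - x0) < pi / 2 + 2 * real n * pi" using n pi_gt_zero by linarith
  then have kaR: "ka > R" unfolding ka_def using L by (simp add: field_simps)
  have kab: "ka \<le> kb" unfolding ka_def kb_def using L by (intro divide_right_mono) auto
  have sa: "sin (ka * (x1 - x0)) = 1"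
  proof -
    have "ka * (x1 - x0) = pi / 2 + 2 * real n * pi" using L by (simp add: ka_def)
    then show ?thesis by (simp add: sin_add sin_2npi cos_2npi)
  qed
  have sb: "sin (kb * (x1 - x0)) = - 1"
  proof -
    have "kb * (x1 - x0) = 3 * pi / 2 + 2 * real n * pi" using L by (simp add: kb_def)
    then show ?thesis using sin_3over2_pi by (simp add: sin_add sin_2npi cos_2npi)
  qed
  have "ka > 0" "ka \<ge> 2 * Q * (x1 - x0)" "ka \<ge> \<bar>c0\<bar>" using kaR QL by (auto simp: R_def)
  then obtain y y' where y:
    "\<And>k s. k \<in> {ka..kb} \<Longrightarrow> s \<in> {x0..x1} \<Longrightarrow> (y k has_real_derivative y' k s) (at s within {x0..x1})"
    "\<And>k s. k \<in> {ka..kb} \<Longrightarrow> s \<in> {x0..x1} \<Longrightarrow> (y' k has_real_derivative - (k\<^sup>2 + q s) * y k s) (at s within {x0..x1})"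
    "\<And>k. k \<in> {ka..kb} \<Longrightarrow> y k x0 = 1" "\<And>k. k \<in> {ka..kb} \<Longrightarrow> y' k x0 = c0"
    "continuous_on {ka..kb} (\<lambda>k. y k x1)" "continuous_on {ka..kb} (\<lambda>k. y' k x1)"
    "\<And>k. k \<in> {ka..kb} \<Longrightarrow> \<bar>y k x1\<bar> \<le> 4"
    "\<And>k. k \<in> {ka..kb} \<Longrightarrow> \<bar>y' k x1 + k * sin (k * (x1 - x0))\<bar> \<le> \<bar>c0\<bar> + 8 * Q * (x1 - x0)"
    using oscillator_solutions_exist[OF L q Q kab, of c0] by blast
  define F where "F k = y' k x1 - c1 * y k x1" for k
  have F: "\<bar>F k + k * sin (k * (x1 - x0))\<bar> < R" if "k \<in> {ka..kb}" for k
  proof -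
    have "\<bar>c1 * y k x1\<bar> \<le> \<bar>c1\<bar> * 4" unfolding abs_mult using y(7)[OF that] by (intro mult_left_mono) auto
    then show ?thesis using y(8)[OF that] unfolding F_def R_def by linarith
  qed
  have "F ka \<le> 0" using F[of ka] kab kaR sa by auto
  moreover have "0 \<le> F kb" using F[of kb] kab kaR sb by auto
  moreover have "continuous_on {ka..kb} F" unfolding F_def by (intro continuous_intros y)
  ultimately obtain k where k: "ka \<le> k" "k \<le> kb" "F k = 0" using IVT'[of F ka 0 kb] kab by auto
  have "k > K" using k kaR QL unfolding R_def by linarith
  then show ?thesis using that[of k "y k" "y' k"] y k by (auto simp: F_def)
qed

context robin_form begin

text \<open>The Liouville substitution \<open>u = w / \<surd>B\<close> removes the first order term and shifts the potential by
\<open>(\<surd>B)'' / \<surd>B\<close>; it needs \<open>B\<close> to be twice continuously differentiable.\<close>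

lemma infinite_spec:
  fixes B' B'' :: "real \<Rightarrow> real"
  assumes B': "\<And>s. s \<in> {-l..l} \<Longrightarrow> (B has_real_derivative B' s) (at s within {-l..l})"
    and B'': "\<And>s. s \<in> {-l..l} \<Longrightarrow> (B' has_real_derivative B'' s) (at s within {-l..l})"
    and cB'': "continuous_on {-l..l} B''"
  shows "infinite spec"
proof -
  define \<beta> where "\<beta> s = sqrt (B s)" for s
  define \<beta>' where "\<beta>' s = B' s / (2 * \<beta> s)" for s
  define \<beta>'' where "\<beta>'' s = B'' s / (2 * \<beta> s) - B' s * \<beta>' s / (2 * B s)" for s
  have pos: "\<beta> s > 0" if "s \<in> {-l..l}" for s using B_pos[OF that] by (simp add: \<beta>_def)
  have sq: "\<beta> s * \<beta> s = B s" if "s \<in> {-l..l}" for s using B_pos[OF that] by (simp add: \<beta>_def)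
  have d\<beta>: "(\<beta> has_real_derivative \<beta>' s) (at s within {-l..l})" if s: "s \<in> {-l..l}" for s
    unfolding \<beta>_def \<beta>'_def
    using DERIV_chain2[OF DERIV_real_sqrt[OF B_pos[OF s]] B'[OF s]] by (simp add: field_simps)
  have d\<beta>': "(\<beta>' has_real_derivative \<beta>'' s) (at s within {-l..l})" if s: "s \<in> {-l..l}" for s
  proof -
    have "((\<lambda>s. B' s / (2 * \<beta> s)) has_real_derivative (B'' s * (2 * \<beta> s) - B' s * (2 * \<beta>' s)) / ((2 * \<beta> s) * (2 * \<beta> s))) (at s within {-l..l})"
      using pos[OF s] by (intro DERIV_divide B'' s DERIV_cmult d\<beta>) auto
    moreover have "(B'' s * (2 * \<beta> s) - B' s * (2 * \<beta>' s)) / ((2 * \<beta> s) * (2 * \<beta> s)) = \<beta>'' s"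
      unfolding \<beta>''_def sq[OF s, symmetric] using pos[OF s] by (simp add: field_simps)
    ultimately show ?thesis unfolding \<beta>'_def by simp
  qed
  have c: "continuous_on {-l..l} \<beta>" "continuous_on {-l..l} \<beta>'" "continuous_on {-l..l} B'"
    using DERIV_continuous_on[OF d\<beta>] DERIV_continuous_on[OF d\<beta>'] DERIV_continuous_on[OF B''] by blast+
  have nz: "\<forall>s\<in>{-l..l}. \<beta> s \<noteq> 0" "\<forall>s\<in>{-l..l}. B s \<noteq> 0" using pos B_pos by force+
  define q where "q s = V s - \<beta>'' s / \<beta> s" for s
  have cq: "continuous_on {-l..l} q" unfolding q_def \<beta>''_def using nz
    by (intro continuous_intros V_cont c B_cont cB'') auto
  have ll: "-l < l" "l \<in> {-l..l}" "-l \<in> {-l..l}" using l_pos by auto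
  have "\<exists>\<kappa>\<in>spec. \<kappa> > K" for K
  proof -
    \<comment> \<open>The Robin conditions for \<open>u = w / \<surd>B\<close>, rewritten for \<open>w\<close>.\<close>
    define c0 where "c0 = - C / B (-l) + \<beta>' (-l) / \<beta> (-l)"
    define c1 where "c1 = C / B l + \<beta>' l / \<beta> l"
    obtain k w w' where k: "k > max K 1" and
      w: "\<And>s. s \<in> {-l..l} \<Longrightarrow> (w has_real_derivative w' s) (at s within {-l..l})" and
      w': "\<And>s. s \<in> {-l..l} \<Longrightarrow> (w' has_real_derivative - (k\<^sup>2 + q s) * w s) (at s within {-l..l})" and
      ini: "w (-l) = 1" "w' (-l) = c0" "w' l = c1 * w l"
      using robin_oscillator_unbounded_spectrum[OF ll(1) cq, of "max K 1" c0 c1] by blast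
    define u where "u s = w s / \<beta> s" for s
    define u' where "u' s = (w' s * \<beta> s - w s * \<beta>' s) / (\<beta> s * \<beta> s)" for s
    have du: "(u has_real_derivative u' s) (at s within {-l..l})" if s: "s \<in> {-l..l}" for s
      unfolding u_def u'_def using pos[OF s] by (intro DERIV_divide w d\<beta> s) auto
    have Bu': "B s * u' s = w' s * \<beta> s - w s * \<beta>' s" if s: "s \<in> {-l..l}" for s
      using nz s unfolding u'_def sq[OF s] by simp
    have dBu': "((\<lambda>s. B s * u' s) has_real_derivative - B s * (V s + k\<^sup>2) * u s) (at s within {-l..l})" if s: "s \<in> {-l..l}" for s
    proof -
      have "((\<lambda>s. w' s * \<beta> s - w s * \<beta>' s) has_real_derivative (- (k\<^sup>2 + q s) * w s) * \<beta> s + \<beta>' s * w' s - (w' s * \<beta>' s + \<beta>'' s * w s)) (at s within {-l..l})"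
        by (intro DERIV_diff DERIV_mult w w' d\<beta> d\<beta>' s)
      moreover have "(- (k\<^sup>2 + q s) * w s) * \<beta> s + \<beta>' s * w' s - (w' s * \<beta>' s + \<beta>'' s * w s) = - B s * (V s + k\<^sup>2) * u s"
        unfolding q_def u_def sq[OF s, symmetric] using nz s by (simp add: field_simps)
      ultimately have "((\<lambda>s. w' s * \<beta> s - w s * \<beta>' s) has_real_derivative - B s * (V s + k\<^sup>2) * u s) (at s within {-l..l})" by simp
      then show ?thesis by (rule DERIV_within_transform[OF _ s]) (simp add: Bu')
    qed
    have "k\<^sup>2 \<in> spec"
    proof (rule classical_eigenfunction[OF du dBu'])
      have "B l * u' l = c1 * w l * \<beta> l - w l * \<beta>' l" using Bu'[OF ll(2)] ini by simp
      also have "\<dots> = C * u l" unfolding c1_def u_def sq[OF ll(2), symmetric] using nz ll by (simp add: field_simps)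
      finally show "B l * u' l = C * u l" .
      have "B (-l) * u' (-l) = c0 * \<beta> (-l) - \<beta>' (-l)" using Bu'[OF ll(3)] ini by simp
      also have "\<dots> = - C * u (-l)" unfolding c0_def u_def sq[OF ll(3), symmetric] using nz ll ini by (simp add: field_simps)
      finally show "B (-l) * u' (-l) = - C * u (-l)" .
      show "-l \<in> {-l..l}" by (rule ll)
      show "u (-l) \<noteq> 0" using ini nz ll by (simp add: u_def)
    qed
    moreover have "k\<^sup>2 > K"
    proof -
      have "k * 1 \<le> k * k" using k by (intro mult_left_mono) auto
      then show ?thesis using k unfolding power2_eq_square by linarith
    qed
    ultimately show ?thesis by blast
  qed
  then have "\<exists>\<kappa>\<in>spec. \<kappa> > Max spec" by blast
  then show ?thesis by (meson Max_ge not_le)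
qed

end

section \<open>The catenoid family and its parametric Jacobi field\<close>

text \<open>This is \<open>B\<^sup>2 = A\<^sup>2 - 1\<close>. In this variable the remaining geometric quantities are algebraic:
\<open>cosh 2s\<close> is affine in it, and \<open>(a sinh 2s)\<^sup>2\<close> is quadratic.\<close>

definition cat_m :: "real \<Rightarrow> real \<Rightarrow> real" where
  "cat_m a s = a * cosh (2 * s) - 1 / 2"

lemma cat_m_ge: "a > 1 / 2 \<Longrightarrow> cat_m a s \<ge> a - 1 / 2"
  using mult_left_mono[OF cosh_real_ge_1[of "2 * s"], of a] by (simp add: cat_m_def)

lemma cat_m_pos: "a > 1 / 2 \<Longrightarrow> cat_m a s > 0"
  using cat_m_ge[of a s] by simp

lemma catB_eq: "catB a s = sqrt (cat_m a s)" by (simp add: catB_def cat_m_def)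
lemma catA_eq: "catA a s = sqrt (cat_m a s + 1)" by (simp add: catA_def cat_m_def)

lemma catB_sq: "a > 1 / 2 \<Longrightarrow> (catB a s)\<^sup>2 = cat_m a s"
  using cat_m_pos[of a s] by (simp add: catB_eq)
lemma catA_sq: "a > 1 / 2 \<Longrightarrow> (catA a s)\<^sup>2 = cat_m a s + 1"
  using cat_m_pos[of a s] by (simp add: catA_eq)
lemma catB_pos: "a > 1 / 2 \<Longrightarrow> catB a s > 0"
  using cat_m_pos[of a s] by (simp add: catB_eq)
lemma catA_gt_1: "a > 1 / 2 \<Longrightarrow> catA a s > 1"
  using cat_m_pos[of a s] by (simp add: catA_eq)

lemma
  assumes "a > 1 / 2"
  shows catK_sq: "(catK a)\<^sup>2 = a\<^sup>2 - 1 / 4"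
    and catK_pos: "catK a > 0"
proof -
  have "(1 / 2) * (1 / 2) < a * a" using assms by (intro mult_strict_mono) auto
  then have "a\<^sup>2 - 1 / 4 > 0" by (simp add: power2_eq_square)
  then show "(catK a)\<^sup>2 = a\<^sup>2 - 1 / 4" "catK a > 0" by (simp_all add: catK_def)
qed

lemma sinh_sq_eq:
  assumes "a > 1 / 2"
  shows "(a * sinh (2 * s))\<^sup>2 = (cat_m a s)\<^sup>2 + cat_m a s - (catK a)\<^sup>2"
proof -
  have "(a * sinh (2 * s))\<^sup>2 = (a * cosh (2 * s))\<^sup>2 - a\<^sup>2"
    by (simp add: power_mult_distrib sinh_square_eq algebra_simps)
  also have "a * cosh (2 * s) = cat_m a s + 1 / 2" by (simp add: cat_m_def)
  also have "(cat_m a s + 1 / 2)\<^sup>2 = (cat_m a s)\<^sup>2 + cat_m a s + 1 / 4" by (simp add: power2_eq_square field_simps)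
  finally show ?thesis using catK_sq[OF assms] by simp
qed

lemma cat_m_deriv: "(cat_m a has_real_derivative 2 * (a * sinh (2 * s))) (at s)"
  unfolding cat_m_def by (auto intro!: derivative_eq_intros)

lemma catB_deriv:
  assumes "a > 1 / 2"
  shows "(catB a has_real_derivative a * sinh (2 * s) / catB a s) (at s)"
proof -
  have "((\<lambda>s. sqrt (cat_m a s)) has_real_derivative a * sinh (2 * s) / sqrt (cat_m a s)) (at s)"
    using DERIV_chain2[OF DERIV_real_sqrt[OF cat_m_pos[OF assms]] cat_m_deriv] by (simp add: field_simps)
  then show ?thesis by (simp add: catB_eq[abs_def])
qed

lemma catB_continuous: "a > 1 / 2 \<Longrightarrow> continuous_on S (catB a)"
  using catB_deriv by (meson DERIV_continuous continuous_at_imp_continuous_on)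

text \<open>The oriented integral makes this valid on both sides of \<open>0\<close>.\<close>

lemma LBINT_primitive:
  fixes p :: "real \<Rightarrow> real"
  assumes "continuous_on UNIV p"
  shows "((\<lambda>s. LBINT t=0..s. p t) has_real_derivative p s) (at s)"
proof -
  have "((\<lambda>u. LBINT y=ereal 0..ereal u. p y) has_vector_derivative p s) (at s within {-\<bar>s\<bar> - 1..\<bar>s\<bar> + 1})"
    by (rule interval_integral_FTC2) (use assms in \<open>auto intro: continuous_on_subset\<close>)
  moreover have "at s within {-\<bar>s\<bar> - 1..\<bar>s\<bar> + 1} = at s"
    by (rule at_within_interior) (auto simp: interior_atLeastAtMost_real)
  ultimately show ?thesis
    by (simp add: has_real_derivative_iff_has_vector_derivative zero_ereal_def)
qed

definition phi_density :: "real \<Rightarrow> real \<Rightarrow> real" where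
  "phi_density a t = catK a / ((catA a t)\<^sup>2 * catB a t)"

text \<open>The parameter derivative of the integrand of \<open>\<phi>\<close>, in logarithmic form.\<close>

definition phi_density_da :: "real \<Rightarrow> real \<Rightarrow> real" where
  "phi_density_da a t = phi_density a t * (a / (catK a)\<^sup>2 - cosh (2 * t) / (cat_m a t + 1) - cosh (2 * t) / (2 * cat_m a t))"

definition phi_da :: "real \<Rightarrow> real \<Rightarrow> real" where
  "phi_da a s = (LBINT t=0..s. phi_density_da a t)"

lemma phi_density_pos: "a > 1 / 2 \<Longrightarrow> phi_density a t > 0"
  unfolding phi_density_def using catK_pos[of a] catB_pos[of a t] catA_gt_1[of a t] by (intro divide_pos_pos mult_pos_pos) auto

lemma phi_density_joint_continuous:
  "continuous_on ({1 / 2<..} \<times> UNIV) (\<lambda>(b, t). phi_density b t)"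
  "continuous_on ({1 / 2<..} \<times> UNIV) (\<lambda>(b, t). phi_density_da b t)"
proof -
  have nz: "\<forall>z\<in>{1 / 2<..} \<times> (UNIV::real set). cat_m (fst z) (snd z) \<noteq> 0" "\<forall>z\<in>{1 / 2<..} \<times> (UNIV::real set). cat_m (fst z) (snd z) + 1 \<noteq> 0"
     "\<forall>z\<in>{1 / 2<..} \<times> (UNIV::real set). (catK (fst z))\<^sup>2 \<noteq> 0" "\<forall>z\<in>{1 / 2<..} \<times> (UNIV::real set). 2 * cat_m (fst z) (snd z) \<noteq> 0"
    "\<forall>z\<in>{1 / 2<..} \<times> (UNIV::real set). (catA (fst z) (snd z))\<^sup>2 * catB (fst z) (snd z) \<noteq> 0"
  proof -
    have f: "fst z > 1 / 2" if "z \<in> {1 / 2<..} \<times> (UNIV::real set)" for z :: "real \<times> real" using that by (simp add: mem_Times_iff)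
    note q = cat_m_pos[OF f] catK_pos[OF f] catA_gt_1[OF f] catB_pos[OF f]
    show "\<forall>z\<in>{1 / 2<..} \<times> (UNIV::real set). cat_m (fst z) (snd z) \<noteq> 0"
      "\<forall>z\<in>{1 / 2<..} \<times> (UNIV::real set). 2 * cat_m (fst z) (snd z) \<noteq> 0"
      using q(1) by (simp_all add: less_imp_neq[symmetric])
    show "\<forall>z\<in>{1 / 2<..} \<times> (UNIV::real set). cat_m (fst z) (snd z) + 1 \<noteq> 0"
      using q(1) by (metis add_pos_pos less_irrefl zero_less_one)
    show "\<forall>z\<in>{1 / 2<..} \<times> (UNIV::real set). (catK (fst z))\<^sup>2 \<noteq> 0"
      using q(2) by (metis less_irrefl power_not_zero)
    show "\<forall>z\<in>{1 / 2<..} \<times> (UNIV::real set). (catA (fst z) (snd z))\<^sup>2 * catB (fst z) (snd z) \<noteq> 0"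
    proof
      fix z :: "real \<times> real" assume z: "z \<in> {1 / 2<..} \<times> (UNIV::real set)"
      show "(catA (fst z) (snd z))\<^sup>2 * catB (fst z) (snd z) \<noteq> 0" using q(3)[OF z, of "snd z"] q(4)[OF z, of "snd z"] by simp
    qed
  qed
  have c: "continuous_on S (\<lambda>z. cat_m (fst z) (snd z))" "continuous_on S (\<lambda>z. catK (fst z))"
     "continuous_on S (\<lambda>z. catA (fst z) (snd z))" "continuous_on S (\<lambda>z. catB (fst z) (snd z))" for S :: "(real \<times> real) set"
    unfolding cat_m_def catK_def catA_def catB_def by (intro continuous_intros)+
  show 1: "continuous_on ({1 / 2<..} \<times> UNIV) (\<lambda>(b, t). phi_density b t)"
    unfolding phi_density_def split_beta by (intro continuous_intros c nz)
  then show "continuous_on ({1 / 2<..} \<times> UNIV) (\<lambda>(b, t). phi_density_da b t)"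
    unfolding phi_density_da_def split_beta by (intro continuous_intros c nz)
qed

lemma phi_density_continuous:
  assumes "a > 1 / 2"
  shows "continuous_on S (phi_density a)" "continuous_on S (phi_density_da a)"
proof -
  have "continuous_on S (\<lambda>t. case (a, t) of (b, t) \<Rightarrow> phi_density b t)"
    by (rule continuous_on_compose2[OF phi_density_joint_continuous(1)]) (use assms in \<open>auto intro!: continuous_intros\<close>)
  then show "continuous_on S (phi_density a)" by simp
  have "continuous_on S (\<lambda>t. case (a, t) of (b, t) \<Rightarrow> phi_density_da b t)"
    by (rule continuous_on_compose2[OF phi_density_joint_continuous(2)]) (use assms in \<open>auto intro!: continuous_intros\<close>)
  then show "continuous_on S (phi_density_da a)" by simp
qed

lemma cat_phi_deriv_s: "a > 1 / 2 \<Longrightarrow> (cat_phi a has_real_derivative phi_density a s) (at s)"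
  unfolding cat_phi_def phi_density_def[symmetric] by (rule LBINT_primitive[OF phi_density_continuous(1)])

lemma phi_da_deriv_s: "a > 1 / 2 \<Longrightarrow> (phi_da a has_real_derivative phi_density_da a s) (at s)"
  unfolding phi_da_def by (rule LBINT_primitive[OF phi_density_continuous(2)])

lemma cat_phi_0: "cat_phi a 0 = 0"
  by (simp add: cat_phi_def zero_ereal_def[symmetric])

lemma phi_da_minus:
  assumes "a > 1 / 2"
  shows "phi_da a (- s) = - phi_da a s"
proof -
  have "((\<lambda>s. phi_da a s + phi_da a (- s)) has_real_derivative phi_density_da a s + phi_density_da a (- s) * (- 1)) (at s)" for s
    by (intro DERIV_add phi_da_deriv_s assms DERIV_chain2[OF phi_da_deriv_s[OF assms]]) (auto intro!: derivative_eq_intros)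
  moreover have "phi_density_da a (- s) = phi_density_da a s" for s
    by (simp add: phi_density_da_def phi_density_def catA_eq catB_eq cat_m_def)
  ultimately have "\<forall>s. ((\<lambda>s. phi_da a s + phi_da a (- s)) has_real_derivative 0) (at s)" by simp
  then have "phi_da a s + phi_da a (- s) = phi_da a 0 + phi_da a (- 0)" by (rule DERIV_isconst_all)
  also have "phi_da a 0 = 0" by (simp add: phi_da_def zero_ereal_def[symmetric])
  finally show ?thesis by (simp add: phi_da_def zero_ereal_def[symmetric])
qed

lemma cat_m_deriv_a: "((\<lambda>b. cat_m b s) has_real_derivative cosh (2 * s)) (at a)"
  unfolding cat_m_def by (auto intro!: derivative_eq_intros)

lemma catB_deriv_a:
  assumes "a > 1 / 2"
  shows "((\<lambda>b. catB b s) has_real_derivative cosh (2 * s) / (2 * catB a s)) (at a)"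
  using DERIV_chain2[OF DERIV_real_sqrt[OF cat_m_pos[OF assms]] cat_m_deriv_a] by (simp add: catB_eq field_simps)

lemma catA_deriv_a:
  assumes "a > 1 / 2"
  shows "((\<lambda>b. catA b s) has_real_derivative cosh (2 * s) / (2 * catA a s)) (at a)"
proof -
  have "((\<lambda>b. cat_m b s + 1) has_real_derivative cosh (2 * s)) (at a)"
    using DERIV_add[OF cat_m_deriv_a DERIV_const] by simp
  moreover have "cat_m a s + 1 > 0" using cat_m_pos[OF assms, of s] by simp
  ultimately show ?thesis using DERIV_chain2[OF DERIV_real_sqrt] by (fastforce simp: catA_eq field_simps)
qed

lemma catK_deriv:
  assumes "a > 1 / 2"
  shows "(catK has_real_derivative a / catK a) (at a)"
proof -
  have "a\<^sup>2 - 1 / 4 > 0" using catK_sq[OF assms] catK_pos[OF assms] by (metis zero_less_power)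
  then have "((\<lambda>a. sqrt (a\<^sup>2 - 1 / 4)) has_real_derivative a / sqrt (a\<^sup>2 - 1 / 4)) (at a)"
    by (auto intro!: derivative_eq_intros simp: field_simps)
  then show ?thesis by (simp add: catK_def[abs_def])
qed

lemma phi_density_deriv_a:
  assumes "a > 1 / 2"
  shows "((\<lambda>b. phi_density b t) has_real_derivative phi_density_da a t) (at a)"
proof -
  note p = catA_gt_1[OF assms, of t] catB_pos[OF assms, of t] catK_pos[OF assms] cat_m_pos[OF assms, of t]
  have "((\<lambda>b. catK b / ((catA b t)\<^sup>2 * catB b t)) has_real_derivative
     ((a / catK a) * ((catA a t)\<^sup>2 * catB a t) - catK a * (2 * (cosh (2 * t) / (2 * catA a t)) * catA a t * catB a t + cosh (2 * t) / (2 * catB a t) * (catA a t)\<^sup>2))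
       / (((catA a t)\<^sup>2 * catB a t) * ((catA a t)\<^sup>2 * catB a t))) (at a)"
    using p by (auto intro!: derivative_eq_intros catA_deriv_a catB_deriv_a catK_deriv assms simp: power2_eq_square)
  also have "((a / catK a) * ((catA a t)\<^sup>2 * catB a t) - catK a * (2 * (cosh (2 * t) / (2 * catA a t)) * catA a t * catB a t + cosh (2 * t) / (2 * catB a t) * (catA a t)\<^sup>2))
       / (((catA a t)\<^sup>2 * catB a t) * ((catA a t)\<^sup>2 * catB a t)) = phi_density_da a t"
  proof -
    have gen: "((a / K) * (A\<^sup>2 * B) - K * (2 * (c / (2 * A)) * A * B + c / (2 * B) * A\<^sup>2)) / ((A\<^sup>2 * B) * (A\<^sup>2 * B))
      = K / (A\<^sup>2 * B) * (a / K\<^sup>2 - c / A\<^sup>2 - c / (2 * B\<^sup>2))" if "A > 0" "B > 0" "K > 0" for A B K c :: real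
      using that by (simp add: divide_simps power2_eq_square) (simp add: algebra_simps)
    show ?thesis
      unfolding phi_density_da_def phi_density_def using gen[of "catA a t" "catB a t" "catK a" "cosh (2 * t)"] p
      by (simp add: catA_sq[OF assms] catB_sq[OF assms])
  qed
  finally show ?thesis by (simp add: phi_density_def)
qed

lemma cat_phi_deriv_a:
  assumes "a > 1 / 2" "s \<ge> 0"
  shows "((\<lambda>b. cat_phi b s) has_real_derivative phi_da a s) (at a)"
proof -
  have eq: "(LBINT t=0..s. p t) = integral (cbox 0 s) p" if "continuous_on UNIV p" for p :: "real \<Rightarrow> real"
    using interval_integral_eq_integral[of 0 s p] assms set_integrable_continuous_Icc[OF continuous_on_subset[OF that, of "{0..s}"]]
    by (simp add: zero_ereal_def)
  have e1: "cat_phi b s = integral (cbox 0 s) (phi_density b)" if "b > 1 / 2" for b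
    unfolding cat_phi_def phi_density_def[symmetric] by (rule eq[OF phi_density_continuous(1)[OF that]])
  have e2: "phi_da a s = integral (cbox 0 s) (phi_density_da a)"
    unfolding phi_da_def by (rule eq[OF phi_density_continuous(2)[OF assms(1)]])
  have "((\<lambda>b. integral (cbox 0 s) (phi_density b)) has_field_derivative integral (cbox 0 s) (phi_density_da a)) (at a within {1 / 2<..})"
  proof (rule leibniz_rule_field_derivative)
    show "((\<lambda>b. phi_density b t) has_real_derivative phi_density_da b t) (at b within {1 / 2<..})" if "b \<in> {1 / 2<..}" for b t
      using phi_density_deriv_a[of b t] that by (auto intro: DERIV_subset)
    show "phi_density b integrable_on cbox 0 s" if "b \<in> {1 / 2<..}" for b
      using that by (intro integrable_continuous phi_density_continuous) auto
    show "continuous_on ({1 / 2<..} \<times> cbox 0 s) (\<lambda>(x, t). phi_density_da x t)"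
      by (rule continuous_on_subset[OF phi_density_joint_continuous(2)]) auto
  qed (use assms in auto)
  then have "((\<lambda>b. integral (cbox 0 s) (phi_density b)) has_field_derivative phi_da a s) (at a)"
    using assms e2 at_within_open[of a "{1 / 2<..}"] by simp
  then show ?thesis
    by (rule has_field_derivative_transform_within_open[of _ _ _ "{1 / 2<..}"]) (use assms e1 in auto)
qed

text \<open>The value of the parametric Jacobi field for \<open>s \<ge> 0\<close>. The formula makes sense for negative \<open>s\<close> and
defines an even function there.\<close>

definition jacobi_profile :: "real \<Rightarrow> real \<Rightarrow> real" where
  "jacobi_profile a s = catK a * cosh (2 * s) / (2 * cat_m a s * (cat_m a s + 1)) - a * sinh (2 * s) / catB a s * phi_da a s"

lemma vector_4:
  "(vector [w, x, y, z] :: 'a::zero ^ 4) $ 1 = w" "(vector [w, x, y, z] :: 'a ^ 4) $ 2 = x"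
  "(vector [w, x, y, z] :: 'a ^ 4) $ 3 = y" "(vector [w, x, y, z] :: 'a ^ 4) $ 4 = z"
  unfolding vector_def by simp_all

text \<open>In the plane of the first two coordinates, the position vector and its \<open>\<phi>\<close>-derivative form a Lorentz
orthogonal frame, so the hyperbolic functions of \<open>\<phi>\<close> cancel.\<close>

lemma jacobi_field_eq:
  assumes "a > 1 / 2" "s \<ge> 0"
  shows "jacobi_field a s \<theta> = jacobi_profile a s"
proof -
  note p = catA_gt_1[OF assms(1), of s] catB_pos[OF assms(1), of s] catK_pos[OF assms(1)] cat_m_pos[OF assms(1), of s]
  let ?A = "catA a s" and ?B = "catB a s" and ?K = "catK a" and ?C = "cosh (cat_phi a s)" and ?S = "sinh (cat_phi a s)"
  let ?c = "cosh (2 * s)" and ?q = "a * sinh (2 * s)" and ?P = "phi_da a s"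
  have X: "cat_X b s \<theta> = (catA b s * cosh (cat_phi b s)) *\<^sub>R axis 1 1 + (catA b s * sinh (cat_phi b s)) *\<^sub>R axis 2 1
      + (catB b s * cos \<theta>) *\<^sub>R axis 3 1 + (catB b s * sin \<theta>) *\<^sub>R axis 4 1" for b
    by (simp add: vec_eq_iff forall_4 cat_X_def axis_def vector_4)
  define d1 where "d1 = ?c / (2 * ?A) * ?C + ?A * (?S * ?P)"
  define d2 where "d2 = ?c / (2 * ?A) * ?S + ?A * (?C * ?P)"
  define d3 where "d3 = ?c / (2 * ?B)"
  have D1: "((\<lambda>b. catA b s * cosh (cat_phi b s)) has_real_derivative d1) (at a)"
    unfolding d1_def by (auto intro!: derivative_eq_intros catA_deriv_a cat_phi_deriv_a assms)
  have D2: "((\<lambda>b. catA b s * sinh (cat_phi b s)) has_real_derivative d2) (at a)"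
    unfolding d2_def by (auto intro!: derivative_eq_intros catA_deriv_a cat_phi_deriv_a assms)
  have D3: "((\<lambda>b. catB b s * x) has_real_derivative d3 * x) (at a)" for x
    unfolding d3_def by (auto intro!: derivative_eq_intros catB_deriv_a assms)
  have sc: "((\<lambda>b. g b *\<^sub>R v) has_vector_derivative g' *\<^sub>R v) (at a)" if "(g has_real_derivative g') (at a)" for g g' and v :: "real ^ 4"
    using has_vector_derivative_scaleR[OF that has_vector_derivative_const[of v]] by simp
  have "((\<lambda>b. cat_X b s \<theta>) has_vector_derivative (d1 *\<^sub>R axis 1 1 + d2 *\<^sub>R axis 2 1 + (d3 * cos \<theta>) *\<^sub>R axis 3 1 + (d3 * sin \<theta>) *\<^sub>R axis 4 1)) (at a)"
    unfolding X by (intro has_vector_derivative_add sc D1 D2 D3)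
  then have vd: "vector_derivative (\<lambda>b. cat_X b s \<theta>) (at a) = d1 *\<^sub>R axis 1 1 + d2 *\<^sub>R axis 2 1 + (d3 * cos \<theta>) *\<^sub>R axis 3 1 + (d3 * sin \<theta>) *\<^sub>R axis 4 1"
    by (rule vector_derivative_at)
  have "jacobi_field a s \<theta> = - d1 * (?K * ?C / ?A - ?q * ?S / (?A * ?B)) + d2 * (?K * ?S / ?A - ?q * ?C / (?A * ?B))
     + d3 * cos \<theta> * (?K / ?B * cos \<theta>) + d3 * sin \<theta> * (?K / ?B * sin \<theta>)"
    unfolding jacobi_field_def vd lorentz_def cat_nu_def by (simp add: axis_def vector_4)
  also have "\<dots> = - d1 * (?K * ?C / ?A - ?q * ?S / (?A * ?B)) + d2 * (?K * ?S / ?A - ?q * ?C / (?A * ?B)) + d3 * (?K / ?B) * ((cos \<theta>)\<^sup>2 + (sin \<theta>)\<^sup>2)"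
    by (simp add: algebra_simps power2_eq_square del: sin_cos_squared_add2 sin_cos_squared_add3)
  also have "\<dots> = - d1 * (?K * ?C / ?A - ?q * ?S / (?A * ?B)) + d2 * (?K * ?S / ?A - ?q * ?C / (?A * ?B)) + d3 * (?K / ?B)" by simp
  also have "- d1 * (?K * ?C / ?A - ?q * ?S / (?A * ?B)) + d2 * (?K * ?S / ?A - ?q * ?C / (?A * ?B))
     = - (?C\<^sup>2 - ?S\<^sup>2) * (?K * ?c / (2 * (?A * ?A)) + ?q * ?P / ?B)"
    unfolding d1_def d2_def using p by (simp add: divide_simps) (simp add: algebra_simps power2_eq_square)
  also have "?C\<^sup>2 - ?S\<^sup>2 = 1" by (simp add: cosh_square_eq)
  also have "- 1 * (?K * ?c / (2 * (?A * ?A)) + ?q * ?P / ?B) + d3 * (?K / ?B) =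
      ?K * ?c / (2 * ?B\<^sup>2 * ?A\<^sup>2) * (?A\<^sup>2 - ?B\<^sup>2) - ?q / ?B * ?P"
    unfolding d3_def using p by (simp add: divide_simps) (simp add: algebra_simps power2_eq_square)
  also have "?A\<^sup>2 - ?B\<^sup>2 = 1" by (simp add: catA_sq[OF assms(1)] catB_sq[OF assms(1)])
  finally show ?thesis by (simp add: jacobi_profile_def catA_sq[OF assms(1)] catB_sq[OF assms(1)])
qed

lemma jacobi_profile_minus: "a > 1 / 2 \<Longrightarrow> jacobi_profile a (- s) = jacobi_profile a s"
  using phi_da_minus[of a s] by (simp add: jacobi_profile_def cat_m_def catB_eq)

section \<open>The Jacobi equation and the third radial eigenvalue\<close>

text \<open>The rational functions \<open>w\<close> and \<open>u\<close> of \<open>m\<close> record the two ingredients of the flux of the Jacobi field: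
\<open>w\<close> comes from differentiating its first summand, \<open>u\<close> is the density of \<open>phi_da\<close> up to the factor \<open>K / (a B)\<close>,
with \<open>k = K\<^sup>2\<close>. The primed versions are their derivatives.\<close>

definition flux_w :: "real \<Rightarrow> real" where "flux_w m = (m\<^sup>2 + m + 1 / 2) / (m * (m + 1)\<^sup>2)"
definition flux_w' :: "real \<Rightarrow> real" where
  "flux_w' m = ((2 * m + 1) * m * (m + 1) - (m\<^sup>2 + m + 1 / 2) * (3 * m + 1)) / (m\<^sup>2 * (m + 1) ^ 3)"
definition flux_u :: "real \<Rightarrow> real \<Rightarrow> real" where
  "flux_u k m = (k + 1 / 4) / (k * (m + 1)) - (2 * m + 1) * (3 * m + 1) / (4 * m * (m + 1)\<^sup>2)"
definition flux_u' :: "real \<Rightarrow> real \<Rightarrow> real" where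
  "flux_u' k m = - (k + 1 / 4) / (k * (m + 1)\<^sup>2) - ((12 * m + 5) * m * (m + 1) - (6 * m\<^sup>2 + 5 * m + 1) * (3 * m + 1)) / (4 * m\<^sup>2 * (m + 1) ^ 3)"

text \<open>What remains of the Jacobi equation once the terms proportional to \<open>phi_da\<close> have cancelled.\<close>

lemma jacobi_rational_identity:
  fixes m k :: real
  assumes "m > 0" "k > 0"
  shows "- (m\<^sup>2 + k) / m * (flux_w m + 2 * flux_u k m) - 2 * (m\<^sup>2 + m - k) * (flux_w' m + flux_u' k m)
     = - m * (2 * k / m\<^sup>2 - 2) * ((2 * m + 1) / (4 * m * (m + 1)))"
proof -
  have "m \<noteq> 0" "k \<noteq> 0" "m + 1 \<noteq> 0" using assms by auto
  then show ?thesis unfolding flux_w_def flux_w'_def flux_u_def flux_u'_def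
    by (simp add: divide_simps) algebra
qed

lemma flux_w_deriv: "m > 0 \<Longrightarrow> (flux_w has_real_derivative flux_w' m) (at m)"
  unfolding flux_w_def[abs_def] flux_w'_def
  by (auto intro!: derivative_eq_intros) (simp add: divide_simps, algebra)

lemma flux_u_deriv: "m > 0 \<Longrightarrow> k > 0 \<Longrightarrow> (flux_u k has_real_derivative flux_u' k m) (at m)"
  unfolding flux_u_def[abs_def] flux_u'_def
  by (auto intro!: derivative_eq_intros) (simp add: divide_simps, algebra)

text \<open>\<open>B\<close> times the \<open>s\<close>-derivative of the Jacobi field.\<close>

definition jacobi_flux :: "real \<Rightarrow> real \<Rightarrow> real" where
  "jacobi_flux a s = - (catK a / a) * (a * sinh (2 * s) / catB a s) * (flux_w (cat_m a s) + flux_u ((catK a)\<^sup>2) (cat_m a s))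
     - (cat_m a s + (catK a)\<^sup>2 / cat_m a s) * phi_da a s"

lemma cosh_eq_m: "a > 1 / 2 \<Longrightarrow> cosh (2 * s) = (2 * cat_m a s + 1) / (2 * a)"
  by (simp add: cat_m_def)

lemma phi_density_da_eq:
  assumes "a > 1 / 2"
  shows "phi_density_da a s = (catK a / a) * flux_u ((catK a)\<^sup>2) (cat_m a s) / catB a s"
proof -
  note p = catB_pos[OF assms, of s] catK_pos[OF assms] cat_m_pos[OF assms, of s]
  have gen: "K / ((m + 1) * R) * (a / K\<^sup>2 - ((2 * m + 1) / (2 * a)) / (m + 1) - ((2 * m + 1) / (2 * a)) / (2 * m)) = (K / a) * flux_u (K\<^sup>2) m / R"
    if "K > 0" "R > 0" "m > 0" "a > 0" and k: "K\<^sup>2 = a\<^sup>2 - 1 / 4" for K R m a :: real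
  proof -
    have "a\<^sup>2 = K\<^sup>2 + 1 / 4" using k by simp
    have nz: "K \<noteq> 0" "R \<noteq> 0" "m \<noteq> 0" "m + 1 \<noteq> 0" "a \<noteq> 0" using that by auto
    have e: "a / K\<^sup>2 = (K\<^sup>2 + 1 / 4) / (a * K\<^sup>2)" using nz k by (simp add: field_simps power2_eq_square)
    show ?thesis unfolding e flux_u_def using nz by (simp add: divide_simps) algebra
  qed
  show ?thesis unfolding phi_density_da_def phi_density_def catA_sq[OF assms] cosh_eq_m[OF assms]
    by (rule gen) (use p assms catK_sq in auto)
qed

text \<open>The function \<open>a sinh 2s / B = B'\<close> is, up to sign, the normal part of the translation Killing field
along the axis; its flux \<open>m + K\<^sup>2/m\<close> is the negative of the coefficient of \<open>phi_da\<close> in \<open>jacobi_flux\<close>.\<close>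

lemma neck_slope_deriv:
  assumes "a > 1 / 2"
  shows "((\<lambda>s. a * sinh (2 * s) / catB a s) has_real_derivative (cat_m a s + (catK a)\<^sup>2 / cat_m a s) / catB a s) (at s)"
proof -
  note p = catB_pos[OF assms, of s] cat_m_pos[OF assms, of s]
  let ?q = "a * sinh (2 * s)" and ?R = "catB a s" and ?m = "cat_m a s"
  have "((\<lambda>s. a * sinh (2 * s) / catB a s) has_real_derivative ((2 * ?m + 1) * ?R - ?q * (?q / ?R)) / (?R * ?R)) (at s)"
  proof (rule DERIV_divide[OF _ catB_deriv[OF assms]])
    show "((\<lambda>s. a * sinh (2 * s)) has_real_derivative 2 * ?m + 1) (at s)"
      by (auto intro!: derivative_eq_intros simp: cat_m_def)
  qed (use p in auto)
  also have "((2 * ?m + 1) * ?R - ?q * (?q / ?R)) / (?R * ?R) = ((2 * ?m + 1) * ?R\<^sup>2 - ?q\<^sup>2) / (?R\<^sup>2 * ?R)"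
    using p by (simp add: field_simps power2_eq_square)
  also have "\<dots> = (?m + (catK a)\<^sup>2 / ?m) / ?R"
    unfolding sinh_sq_eq[OF assms] catB_sq[OF assms] using p by (simp add: field_simps power2_eq_square)
  finally show ?thesis .
qed

lemma jacobi_profile_deriv:
  assumes "a > 1 / 2"
  shows "(jacobi_profile a has_real_derivative jacobi_flux a s / catB a s) (at s)"
proof -
  note p = catB_pos[OF assms, of s] cat_m_pos[OF assms, of s] catK_pos[OF assms]
  let ?q = "a * sinh (2 * s)" and ?R = "catB a s" and ?m = "cat_m a s" and ?K = "catK a" and ?P = "phi_da a s"
  define h where "h m = (2 * m + 1) / (4 * m * (m + 1))" for m :: real
  have hd: "(h has_real_derivative - flux_w m / (2 * m)) (at m)" if "m > 0" for m
    unfolding h_def[abs_def] flux_w_def using that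
    by (auto intro!: derivative_eq_intros) (simp add: divide_simps, algebra)
  have "((\<lambda>s. (?K / a) * h (cat_m a s) - (a * sinh (2 * s) / catB a s) * phi_da a s) has_real_derivative
    (?K / a) * ((- flux_w ?m / (2 * ?m)) * (2 * ?q)) - ((?m + ?K\<^sup>2 / ?m) / ?R * ?P + phi_density_da a s * (?q / ?R))) (at s)"
    by (intro DERIV_diff DERIV_mult DERIV_cmult DERIV_chain2[OF hd cat_m_deriv] neck_slope_deriv phi_da_deriv_s assms p)
  also have "(?K / a) * ((- flux_w ?m / (2 * ?m)) * (2 * ?q)) - ((?m + ?K\<^sup>2 / ?m) / ?R * ?P + phi_density_da a s * (?q / ?R)) = jacobi_flux a s / ?R"
  proof -
    have r: "?R * ?R = ?m" "?R * (?R * x) = ?m * x" for x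
      using catB_sq[OF assms, of s] by (simp_all add: power2_eq_square flip: mult.assoc)
    show ?thesis
      unfolding jacobi_flux_def phi_density_da_eq[OF assms] using p assms
      by (simp add: divide_simps) (simp add: algebra_simps r)
  qed
  also have "(\<lambda>s. (?K / a) * h (cat_m a s) - (a * sinh (2 * s) / catB a s) * phi_da a s) = jacobi_profile a"
    unfolding jacobi_profile_def cosh_eq_m[OF assms] h_def fun_eq_iff by (simp add: field_simps)
  finally show ?thesis .
qed

text \<open>The Jacobi equation for the variation through the catenoid family.\<close>

lemma jacobi_flux_deriv:
  assumes "a > 1 / 2"
  shows "(jacobi_flux a has_real_derivative - catB a s * (cat_II_sq a s - 2) * jacobi_profile a s) (at s)"
proof -
  note p = catB_pos[OF assms, of s] cat_m_pos[OF assms, of s] catK_pos[OF assms]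
  let ?q = "a * sinh (2 * s)" and ?R = "catB a s" and ?m = "cat_m a s" and ?K = "catK a" and ?P = "phi_da a s"
  let ?k = "?K\<^sup>2"
  have k: "?k > 0" using p by simp
  define V where "V = 2 * ?k / ?m\<^sup>2 - 2"
  define h where "h = (2 * ?m + 1) / (4 * ?m * (?m + 1))"
  have V: "cat_II_sq a s - 2 = V"
    using catB_sq[OF assms, of s] by (simp add: V_def cat_II_sq_def power4_eq_xxxx power2_eq_square)
  have d1: "((\<lambda>s. flux_w (cat_m a s) + flux_u ?k (cat_m a s)) has_real_derivative flux_w' ?m * (2 * ?q) + flux_u' ?k ?m * (2 * ?q)) (at s)"
    by (intro DERIV_add DERIV_chain2[OF flux_w_deriv cat_m_deriv] DERIV_chain2[OF flux_u_deriv cat_m_deriv] p k)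
  have d2: "((\<lambda>s. cat_m a s + ?k / cat_m a s) has_real_derivative (1 - ?k / ?m\<^sup>2) * (2 * ?q)) (at s)"
    using p by (auto intro!: derivative_eq_intros cat_m_deriv simp: field_simps power2_eq_square)
  have "(jacobi_flux a has_real_derivative
     - (?K / a) * ((?m + ?k / ?m) / ?R * (flux_w ?m + flux_u ?k ?m) + (flux_w' ?m * (2 * ?q) + flux_u' ?k ?m * (2 * ?q)) * (?q / ?R))
     - ((1 - ?k / ?m\<^sup>2) * (2 * ?q) * ?P + phi_density_da a s * (?m + ?k / ?m))) (at s)"
    unfolding jacobi_flux_def[abs_def] mult.assoc[of "- (?K / a)"]
    by (intro DERIV_diff DERIV_mult[OF neck_slope_deriv[OF assms] d1] DERIV_cmult DERIV_mult[OF d2] phi_da_deriv_s assms)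
  also have "- (?K / a) * ((?m + ?k / ?m) / ?R * (flux_w ?m + flux_u ?k ?m) + (flux_w' ?m * (2 * ?q) + flux_u' ?k ?m * (2 * ?q)) * (?q / ?R))
     - ((1 - ?k / ?m\<^sup>2) * (2 * ?q) * ?P + phi_density_da a s * (?m + ?k / ?m))
     = (?K / a) / ?R * (- (?m\<^sup>2 + ?k) / ?m * (flux_w ?m + 2 * flux_u ?k ?m) - 2 * ?q\<^sup>2 * (flux_w' ?m + flux_u' ?k ?m)) + V * ?q * ?P"
    unfolding phi_density_da_eq[OF assms] V_def using p assms by (simp add: divide_simps) algebra
  also have "\<dots> = (?K / a) / ?R * (- ?m * V * h) + V * ?q * ?P"
    unfolding sinh_sq_eq[OF assms] jacobi_rational_identity[OF p(2) k] V_def h_def ..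
  also have "\<dots> = - ?R * V * ((?K / a) * h - ?q / ?R * ?P)"
    unfolding catB_sq[OF assms, symmetric] using p assms by (simp add: field_simps power2_eq_square)
  also have "(?K / a) * h - ?q / ?R * ?P = jacobi_profile a s"
    unfolding jacobi_profile_def cosh_eq_m[OF assms] h_def by (simp add: field_simps)
  finally show ?thesis unfolding V .
qed

text \<open>The form is positive on functions vanishing at the two end points, so at most two eigenvalues,
counted with multiplicity, are \<open>\<le> 0\<close>.\<close>

lemma third_radial_eigenvalue_pos:
  assumes a: "a > 1 / 2" and l: "cat_s0 a > 0"
    and pos: "\<And>s. s \<in> {0..cat_s0 a} \<Longrightarrow> jacobi_profile a s > 0"
  shows "mu_rad a 2 > 0"
proof -
  let ?l = "cat_s0 a"
  define V where "V s = cat_II_sq a s - 2" for s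
  define C where "C = cosh (cat_r a) / sinh (cat_r a) * catB a ?l"
  have cV: "continuous_on {-?l..?l} V" unfolding V_def cat_II_sq_def
    using catB_pos[OF a] by (intro continuous_intros catB_continuous a) (auto simp: less_imp_neq[symmetric])
  interpret R: robin_form ?l "catB a" V C
    by unfold_locales (use l cV catB_pos catB_continuous a in auto)
  have S: "S_rad a = R.S" unfolding fun_eq_iff S_rad_def R.S_def by (simp add: V_def C_def Let_def)
  have M: "B_inner a = R.M" by (simp add: fun_eq_iff B_inner_def R.M_def)
  have E: "eigenspace a = R.eig" by (simp add: fun_eq_iff eigenspace_def R.eig_def S M)
  have sp: "is_eigenvalue a \<kappa> \<longleftrightarrow> \<kappa> \<in> R.spec" for \<kappa> by (simp add: is_eigenvalue_def R.spec_def E)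
  have mu: "multiplicity_of a = R.mult" by (simp add: fun_eq_iff multiplicity_of_def R.mult_def E)
  have nth: "is_nth_eigenvalue a n = R.nth_eigenvalue n" for n
    by (simp add: fun_eq_iff is_nth_eigenvalue_def R.nth_eigenvalue_def sp mu)
  have pos': "jacobi_profile a s > 0" if "s \<in> {-?l..?l}" for s
    using pos[of s] pos[of "-s"] jacobi_profile_minus[OF a, of s] that by (cases "s \<ge> 0") auto
  have co0: "R.coercive 0 {-?l, ?l}"
  proof (rule R.positive_jacobi_coercive[where f = "jacobi_profile a" and f' = "\<lambda>s. jacobi_flux a s / catB a s"])
    fix s
    show "(jacobi_profile a has_real_derivative jacobi_flux a s / catB a s) (at s within {-?l..?l})"
      using jacobi_profile_deriv[OF a] by (rule DERIV_subset) auto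
    have "(\<lambda>t. catB a t * (jacobi_flux a t / catB a t)) = jacobi_flux a"
      using catB_pos[OF a] by (auto simp: fun_eq_iff less_imp_neq[symmetric])
    then show "((\<lambda>t. catB a t * (jacobi_flux a t / catB a t)) has_real_derivative - catB a s * V s * jacobi_profile a s) (at s within {-?l..?l})"
      using DERIV_subset[OF jacobi_flux_deriv[OF a]] by (simp add: V_def)
  qed (use pos' in auto)
  have "infinite R.spec"
  proof (rule R.infinite_spec)
    show "(catB a has_real_derivative a * sinh (2 * s) / catB a s) (at s within {-?l..?l})" for s
      using catB_deriv[OF a] by (rule DERIV_subset) auto
    show "((\<lambda>s. a * sinh (2 * s) / catB a s) has_real_derivative (cat_m a s + (catK a)\<^sup>2 / cat_m a s) / catB a s) (at s within {-?l..?l})" for s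
      using neck_slope_deriv[OF a] by (rule DERIV_subset) auto
    have "continuous_on {-?l..?l} (cat_m a)"
      using cat_m_deriv by (meson DERIV_continuous continuous_at_imp_continuous_on)
    then show "continuous_on {-?l..?l} (\<lambda>s. (cat_m a s + (catK a)\<^sup>2 / cat_m a s) / catB a s)"
      using catB_pos[OF a] cat_m_pos[OF a] by (intro continuous_intros catB_continuous a) (auto simp: less_imp_neq[symmetric])
  qed
  then obtain \<mu> where \<mu>: "R.nth_eigenvalue 2 \<mu>" using R.nth_eigenvalue_exists[OF R.coercive_exists] by blast
  then have "mu_rad a 2 = \<mu>" unfolding mu_rad_def nth
    using R.nth_eigenvalue_unique[OF R.coercive_exists] by blast
  moreover have "card {-?l, ?l} \<le> 2" by (simp add: card_insert_if)
  ultimately show ?thesis using R.nth_eigenvalue_gt[OF co0 _ \<mu>] by simp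
qed

section \<open>The free boundary and the radius of the ball\<close>

text \<open>The right-hand side of the free boundary equation \<open>tanh \<phi> = B K / (a sinh 2s)\<close>.\<close>

definition free_bdry_rhs :: "real \<Rightarrow> real \<Rightarrow> real" where
  "free_bdry_rhs b s = catB b s * catK b / (b * sinh (2 * s))"

definition free_bdry_defect :: "real \<Rightarrow> real \<Rightarrow> real" where
  "free_bdry_defect b s = tanh (cat_phi b s) - free_bdry_rhs b s"

lemma cat_m_strict_mono: "b > 1 / 2 \<Longrightarrow> 0 \<le> s \<Longrightarrow> s < t \<Longrightarrow> cat_m b s < cat_m b t"
  using cosh_real_strict_mono[of "2 * s" "2 * t"] by (simp add: cat_m_def)

lemma discriminant_pos:
  assumes "b > 1 / 2" "s > 0"
  shows "(cat_m b s)\<^sup>2 + cat_m b s - (catK b)\<^sup>2 > 0"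
  unfolding sinh_sq_eq[OF assms(1), symmetric] using assms by simp

lemma free_bdry_rhs_pos: "b > 1 / 2 \<Longrightarrow> s > 0 \<Longrightarrow> free_bdry_rhs b s > 0"
  unfolding free_bdry_rhs_def using catB_pos[of b s] catK_pos[of b] by simp

lemma free_bdry_rhs_sq:
  assumes "b > 1 / 2"
  shows "(free_bdry_rhs b s)\<^sup>2 = (catK b)\<^sup>2 * cat_m b s / ((cat_m b s)\<^sup>2 + cat_m b s - (catK b)\<^sup>2)"
  unfolding free_bdry_rhs_def power_divide power_mult_distrib[of "catB b s"] catB_sq[OF assms] sinh_sq_eq[OF assms]
  by (simp add: mult.commute)

text \<open>Its square is \<open>K\<^sup>2 m / (m\<^sup>2 + m - K\<^sup>2)\<close>, which decreases in \<open>m\<close>.\<close>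

lemma free_bdry_rhs_strict_antimono:
  assumes b: "b > 1 / 2" and s: "0 < s" "s < t"
  shows "free_bdry_rhs b t < free_bdry_rhs b s"
proof (rule power2_less_imp_less)
  let ?m = "cat_m b s" and ?n = "cat_m b t" and ?k = "(catK b)\<^sup>2"
  have mn: "?m < ?n" using cat_m_strict_mono[OF b] s by simp
  have m: "?m > 0" "?n > 0" using cat_m_pos[OF b] by auto
  have k: "?k > 0" using catK_pos[OF b] by simp
  have d: "?m\<^sup>2 + ?m - ?k > 0" "?n\<^sup>2 + ?n - ?k > 0" using discriminant_pos[OF b] s by auto
  have "?m * (?n\<^sup>2 + ?n - ?k) - ?n * (?m\<^sup>2 + ?m - ?k) = (?m * ?n + ?k) * (?n - ?m)"
    by (simp add: algebra_simps power2_eq_square)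
  also have "\<dots> > 0" using mn m k by (intro mult_pos_pos add_pos_pos) auto
  finally have "?n / (?n\<^sup>2 + ?n - ?k) < ?m / (?m\<^sup>2 + ?m - ?k)" using d by (simp add: divide_simps)
  then have "?k * (?n / (?n\<^sup>2 + ?n - ?k)) < ?k * (?m / (?m\<^sup>2 + ?m - ?k))" using k by (rule mult_strict_left_mono)
  then show "(free_bdry_rhs b t)\<^sup>2 < (free_bdry_rhs b s)\<^sup>2" by (simp add: free_bdry_rhs_sq[OF b])
  show "0 \<le> free_bdry_rhs b s" using free_bdry_rhs_pos[OF b s(1)] by simp
qed

lemma cat_phi_strict_mono:
  assumes "b > 1 / 2" "s < t"
  shows "cat_phi b s < cat_phi b t"
  using DERIV_pos_imp_increasing[OF assms(2)] cat_phi_deriv_s[OF assms(1)] phi_density_pos[OF assms(1)] by blast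

lemma free_bdry_defect_strict_mono:
  assumes "b > 1 / 2" "0 < s" "s < t"
  shows "free_bdry_defect b s < free_bdry_defect b t"
  using free_bdry_rhs_strict_antimono[OF assms] cat_phi_strict_mono[OF assms(1,3)]
  by (simp add: free_bdry_defect_def)  (smt (verit) tanh_real_strict_mono strict_monoD)

lemma free_bdry_defect_continuous:
  assumes "b > 1 / 2" "s1 > 0"
  shows "continuous_on {s1..s2} (free_bdry_defect b)"
proof -
  have c: "continuous_on S (cat_phi b)" for S
    using cat_phi_deriv_s[OF assms(1)] by (meson DERIV_continuous continuous_at_imp_continuous_on)
  have nz: "b * sinh (2 * s) \<noteq> 0" if "s \<in> {s1..s2}" for s using that assms by auto
  show ?thesis unfolding free_bdry_defect_def free_bdry_rhs_def using nz
    by (intro continuous_intros c catB_continuous assms) auto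
qed

text \<open>The right-hand side equals \<open>1 > tanh \<phi>\<close> where \<open>m = K\<^sup>2\<close>, and it tends to \<open>0\<close> while \<open>tanh \<phi>\<close>
increases, so the intermediate value theorem applies.\<close>

lemma free_bdry_defect_zero_exists:
  assumes b: "b > 1 / 2"
  shows "\<exists>s>0. free_bdry_defect b s = 0"
proof -
  let ?k = "(catK b)\<^sup>2"
  have k: "?k > 0" using catK_pos[OF b] by simp
  have kb: "?k = b\<^sup>2 - 1 / 4" by (rule catK_sq[OF b])
  have y1: "b + 1 / (4 * b) > 1"
  proof -
    have "(b - 1 / 2) * (b - 1 / 2) > 0" using b by (intro mult_pos_pos) auto
    then show ?thesis using b by (simp add: field_simps)
  qed
  \<comment> \<open>The point with \<open>m = K\<^sup>2\<close>, where the right-hand side of the equation is \<open>1\<close>.\<close>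
  define s1 where "s1 = arcosh (b + 1 / (4 * b)) / 2"
  have s1: "s1 > 0" using y1 by (simp add: s1_def)
  have m1: "cat_m b s1 = ?k" unfolding cat_m_def s1_def kb using y1 b
    by (simp add: field_simps power2_eq_square)
  have "(free_bdry_rhs b s1)\<^sup>2 = 1" unfolding free_bdry_rhs_sq[OF b] m1 using catK_pos[OF b] by (simp add: power2_eq_square)
  then have "free_bdry_rhs b s1 = 1" using free_bdry_rhs_pos[OF b s1] by (simp add: power2_eq_1_iff)
  then have neg: "free_bdry_defect b s1 \<le> 0" using tanh_real_lt_1[of "cat_phi b s1"] by (simp add: free_bdry_defect_def)
  define \<delta> where "\<delta> = tanh (cat_phi b s1)"
  have \<delta>: "\<delta> > 0" using cat_phi_strict_mono[OF b s1] by (simp add: \<delta>_def cat_phi_0)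
  \<comment> \<open>The second argument makes \<open>m > K\<^sup>2 / \<delta>\<^sup>2\<close>, the first one \<open>s2 \<ge> s1\<close>.\<close>
  define y where "y = max (cosh (2 * s1)) ((?k / \<delta>\<^sup>2 + 1) / b)"
  have yge: "y \<ge> 1" using cosh_real_ge_1[of "2 * s1"] unfolding y_def by linarith
  define s2 where "s2 = arcosh y / 2"
  have cy: "cosh (2 * s2) = y" using yge by (simp add: s2_def)
  have "cosh (2 * s1) \<le> y" by (simp add: y_def)
  then have "arcosh (cosh (2 * s1)) \<le> arcosh y"
    using arcosh_less_iff_real[OF yge cosh_real_ge_1[of "2 * s1"]] by (simp add: not_less[symmetric])
  then have s12: "s1 \<le> s2" using s1 by (simp add: s2_def arcosh_cosh_real)
  have m2: "cat_m b s2 > ?k / \<delta>\<^sup>2"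
  proof -
    have "b * ((?k / \<delta>\<^sup>2 + 1) / b) \<le> b * y" using b by (intro mult_left_mono) (auto simp: y_def)
    then show ?thesis using b by (simp add: cat_m_def cy)
  qed
  have m2k: "cat_m b s2 \<ge> ?k" using cat_m_strict_mono[OF b, of s1 s2] s1 s12 m1 by (cases "s1 = s2") auto
  have m2p: "cat_m b s2 > 0" by (rule cat_m_pos[OF b])
  have "free_bdry_rhs b s2 \<le> \<delta>"
  proof (rule power2_le_imp_le)
    have "(free_bdry_rhs b s2)\<^sup>2 \<le> ?k * cat_m b s2 / (cat_m b s2)\<^sup>2"
      unfolding free_bdry_rhs_sq[OF b] using k m2p m2k discriminant_pos[OF b, of s2] s1 s12
      by (intro divide_left_mono mult_pos_pos) auto
    also have "\<dots> = ?k / cat_m b s2" using m2p by (simp add: power2_eq_square)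
    also have "\<dots> \<le> \<delta>\<^sup>2" using m2 m2p \<delta> by (simp add: field_simps)
    finally show "(free_bdry_rhs b s2)\<^sup>2 \<le> \<delta>\<^sup>2" .
  qed (use \<delta> in auto)
  moreover have "\<delta> \<le> tanh (cat_phi b s2)" using cat_phi_strict_mono[OF b, of s1 s2] s12 by (cases "s1 = s2") (auto simp: \<delta>_def)
  ultimately have pos: "free_bdry_defect b s2 \<ge> 0" by (simp add: free_bdry_defect_def)
  obtain s where "s1 \<le> s" "s \<le> s2" "free_bdry_defect b s = 0"
    using IVT'[of "free_bdry_defect b" s1 0 s2] neg pos s12 free_bdry_defect_continuous[OF b s1] by auto
  then show ?thesis using s1 by (intro exI[of _ s]) auto
qed

lemma free_bdry_defect_zero_unique:
  assumes "b > 1 / 2" "s > 0" "t > 0" "free_bdry_defect b s = free_bdry_defect b t"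
  shows "s = t"
  using free_bdry_defect_strict_mono[OF assms(1,2), of t] free_bdry_defect_strict_mono[OF assms(1,3), of s] assms(4)
  by (cases s t rule: linorder_cases) auto

lemma cat_s0:
  assumes b: "b > 1 / 2"
  shows "cat_s0 b > 0" "free_bdry_defect b (cat_s0 b) = 0"
proof -
  obtain s where s: "s > 0" "free_bdry_defect b s = 0" using free_bdry_defect_zero_exists[OF b] by blast
  have "cat_s0 b = s" unfolding cat_s0_def
  proof (rule the_equality)
    show "s > 0 \<and> tanh (cat_phi b s) = catB b s * catK b / (b * sinh (2 * s))"
      using s by (simp add: free_bdry_defect_def free_bdry_rhs_def)
    show "t = s" if "t > 0 \<and> tanh (cat_phi b t) = catB b t * catK b / (b * sinh (2 * t))" for t
      by (rule free_bdry_defect_zero_unique[OF b _ s(1)]) (use that s in \<open>simp_all add: free_bdry_defect_def free_bdry_rhs_def\<close>)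
  qed
  then show "cat_s0 b > 0" "free_bdry_defect b (cat_s0 b) = 0" using s by auto
qed

text \<open>The partial derivative in \<open>s\<close> is jointly continuous, so a partial derivative in the parameter at the
single point is enough for total differentiability.\<close>

lemma cat_phi_has_derivative:
  assumes "a > 1 / 2" "s > 0"
  shows "((\<lambda>(b, s). cat_phi b s) has_derivative (\<lambda>(h, k). phi_da a s * h + phi_density a s * k)) (at (a, s))"
proof -
  have "((\<lambda>(b, s). cat_phi b s) has_derivative (\<lambda>(h, k). phi_da a s * h + blinfun_apply (blinfun_mult_right (phi_density a s)) k))
     (at (a, s) within {1 / 2<..} \<times> {0<..})"
  proof (rule has_derivative_partialsI)
    show "((\<lambda>b. cat_phi b s) has_derivative (*) (phi_da a s)) (at a within {1 / 2<..})"
      using cat_phi_deriv_a[of a s] assms unfolding has_field_derivative_def by (auto intro: has_derivative_at_withinI)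
    show "(cat_phi b has_derivative blinfun_apply (blinfun_mult_right (phi_density b t))) (at t within {0<..})" if "b \<in> {1 / 2<..}" for b t
      using cat_phi_deriv_s[of b t] that unfolding has_field_derivative_def by (auto intro: has_derivative_at_withinI)
    have "continuous (at (a, s) within {1 / 2<..} \<times> {0<..}) (\<lambda>z. case z of (b, t) \<Rightarrow> phi_density b t)"
    proof -
      have "continuous_on ({1 / 2<..} \<times> {0<..}) (\<lambda>z. case z of (b, t) \<Rightarrow> phi_density b t)"
        by (rule continuous_on_subset[OF phi_density_joint_continuous(1)]) auto
      then show ?thesis unfolding continuous_on_eq_continuous_within by (rule bspec) (use assms in auto)
    qed
    then show "continuous (at (a, s) within {1 / 2<..} \<times> {0<..}) (\<lambda>(b, t). blinfun_mult_right (phi_density b t))"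
      unfolding split_beta by (intro bounded_linear.continuous[OF bounded_linear_blinfun_mult_right])
  qed (use assms in auto)
  moreover have "at (a, s) within {1 / 2<..} \<times> {0<..} = at (a, s)"
    using assms by (intro at_within_open open_Times) auto
  ultimately show ?thesis by simp
qed

lemma differentiable_real_compose:
  fixes h :: "'a::real_normed_vector \<Rightarrow> real"
  assumes "h differentiable (at z)" "(g has_real_derivative D) (at (h z))"
  shows "(\<lambda>z. g (h z)) differentiable (at z)"
  using assms DERIV_compose_FDERIV unfolding differentiable_def by blast

lemma free_bdry_rhs_differentiable:
  assumes "a > 1 / 2" "s > 0"
  shows "(\<lambda>z. free_bdry_rhs (fst z) (snd z)) differentiable (at (a, s))"
proof -
  have p: "a\<^sup>2 - 1 / 4 > 0" using catK_sq[OF assms(1)] catK_pos[OF assms(1)] by (metis zero_less_power)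
  have f: "(\<lambda>z. fst z) differentiable (at (a, s))" "(\<lambda>z. 2 * snd z) differentiable (at (a, s))"
    unfolding differentiable_def by (auto intro!: exI derivative_eq_intros)
  have ch: "(\<lambda>z. cosh (2 * snd z)) differentiable (at (a, s))" "(\<lambda>z. sinh (2 * snd z)) differentiable (at (a, s))"
    by (rule differentiable_real_compose[OF f(2)], auto intro!: derivative_eq_intros)+
  have m: "(\<lambda>z. cat_m (fst z) (snd z)) differentiable (at (a, s))"
    unfolding cat_m_def by (intro differentiable_diff differentiable_mult f ch differentiable_const)
  have k: "(\<lambda>z. (fst z)\<^sup>2 - 1 / 4) differentiable (at (a, s))"
    unfolding power2_eq_square by (intro differentiable_diff differentiable_mult f differentiable_const)
  have R: "(\<lambda>z. catB (fst z) (snd z)) differentiable (at (a, s))" unfolding catB_eq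
    by (rule differentiable_real_compose[OF m DERIV_real_sqrt]) (use cat_m_pos assms in simp)
  have K: "(\<lambda>z. catK (fst z)) differentiable (at (a, s))" unfolding catK_def
    by (rule differentiable_real_compose[OF k DERIV_real_sqrt]) (use p in simp)
  show ?thesis unfolding free_bdry_rhs_def
    using assms by (intro differentiable_divide differentiable_mult R K f ch) auto
qed

text \<open>The \<open>s\<close>-derivative \<open>\<beta>\<close> is positive because the right-hand side of the equation is decreasing in
\<open>s\<close>, while \<open>tanh \<phi>\<close> has positive derivative.\<close>

lemma free_bdry_defect_has_derivative:
  assumes "a > 1 / 2" "s > 0"
  obtains \<alpha> \<beta> where "((\<lambda>(b, s). free_bdry_defect b s) has_derivative (\<lambda>(h, k). \<alpha> * h + \<beta> * k)) (at (a, s))" "\<beta> > 0"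
proof -
  obtain D where D: "((\<lambda>z. free_bdry_rhs (fst z) (snd z)) has_derivative D) (at (a, s))"
    using free_bdry_rhs_differentiable[OF assms] unfolding differentiable_def by blast
  define t where "t = 1 - (tanh (cat_phi a s))\<^sup>2"
  have t: "t > 0" unfolding t_def using tanh_real_bounds[of "cat_phi a s"] by (simp add: abs_square_less_1 abs_less_iff)
  have dt: "(tanh has_derivative (\<lambda>h. t * h)) (at (case (a, s) of (b, s) \<Rightarrow> cat_phi b s))"
  proof -
    have "(tanh has_real_derivative t) (at (cat_phi a s))"
      unfolding t_def by (auto intro!: derivative_eq_intros)
    then show ?thesis by (simp add: has_field_derivative_def)
  qed
  have "((\<lambda>z. tanh (case z of (b, s) \<Rightarrow> cat_phi b s)) has_derivative (\<lambda>z. t * (case z of (h, k) \<Rightarrow> phi_da a s * h + phi_density a s * k))) (at (a, s))"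
    by (rule has_derivative_compose[OF cat_phi_has_derivative[OF assms] dt])
  from has_derivative_diff[OF this D]
  have F: "((\<lambda>(b, s). free_bdry_defect b s) has_derivative (\<lambda>z. t * (case z of (h, k) \<Rightarrow> phi_da a s * h + phi_density a s * k) - D z)) (at (a, s))"
  proof -
    have "(\<lambda>(b, s). free_bdry_defect b s) = (\<lambda>z. tanh (case z of (b, s) \<Rightarrow> cat_phi b s) - free_bdry_rhs (fst z) (snd z))"
      by (auto simp: free_bdry_defect_def)
    with \<open>((\<lambda>z. tanh (case z of (b, s) \<Rightarrow> cat_phi b s) - free_bdry_rhs (fst z) (snd z)) has_derivative
       (\<lambda>z. t * (case z of (h, k) \<Rightarrow> phi_da a s * h + phi_density a s * k) - D z)) (at (a, s))\<close>
    show ?thesis by (simp only:)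
  qed
  interpret D: linear D using D by (rule has_derivative_linear)
  have De: "D (h, k) = D (1, 0) * h + D (0, 1) * k" for h k
    using D.add[of "(h, 0)" "(0, k)"] D.scale[of h "(1, 0)"] D.scale[of k "(0, 1)"] by simp
  have "((\<lambda>s. (a, s)) has_derivative (\<lambda>k. (0, k))) (at s)" by (auto intro!: derivative_eq_intros)
  from has_derivative_compose[OF this D] have "((\<lambda>s. free_bdry_rhs a s) has_derivative (\<lambda>k. D (0, k))) (at s)" by simp
  moreover have "(\<lambda>k. D (0, k)) = (*) (D (0, 1))"
  proof
    show "D (0, k) = D (0, 1) * k" for k using D.scale[of k "(0, 1)"] by simp
  qed
  ultimately have Ds: "(free_bdry_rhs a has_real_derivative D (0, 1)) (at s)" by (simp add: has_field_derivative_def)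
  have D0: "D (0, 1) \<le> 0"
  proof (rule ccontr)
    assume "\<not> ?thesis"
    then obtain d where d: "d > 0" "\<And>h. 0 < h \<Longrightarrow> h < d \<Longrightarrow> free_bdry_rhs a s < free_bdry_rhs a (s + h)"
      using DERIV_pos_inc_right[OF Ds] by auto
    have "free_bdry_rhs a s < free_bdry_rhs a (s + d / 2)" using d(2)[of "d / 2"] d(1) by simp
    then show False using free_bdry_rhs_strict_antimono[of a s "s + d / 2"] assms d(1) by simp
  qed
  have "t * phi_density a s > 0" using t phi_density_pos[OF assms(1)] by simp
  then have "t * phi_density a s - D (0, 1) > 0" using D0 by simp
  moreover have "(\<lambda>z. t * (case z of (h, k) \<Rightarrow> phi_da a s * h + phi_density a s * k) - D z) =
     (\<lambda>(h, k). (t * phi_da a s - D (1, 0)) * h + (t * phi_density a s - D (0, 1)) * k)"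
  proof
    fix z show "t * (case z of (h, k) \<Rightarrow> phi_da a s * h + phi_density a s * k) - D z =
     (case z of (h, k) \<Rightarrow> (t * phi_da a s - D (1, 0)) * h + (t * phi_density a s - D (0, 1)) * k)"
      using De[of "fst z" "snd z"] by (simp add: split_beta algebra_simps)
  qed
  ultimately show ?thesis using that F by simp
qed

text \<open>The implicit function theorem, from the inverse function theorem for the injective map
\<open>(b, s) \<mapsto> (b, defect)\<close>: \<open>(b, s\<^sub>0(b))\<close> is the preimage of \<open>(b, 0)\<close>.\<close>

lemma cat_s0_differentiable:
  assumes a: "a > 1 / 2"
  obtains \<sigma> where "(cat_s0 has_real_derivative \<sigma>) (at a)"
proof -
  let ?S = "{1 / 2<..} \<times> {0<..} :: (real \<times> real) set"
  define f where "f z = (fst z, case z of (b, s) \<Rightarrow> free_bdry_defect b s)" for z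
  define g where "g = the_inv_into ?S f"
  have inj: "inj_on f ?S"
    by (auto simp: inj_on_def f_def intro: free_bdry_defect_zero_unique)
  have gf: "g (f z) = z" if "z \<in> ?S" for z unfolding g_def by (rule the_inv_into_f_f[OF inj that])
  let ?s = "cat_s0 a"
  have s: "?s > 0" using cat_s0[OF a] by simp
  obtain \<alpha> \<beta> where F: "((\<lambda>(b, s). free_bdry_defect b s) has_derivative (\<lambda>(h, k). \<alpha> * h + \<beta> * k)) (at (a, ?s))" and \<beta>: "\<beta> > 0"
    using free_bdry_defect_has_derivative[OF a s] by blast
  have df: "(f has_derivative (\<lambda>z. (fst z, case z of (h, k) \<Rightarrow> \<alpha> * h + \<beta> * k))) (at (a, ?s))"
    unfolding f_def[abs_def] by (intro has_derivative_Pair F has_derivative_fst has_derivative_ident)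
  have cf: "continuous_on ?S f"
  proof (rule continuous_at_imp_continuous_on, rule ballI)
    fix z assume "z \<in> ?S"
    then obtain b t where z: "z = (b, t)" "b > 1 / 2" "t > 0" by auto
    obtain \<alpha>' \<beta>' where "((\<lambda>(b, s). free_bdry_defect b s) has_derivative (\<lambda>(h, k). \<alpha>' * h + \<beta>' * k)) (at (b, t))"
      using free_bdry_defect_has_derivative[OF z(2,3)] by blast
    then have "isCont (\<lambda>(b, s). free_bdry_defect b s) z" using has_derivative_continuous z(1) by blast
    then show "isCont f z" unfolding f_def[abs_def] by (intro continuous_intros)
  qed
  define g' where "g' z = (fst z, (snd z - \<alpha> * fst z) / \<beta>)" for z :: "real \<times> real"
  have "(g has_derivative g') (at (f (a, ?s)))"
  proof (rule has_derivative_inverse_strong[OF _ _ cf gf df])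
    show "open ?S" by (intro open_Times) auto
    show "(a, ?s) \<in> ?S" using a s by auto
    show "(\<lambda>z. (fst z, case z of (h, k) \<Rightarrow> \<alpha> * h + \<beta> * k)) \<circ> g' = id"
      using \<beta> by (auto simp: fun_eq_iff g'_def)
  qed
  moreover have "f (a, ?s) = (a, 0)" using cat_s0[OF a] by (simp add: f_def)
  ultimately have dg: "(g has_derivative g') (at (a, 0))" by simp
  have "((\<lambda>b. (b, 0)) has_derivative (\<lambda>h. (h, 0))) (at a)" by (auto intro!: derivative_eq_intros)
  from has_derivative_snd[OF has_derivative_compose[OF this dg]]
  have "((\<lambda>b. snd (g (b, 0))) has_derivative (\<lambda>h. snd (g' (h, 0)))) (at a)" .
  moreover have "(\<lambda>h. snd (g' (h, 0))) = (*) (- \<alpha> / \<beta>)" by (auto simp: g'_def)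
  ultimately have d: "((\<lambda>b. snd (g (b, 0))) has_real_derivative - \<alpha> / \<beta>) (at a)" by (simp add: has_field_derivative_def)
  have "snd (g (b, 0)) = cat_s0 b" if "b > 1 / 2" for b
  proof -
    have "f (b, cat_s0 b) = (b, 0)" using cat_s0[OF that] by (simp add: f_def)
    then show ?thesis using gf[of "(b, cat_s0 b)"] cat_s0[OF that] that by simp
  qed
  then have "(cat_s0 has_real_derivative - \<alpha> / \<beta>) (at a)"
    using has_field_derivative_transform_within_open[OF d, of "{1 / 2<..}"] a by auto
  then show ?thesis by (rule that)
qed

text \<open>The inequality \<open>m > K\<^sup>2\<close> is just \<open>tanh\<^sup>2 \<phi> < 1\<close>, because
\<open>m\<^sup>2 + m - K\<^sup>2 - K\<^sup>2 m = (m + 1)(m - K\<^sup>2)\<close>.\<close>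

lemma boundary_m_gt:
  assumes b: "b > 1 / 2"
  shows "cat_m b (cat_s0 b) > (catK b)\<^sup>2"
    and "(tanh (cat_phi b (cat_s0 b)))\<^sup>2 = (catK b)\<^sup>2 * cat_m b (cat_s0 b) / ((cat_m b (cat_s0 b))\<^sup>2 + cat_m b (cat_s0 b) - (catK b)\<^sup>2)"
proof -
  let ?m = "cat_m b (cat_s0 b)" and ?k = "(catK b)\<^sup>2" and ?t = "tanh (cat_phi b (cat_s0 b))"
  note s = cat_s0[OF b]
  have "?t = free_bdry_rhs b (cat_s0 b)" using s by (simp add: free_bdry_defect_def)
  then show e: "?t\<^sup>2 = ?k * ?m / (?m\<^sup>2 + ?m - ?k)" by (simp add: free_bdry_rhs_sq[OF b])
  have "?t\<^sup>2 < 1" using tanh_real_bounds[of "cat_phi b (cat_s0 b)"] by (simp add: abs_square_less_1 abs_less_iff)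
  then have "?k * ?m < ?m\<^sup>2 + ?m - ?k" unfolding e using discriminant_pos[OF b s(1)] by simp
  then have "(?m + 1) * (?m - ?k) > 0" by (simp add: algebra_simps power2_eq_square)
  then show "?m > ?k" using cat_m_pos[OF b, of "cat_s0 b"] by (simp add: zero_less_mult_iff)
qed

lemma cat_r_eq:
  assumes b: "b > 1 / 2"
  shows "cat_r b = arcosh (sqrt (1 + (cat_m b (cat_s0 b))\<^sup>2 / (cat_m b (cat_s0 b) - (catK b)\<^sup>2)))"
proof -
  let ?m = "cat_m b (cat_s0 b)" and ?k = "(catK b)\<^sup>2" and ?\<phi> = "cat_phi b (cat_s0 b)"
  define X where "X = catA b (cat_s0 b) * cosh ?\<phi>"
  have mk: "?m - ?k > 0" "?m + 1 > 0" "?m > 0" using boundary_m_gt[OF b] cat_m_pos[OF b, of "cat_s0 b"] by auto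
  have d: "?m\<^sup>2 + ?m - ?k > 0" using discriminant_pos[OF b] cat_s0[OF b] by auto
  have c: "(cosh ?\<phi>)\<^sup>2 * (1 - (tanh ?\<phi>)\<^sup>2) = 1"
  proof -
    have "cosh ?\<phi> * tanh ?\<phi> = sinh ?\<phi>" by (simp add: tanh_def)
    then have "(cosh ?\<phi>)\<^sup>2 * (tanh ?\<phi>)\<^sup>2 = (sinh ?\<phi>)\<^sup>2" by (metis power_mult_distrib)
    then show ?thesis by (simp add: right_diff_distrib cosh_square_eq)
  qed
  have "1 - (tanh ?\<phi>)\<^sup>2 = (?m + 1) * (?m - ?k) / (?m\<^sup>2 + ?m - ?k)"
    unfolding boundary_m_gt(2)[OF b] using d by (simp add: field_simps power2_eq_square)
  then have "(cosh ?\<phi>)\<^sup>2 * ((?m + 1) * (?m - ?k) / (?m\<^sup>2 + ?m - ?k)) = 1" using c by (simp only:)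
  moreover have "x * n = e" if "x * (n / e) = 1" "e > 0" for x n e :: real using that by (simp add: field_simps)
  ultimately have c2: "(cosh ?\<phi>)\<^sup>2 * ((?m + 1) * (?m - ?k)) = ?m\<^sup>2 + ?m - ?k" using d by blast
  have "X\<^sup>2 * (?m - ?k) = (cosh ?\<phi>)\<^sup>2 * ((?m + 1) * (?m - ?k))"
    unfolding X_def power_mult_distrib catA_sq[OF b] by (simp add: mult.commute mult.left_commute)
  then have "X\<^sup>2 * (?m - ?k) = ?m\<^sup>2 + (?m - ?k)" unfolding c2 by simp
  then have "X\<^sup>2 = (?m\<^sup>2 + (?m - ?k)) / (?m - ?k)" using mk(1) by (metis less_irrefl nonzero_eq_divide_eq)
  then have "X\<^sup>2 = 1 + ?m\<^sup>2 / (?m - ?k)" using mk(1) by (simp add: add_divide_distrib)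
  moreover have X1: "X > 1"
  proof -
    have "catA b (cat_s0 b) * 1 \<le> X" unfolding X_def using catA_gt_1[OF b, of "cat_s0 b"] cosh_real_ge_1 by (intro mult_left_mono) auto
    then show ?thesis using catA_gt_1[OF b, of "cat_s0 b"] by simp
  qed
  ultimately have X: "X = sqrt (1 + ?m\<^sup>2 / (?m - ?k))" by (metis less_trans real_sqrt_unique zero_less_one less_imp_le)
  have "cat_r b = arcosh X" unfolding cat_r_def X_def[symmetric]
  proof (rule the_equality)
    show "arcosh X > 0 \<and> cosh (arcosh X) = X" using X1 by simp
    show "\<rho> = arcosh X" if "\<rho> > 0 \<and> cosh \<rho> = X" for \<rho> using that arcosh_cosh_real[of \<rho>] by auto
  qed
  then show ?thesis by (simp only: X)
qed

text \<open>Differentiate \<open>tanh\<^sup>2 \<phi> (m\<^sup>2 + m - K\<^sup>2) = K\<^sup>2 m\<close> along the free boundary curve, eliminate the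
derivative of \<open>s\<^sub>0\<close> in favour of \<open>m'\<close> and the parameter derivative of \<open>\<phi>\<close> in favour of the Jacobi field.\<close>

lemma boundary_m_deriv:
  assumes a: "a > 1 / 2"
  obtains m' where "((\<lambda>b. cat_m b (cat_s0 b)) has_real_derivative m') (at a)"
    and "(catK a)\<^sup>2 * m' = 2 * a * cat_m a (cat_s0 a) + 2 * catK a * (cat_m a (cat_s0 a) - (catK a)\<^sup>2) * jacobi_profile a (cat_s0 a)"
proof -
  obtain \<sigma> where \<sigma>: "(cat_s0 has_real_derivative \<sigma>) (at a)" using cat_s0_differentiable[OF a] by blast
  let ?s = "cat_s0 a"
  have s: "?s > 0" using cat_s0[OF a] by simp
  let ?m = "cat_m a ?s" and ?K = "catK a" and ?q = "a * sinh (2 * ?s)" and ?R = "catB a ?s" and ?c = "cosh (2 * ?s)" and ?P = "phi_da a ?s"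
  let ?t = "tanh (cat_phi a ?s)"
  define m' where "m' = ?c + 2 * ?q * \<sigma>"
  define \<phi>' where "\<phi>' = ?P + phi_density a ?s * \<sigma>"
  have dm: "((\<lambda>b. cat_m b (cat_s0 b)) has_real_derivative m') (at a)"
    unfolding cat_m_def m'_def by (auto intro!: derivative_eq_intros \<sigma>)
  have d\<phi>: "((\<lambda>b. cat_phi b (cat_s0 b)) has_real_derivative \<phi>') (at a)"
  proof -
    have "((\<lambda>b. (b, cat_s0 b)) has_derivative (\<lambda>h. (h, \<sigma> * h))) (at a)"
      using \<sigma> unfolding has_field_derivative_def by (intro has_derivative_Pair has_derivative_ident)
    from has_derivative_compose[OF this cat_phi_has_derivative[OF a s]]
    have "((\<lambda>b. cat_phi b (cat_s0 b)) has_derivative (\<lambda>h. ?P * h + phi_density a ?s * (\<sigma> * h))) (at a)" by simp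
    moreover have "(\<lambda>h. ?P * h + phi_density a ?s * (\<sigma> * h)) = (*) \<phi>'" by (auto simp: \<phi>'_def algebra_simps)
    ultimately show ?thesis by (simp add: has_field_derivative_def)
  qed
  have rel: "(tanh (cat_phi b (cat_s0 b)))\<^sup>2 * ((cat_m b (cat_s0 b))\<^sup>2 + cat_m b (cat_s0 b) - (b\<^sup>2 - 1 / 4)) = (b\<^sup>2 - 1 / 4) * cat_m b (cat_s0 b)"
    if b: "b > 1 / 2" for b
    using boundary_m_gt(2)[OF b] discriminant_pos[OF b cat_s0(1)[OF b]] unfolding catK_sq[OF b] by simp
  define D where "D = ?m\<^sup>2 + ?m - ?K\<^sup>2"
  have D: "D = ?m\<^sup>2 + ?m - (a\<^sup>2 - 1 / 4)" using catK_sq[OF a] by (simp add: D_def)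
  have L: "((\<lambda>b. (tanh (cat_phi b (cat_s0 b)))\<^sup>2 * ((cat_m b (cat_s0 b))\<^sup>2 + cat_m b (cat_s0 b) - (b\<^sup>2 - 1 / 4)))
     has_real_derivative 2 * ?t * (1 - ?t\<^sup>2) * \<phi>' * D + ?t\<^sup>2 * (2 * ?m * m' + m' - 2 * a)) (at a)"
  proof -
    have "(tanh has_real_derivative 1 - ?t\<^sup>2) (at (cat_phi a ?s))" by (auto intro!: derivative_eq_intros)
    from DERIV_power[OF DERIV_chain2[OF this d\<phi>], of 2]
    have d1: "((\<lambda>b. (tanh (cat_phi b (cat_s0 b)))\<^sup>2) has_real_derivative 2 * ?t * (1 - ?t\<^sup>2) * \<phi>') (at a)"
      by (simp add: mult_ac)
    have d2: "((\<lambda>b. (cat_m b (cat_s0 b))\<^sup>2 + cat_m b (cat_s0 b) - (b\<^sup>2 - 1 / 4)) has_real_derivative 2 * ?m * m' + m' - 2 * a) (at a)"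
      by (auto intro!: derivative_eq_intros dm)
    from DERIV_mult[OF d1 d2] show ?thesis unfolding D mult.commute[of "?t\<^sup>2"] .
  qed
  have Rr: "((\<lambda>b. (b\<^sup>2 - 1 / 4) * cat_m b (cat_s0 b)) has_real_derivative 2 * a * ?m + ?K\<^sup>2 * m') (at a)"
    unfolding catK_sq[OF a] by (auto intro!: derivative_eq_intros dm)
  have "((\<lambda>b. (b\<^sup>2 - 1 / 4) * cat_m b (cat_s0 b)) has_real_derivative 2 * ?t * (1 - ?t\<^sup>2) * \<phi>' * D + ?t\<^sup>2 * (2 * ?m * m' + m' - 2 * a)) (at a)"
    by (rule has_field_derivative_transform_within_open[OF L, of "{1 / 2<..}"]) (use a rel in auto)
  then have eq: "2 * ?t * (1 - ?t\<^sup>2) * \<phi>' * D + ?t\<^sup>2 * (2 * ?m * m' + m' - 2 * a) = 2 * a * ?m + ?K\<^sup>2 * m'"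
    using Rr by (rule DERIV_unique)
  have t: "?t = ?R * ?K / ?q" using cat_s0(2)[OF a] by (simp add: free_bdry_defect_def free_bdry_rhs_def)
  note p = catB_pos[OF a, of ?s] catK_pos[OF a] cat_m_pos[OF a, of ?s]
  have q: "?q > 0" using a s by simp
  \<comment> \<open>The elimination, with \<open>n = m'\<close>, \<open>j\<close> the Jacobi field, \<open>R = B\<close> and \<open>q = a sinh (2 s\<^sub>0)\<close>.\<close>
  have alg: "K\<^sup>2 * n = 2 * a * m + 2 * K * (m - K\<^sup>2) * j"
    if e: "2 * t * (1 - t\<^sup>2) * (P + K / ((m + 1) * R) * \<sigma>) * D + t\<^sup>2 * (2 * m * n + n - 2 * a) = 2 * a * m + K\<^sup>2 * n"
      and t: "t = R * K / q" and R: "R\<^sup>2 = m" and D: "D = q\<^sup>2" "q\<^sup>2 = m\<^sup>2 + m - K\<^sup>2"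
      and n: "n = c + 2 * q * \<sigma>" and j: "j = K * c / (2 * m * (m + 1)) - q / R * P"
      and pos: "R > 0" "K > 0" "m > 0" "q > 0"
    for K n m j t P R q c D \<sigma> :: real
  proof -
    have nz: "R \<noteq> 0" "K \<noteq> 0" "m \<noteq> 0" "q \<noteq> 0" "m + 1 \<noteq> 0" using pos by auto
    have tq: "t * q = R * K" using t nz by simp
    have t2: "t\<^sup>2 * q\<^sup>2 = m * K\<^sup>2" using tq R by (metis power_mult_distrib)
    have P: "q * P = R * (K * c / (2 * m * (m + 1)) - j)" using j nz by (simp add: field_simps)
    define \<psi> where "\<psi> = P + K / ((m + 1) * R) * \<sigma>"
    have \<psi>: "2 * m * (m + 1) * q * \<psi> = R * (K * c - 2 * m * (m + 1) * j) + R * K * (n - c)"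
    proof -
      have "2 * m * (m + 1) * q * \<psi> = 2 * m * (m + 1) * (q * P) + (m / R) * K * (2 * q * \<sigma>)"
      proof -
        have "2 * m * (m + 1) * q * (K / ((m + 1) * R) * \<sigma>) = (m / R) * K * (2 * q * \<sigma>)"
          using nz by (simp add: divide_simps)
        then show ?thesis unfolding \<psi>_def by (simp add: distrib_left)
      qed
      also have "m / R = R" using R nz by (simp add: field_simps power2_eq_square)
      also have "2 * m * (m + 1) * (q * P) = R * (K * c - 2 * m * (m + 1) * j)"
        unfolding P using nz by (simp add: divide_simps)
      finally show ?thesis using n by simp
    qed
    have "2 * t * (q\<^sup>2 - t\<^sup>2 * q\<^sup>2) * \<psi> * q\<^sup>2 + (t\<^sup>2 * q\<^sup>2) * (2 * m * n + n - 2 * a) = (2 * a * m + K\<^sup>2 * n) * q\<^sup>2"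
      using arg_cong[OF e, of "\<lambda>x. x * q\<^sup>2"] unfolding D(1) \<psi>_def by (simp add: algebra_simps)
    moreover have "q\<^sup>2 - t\<^sup>2 * q\<^sup>2 = (m + 1) * (m - K\<^sup>2)" unfolding t2 unfolding D(2) by (simp add: algebra_simps power2_eq_square)
    moreover have "2 * t * ((m + 1) * (m - K\<^sup>2)) * \<psi> * q\<^sup>2 = (t * q) * (m - K\<^sup>2) * (2 * (m + 1) * q * \<psi>)" by (simp add: algebra_simps power2_eq_square)
    ultimately have "(R * K) * (m - K\<^sup>2) * (2 * (m + 1) * q * \<psi>) + m * K\<^sup>2 * (2 * m * n + n - 2 * a) = (2 * a * m + K\<^sup>2 * n) * (m\<^sup>2 + m - K\<^sup>2)"
      unfolding t2 tq unfolding D(2) by simp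
    then have "K * (m - K\<^sup>2) * (R * (2 * m * (m + 1) * q * \<psi>)) + m * (m * K\<^sup>2 * (2 * m * n + n - 2 * a)) = m * ((2 * a * m + K\<^sup>2 * n) * (m\<^sup>2 + m - K\<^sup>2))"
      by algebra
    moreover have "R * (2 * m * (m + 1) * q * \<psi>) = m * (K * n - 2 * m * (m + 1) * j)"
    proof -
      have "R * (2 * m * (m + 1) * q * \<psi>) = R\<^sup>2 * (K * n - 2 * m * (m + 1) * j)"
        unfolding \<psi> by (simp add: algebra_simps power2_eq_square)
      then show ?thesis unfolding R .
    qed
    ultimately have "K * (m - K\<^sup>2) * (m * (K * n - 2 * m * (m + 1) * j)) + m * (m * K\<^sup>2 * (2 * m * n + n - 2 * a)) = m * ((2 * a * m + K\<^sup>2 * n) * (m\<^sup>2 + m - K\<^sup>2))"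
      by simp
    then have "m * m * (m + 1) * (K\<^sup>2 * n - (2 * a * m + 2 * K * (m - K\<^sup>2) * j)) = 0"
      by algebra
    then show ?thesis using nz by simp
  qed
  have "?K\<^sup>2 * m' = 2 * a * ?m + 2 * ?K * (?m - ?K\<^sup>2) * jacobi_profile a ?s"
  proof (rule alg[OF _ t])
    show "2 * ?t * (1 - ?t\<^sup>2) * (?P + ?K / ((?m + 1) * ?R) * \<sigma>) * D + ?t\<^sup>2 * (2 * ?m * m' + m' - 2 * a) = 2 * a * ?m + ?K\<^sup>2 * m'"
      using eq unfolding \<phi>'_def phi_density_def catA_sq[OF a] .
  qed (use p q in \<open>auto simp: catB_sq[OF a] D_def sinh_sq_eq[OF a] m'_def jacobi_profile_def\<close>)
  with dm show ?thesis by (rule that)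
qed

text \<open>Differentiate \<open>cosh\<^sup>2 r = 1 + m\<^sup>2/(m - K\<^sup>2)\<close>. The numerator of the derivative is
\<open>m (m' (m - 2 K\<^sup>2) + 2 a m)\<close>, where \<open>2 a\<close> is the derivative of \<open>K\<^sup>2\<close>.\<close>

lemma cat_r_deriv_pos:
  assumes a: "a > 1 / 2" and B: "(catB a (cat_s0 a))\<^sup>2 > 2 * (catK a)\<^sup>2" and j: "jacobi_profile a (cat_s0 a) > 0"
  obtains r' where "(cat_r has_real_derivative r') (at a)" "r' > 0"
proof -
  obtain m' where dm: "((\<lambda>b. cat_m b (cat_s0 b)) has_real_derivative m') (at a)"
    and m': "(catK a)\<^sup>2 * m' = 2 * a * cat_m a (cat_s0 a) + 2 * catK a * (cat_m a (cat_s0 a) - (catK a)\<^sup>2) * jacobi_profile a (cat_s0 a)"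
    using boundary_m_deriv[OF a] by blast
  let ?m = "cat_m a (cat_s0 a)" and ?k = "(catK a)\<^sup>2"
  have k: "?k > 0" "catK a > 0" using catK_pos[OF a] by auto
  have mk: "?m > 2 * ?k" using B catB_sq[OF a] by simp
  have m: "?m > 0" "?m - ?k > 0" using mk k(1) by linarith+
  have "2 * a * ?m > 0" using a m(1) by simp
  moreover have "2 * catK a * (?m - ?k) * jacobi_profile a (cat_s0 a) > 0"
    by (rule mult_pos_pos[OF mult_pos_pos[OF _ m(2)] j]) (use k in simp)
  ultimately have "?k * m' > 0" unfolding m' by (rule add_pos_pos)
  then have m'pos: "m' > 0" using k by (simp add: zero_less_mult_iff)
  define Y where "Y b = 1 + (cat_m b (cat_s0 b))\<^sup>2 / (cat_m b (cat_s0 b) - (b\<^sup>2 - 1 / 4))" for b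
  define Y' where "Y' = ?m * (m' * (?m - 2 * ?k) + 2 * a * ?m) / (?m - ?k)\<^sup>2"
  have "m' * (?m - 2 * ?k) > 0" "2 * a * ?m > 0" using m'pos mk a m by auto
  then have "m' * (?m - 2 * ?k) + 2 * a * ?m > 0" by (rule add_pos_pos)
  then have Y'pos: "Y' > 0" unfolding Y'_def using m by (intro divide_pos_pos mult_pos_pos[OF m(1)]) auto
  have dY: "(Y has_real_derivative Y') (at a)"
  proof -
    have nz: "?m - (a\<^sup>2 - 1 / 4) \<noteq> 0" using m catK_sq[OF a] by simp
    have "(Y has_real_derivative ((2 * m' * ?m) * (?m - (a\<^sup>2 - 1 / 4)) - ?m\<^sup>2 * (m' - 2 * a)) / ((?m - (a\<^sup>2 - 1 / 4)) * (?m - (a\<^sup>2 - 1 / 4)))) (at a)"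
      unfolding Y_def[abs_def] using nz by (auto intro!: derivative_eq_intros dm)
    moreover have "((2 * m' * ?m) * (?m - (a\<^sup>2 - 1 / 4)) - ?m\<^sup>2 * (m' - 2 * a)) / ((?m - (a\<^sup>2 - 1 / 4)) * (?m - (a\<^sup>2 - 1 / 4))) = Y'"
      unfolding Y'_def catK_sq[OF a, symmetric] by (simp add: algebra_simps power2_eq_square)
    ultimately show ?thesis by simp
  qed
  have Y1: "Y a > 1" unfolding Y_def using m catK_sq[OF a] by simp
  define r' where "r' = (1 / sqrt ((sqrt (Y a))\<^sup>2 - 1)) * (inverse (sqrt (Y a)) / 2 * Y')"
  have "((\<lambda>b. arcosh (sqrt (Y b))) has_real_derivative r') (at a)"
  proof -
    have "(arcosh has_real_derivative 1 / sqrt ((sqrt (Y a))\<^sup>2 - 1)) (at (sqrt (Y a)))"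
      using Y1 by (intro arcosh_real_has_field_derivative) auto
    moreover have "((\<lambda>b. sqrt (Y b)) has_real_derivative inverse (sqrt (Y a)) / 2 * Y') (at a)"
      using Y1 by (intro DERIV_chain2[OF DERIV_real_sqrt dY]) auto
    ultimately show ?thesis unfolding r'_def by (rule DERIV_chain2)
  qed
  moreover have "arcosh (sqrt (Y b)) = cat_r b" if "b > 1 / 2" for b
    using cat_r_eq[OF that] catK_sq[OF that] by (simp add: Y_def)
  ultimately have "(cat_r has_real_derivative r') (at a)"
    using has_field_derivative_transform_within_open[of _ r' a "{1 / 2<..}" cat_r] a by auto
  moreover have "r' > 0" unfolding r'_def using Y1 Y'pos by (intro mult_pos_pos divide_pos_pos) auto
  ultimately show ?thesis by (rule that)
qed

theorem theorem10p2:
  fixes a \<theta> :: real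
  assumes "a > 1 / 2"
    and "(catB a (cat_s0 a))\<^sup>2 > 2 * (catK a)\<^sup>2"
    and "\<forall>s\<in>{0..cat_s0 a}. jacobi_field a s \<theta> > 0"
  shows "cat_r differentiable (at a) \<and> deriv cat_r a > 0 \<and> mu_rad a 2 > 0"
proof -
  have s0: "cat_s0 a > 0" using cat_s0[OF assms(1)] by simp
  have pos: "jacobi_profile a s > 0" if "s \<in> {0..cat_s0 a}" for s
  proof -
    have "jacobi_field a s \<theta> > 0" using assms(3) that by blast
    then show ?thesis using jacobi_field_eq[OF assms(1), of s \<theta>] that by simp
  qed
  obtain r' where r: "(cat_r has_real_derivative r') (at a)" "r' > 0"
    using cat_r_deriv_pos[OF assms(1,2) pos[of "cat_s0 a"]] s0 by auto
  have "cat_r differentiable (at a)" using r(1) unfolding has_field_derivative_def differentiable_def by blast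
  moreover have "deriv cat_r a = r'" using r(1) by (rule DERIV_imp_deriv)
  ultimately show ?thesis using r(2) third_radial_eigenvalue_pos[OF assms(1) s0 pos] by simp
qed


end
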